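(* Let $f\in C^2(\mathbb{R})$ satisfy either $f''\le 0$ on $\mathbb{R}$ or $f''\ge 0$ on $\mathbb{R}$, and let $u_0\in BV(\mathbb{R})$. Let $u$ be the entropy admissible solution of the Cauchy problem $\partial_t u+\partial_x[f(u)]=0$, $u(0,\cdot)=u_0$, and set $w:=f\circ u$. Then there is a constant $C$ depending only on $\mathrm{TotVar}\,u_0$ and on $\|f'\|_{L^\infty}:=\max_{u\in[\operatorname{ess\,inf}u_0,\operatorname{ess\,sup}u_0]}|f'(u)|$ such that $$\mathrm{TotVar}\, w(\cdot,x)\le C\big(\mathrm{TotVar}\,u_0,\|f'\|_{L^\infty}\big)\qquad\text{for every }x\in\mathbb{R}.$$
   Context: The entropy admissible solution is the Kružkov solution, i.e. the unique $u\in L^\infty$ satisfying, for every $c\in\mathbb{R}$ and every nonnegative test function $\varphi\in C^\infty_c(]-\infty,+\infty[\times\mathbb{R})$ supported in $t<T$ arbitrary, $\iint \partial_t\varphi|u-c|+\partial_x\varphi\,\mathrm{sign}(u-c)[f(u)-f(c)]\,dx\,dt+\int\varphi(0,\cdot)|u_0-c|\,dx\ge0$. Since $\partial_t u+\partial_x w=0$ in the sense of distributions with $u,w$ bounded, $w$ has a representative such that $x\mapsto w(\cdot,x)$ is continuous from $\mathbb{R}$ into $L^\infty$ in time with the weak$^*$ topology; this representative is used, so that $w(\cdot,x)$ is defined for every $x$. $\mathrm{TotVar}\,w(\cdot,x)$ denotes the total variation of $t\mapsto w(t,x)$ on the time interval $]0,T[$, for any $T>0$ (the constant does not depend on $T$).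 *)

theory Defs
  imports "HOL-Analysis.Analysis" "HOL-Probability.Essential_Supremum"
begin

definition pvar :: "(real \<Rightarrow> real) \<Rightarrow> real set \<Rightarrow> ereal" where
  "pvar g S = (SUP xs \<in> {xs. sorted_wrt (<) xs \<and> set xs \<subseteq> S}.
      ereal (\<Sum>i<length xs - 1. \<bar>g (xs ! Suc i) - g (xs ! i)\<bar>))"

text \<open>Total variation of an (equivalence class of) function(s) on an open interval S:
  the essential variation, i.e. the infimum of the pointwise variation over all
  representatives that agree with g almost everywhere on S.\<close>
definition TotVar :: "(real \<Rightarrow> real) \<Rightarrow> real set \<Rightarrow> ereal" where
  "TotVar g S = (INF h \<in> {h. AE y in lborel. y \<in> S \<longrightarrow> g y = h y}. pvar h S)"

definition BV :: "(real \<Rightarrow> real) \<Rightarrow> bool" where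
  "BV g \<longleftrightarrow> integrable lborel g \<and> TotVar g UNIV < \<infinity>"

definition ess_sup :: "(real \<Rightarrow> real) \<Rightarrow> real" where
  "ess_sup g = real_of_ereal (esssup lborel (\<lambda>x. ereal (g x)))"

definition ess_inf :: "(real \<Rightarrow> real) \<Rightarrow> real" where
  "ess_inf g = - real_of_ereal (esssup lborel (\<lambda>x. ereal (- g x)))"

definition flux_lip :: "(real \<Rightarrow> real) \<Rightarrow> (real \<Rightarrow> real) \<Rightarrow> real" where
  "flux_lip f u0 = Sup ((\<lambda>v. \<bar>deriv f v\<bar>) ` {ess_inf u0 .. ess_sup u0})"

definition C2 :: "(real \<Rightarrow> real) \<Rightarrow> bool" where
  "C2 f \<longleftrightarrow> (\<forall>v. f field_differentiable (at v)) \<and>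
            (\<forall>v. deriv f field_differentiable (at v)) \<and>
            continuous_on UNIV (deriv (deriv f))"

text \<open>C-infinity functions of (t,x): all iterated partial derivatives exist
  (Frechet differentiability at every order, hence continuity of all of them).\<close>
coinductive Cinf :: "(real \<times> real \<Rightarrow> real) \<Rightarrow> bool" where
  "\<lbrakk> \<And>z. (g has_derivative (\<lambda>h. fst h * g1 z + snd h * g2 z)) (at z);
     Cinf g1; Cinf g2 \<rbrakk> \<Longrightarrow> Cinf g"

definition test_fun :: "(real \<times> real \<Rightarrow> real) \<Rightarrow> bool" where
  "test_fun \<phi> \<longleftrightarrow> Cinf \<phi> \<and> compact (closure {z. \<phi> z \<noteq> 0}) \<and> (\<forall>z. 0 \<le> \<phi> z)"

definition dt :: "(real \<times> real \<Rightarrow> real) \<Rightarrow> real \<times> real \<Rightarrow> real" where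
  "dt \<phi> z = deriv (\<lambda>s. \<phi> (s, snd z)) (fst z)"

definition dx :: "(real \<times> real \<Rightarrow> real) \<Rightarrow> real \<times> real \<Rightarrow> real" where
  "dx \<phi> z = deriv (\<lambda>y. \<phi> (fst z, y)) (snd z)"

definition kruzkov_solution ::
    "(real \<Rightarrow> real) \<Rightarrow> (real \<Rightarrow> real) \<Rightarrow> (real \<Rightarrow> real \<Rightarrow> real) \<Rightarrow> bool" where
  "kruzkov_solution f u0 u \<longleftrightarrow>
     set_borel_measurable lborel ({0<..} \<times> UNIV) (\<lambda>z. u (fst z) (snd z)) \<and>
     (\<exists>M. AE z in lborel. z \<in> {0<..} \<times> UNIV \<longrightarrow> \<bar>u (fst z) (snd z)\<bar> \<le> M) \<and>
     (\<forall>c::real. \<forall>\<phi>. test_fun \<phi> \<longrightarrow>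
        (LINT z : {0<..} \<times> UNIV | lborel.
            dt \<phi> z * \<bar>u (fst z) (snd z) - c\<bar>
          + dx \<phi> z * sgn (u (fst z) (snd z) - c) * (f (u (fst z) (snd z)) - f c))
        + (LINT y | lborel. \<phi> (0, y) * \<bar>u0 y - c\<bar>) \<ge> 0)"

text \<open>W is the representative of f o u such that x maps to W(.,x) is continuous from R into
  L-infinity(]0,+oo[) with its weak-* topology (i.e. continuous against every L1 function).\<close>
definition weak_star_rep ::
    "(real \<Rightarrow> real \<Rightarrow> real) \<Rightarrow> (real \<Rightarrow> real \<Rightarrow> real) \<Rightarrow> bool" where
  "weak_star_rep w W \<longleftrightarrow>
     (AE z in lborel. z \<in> {0<..} \<times> UNIV \<longrightarrow> W (fst z) (snd z) = w (fst z) (snd z)) \<and>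
     (\<forall>x. set_borel_measurable lborel {0<..} (\<lambda>t. W t x) \<and>
          (\<exists>M. AE t in lborel. t > 0 \<longrightarrow> \<bar>W t x\<bar> \<le> M)) \<and>
     (\<forall>g. set_integrable lborel {0<..} g \<longrightarrow>
          continuous_on UNIV (\<lambda>x. LINT t : {0<..} | lborel. W t x * g t))"

end

theory Submission
  imports Defs "HOL-Computational_Algebra.Polynomial"
begin

text \<open>
  Replacing \<open>u\<close> by \<open>-u\<close> we may assume \<open>f\<close> convex. Let \<open>V\<close> be the potential of the solution,
  \<open>V\<^sub>x = u\<close> and \<open>V\<^sub>t = - f(u)\<close>, so that the trace \<open>w(\<cdot>, x\<^sub>0)\<close> is minus the derivative of \<open>\<phi>(t) = V(t, x\<^sub>0)\<close>.
  Testing the entropy inequality with functions of \<open>V\<close> itself shows that \<open>V\<close> is a viscosity supersolution of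
  \<open>V\<^sub>t + f(V\<^sub>x) = 0\<close>, hence it is given by the Hopf-Lax formula
  \<open>V(t, x) = min\<^sub>y V\<^sub>0(y) + G(t, x - y)\<close> with \<open>G(t, z) = max\<^sub>p (p z - t f(p))\<close>.

  Split the minimum into the feet \<open>y \<le> x\<^sub>0\<close> and \<open>y \<ge> x\<^sub>0\<close>, so that \<open>\<phi> = min(A, B)\<close>. The optimal foot \<open>y(t)\<close>
  of \<open>A\<close> moves monotonically away from \<open>x\<^sub>0\<close> and \<open>A'(t) = - f(u\<^sub>0(y(t)))\<close>, so \<open>A\<close> is the sum of a concave function
  and of a convex one whose slope varies by at most \<open>\<parallel>f'\<parallel>\<close> times the variation of \<open>u\<^sub>0\<close> to the left of \<open>x\<^sub>0\<close>;
  likewise for \<open>B\<close>. Minima preserve this structure (when a shock crosses \<open>x\<^sub>0\<close> the flux can only jump up), so the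
  decrease of \<open>w(\<cdot>, x\<^sub>0)\<close> is at most \<open>\<parallel>f'\<parallel> TotVar u\<^sub>0\<close>. Its oscillation obeys the same bound, which gives
  \<open>TotVar w(\<cdot>, x\<^sub>0) \<le> 3 \<parallel>f'\<parallel> TotVar u\<^sub>0\<close>.
\<close>

section \<open>Smooth functions and mollification\<close>

text \<open>The flux is only convex, so it is replaced by \<open>f p + e * p\<^sup>2\<close>. Strong
  convexity bounds the Hopf-Lax kernel G from above by touching paraboloids; these tie the optimal
  slope to the datum at the foot and provide the smooth functions with which the supersolution
  property is tested. The datum is averaged over a window of the same length e, so that the
  potential starts from a C^1 function. A convex flux may be affine, and then an unrestricted
  Legendre transform is infinite. Restricting p to [-K, K] with K above the bound of u keeps G
  finite and still steep enough for the minimum over the feet to be attained. The potential is only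
  Lipschitz while test functions must have derivatives of every order, which accounts for the
  smoothness classes and the mollification. As e tends to 0 the derivatives of the approximate
  traces need not converge, but their secant slopes do; hence variation is measured by secants over
  disjoint intervals. The 3 is 2 + 1: a sum of absolute increments is twice the sum of the positive
  ones minus the net increment.\<close>

definition flat_exp :: "real poly \<Rightarrow> real \<Rightarrow> real" where
  "flat_exp P s = (if s > 0 then poly P (1/s) * exp (- (1/s)) else 0)"

lemma poly_mult_exp_minus_tendsto_0:
  "((\<lambda>y::real. poly Q y * exp (- y)) \<longlongrightarrow> 0) at_top"
proof -
  have 1: "((\<lambda>y::real. \<Sum>i\<le>degree Q. coeff Q i * (y ^ i / exp y)) \<longlongrightarrow> (\<Sum>i\<le>degree Q. coeff Q i * 0)) at_top"
    by (intro tendsto_sum tendsto_mult tendsto_const tendsto_power_div_exp_0)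
  have 2: "(\<lambda>y::real. poly Q y * exp (- y)) = (\<lambda>y. \<Sum>i\<le>degree Q. coeff Q i * (y ^ i / exp y))"
    by (auto simp: poly_altdef exp_minus field_simps sum_distrib_right sum_divide_distrib)
  show ?thesis using 1 unfolding 2 by simp
qed

text \<open>The polynomial in 1/s is what makes the family closed under differentiation. Only s = 0
  is delicate: for h > 0 the quotient \<open>flat_exp P h / h\<close> is again a flat function, with
  polynomial X P, and so tends to 0.\<close>

lemma flat_exp_has_derivative:
  "(flat_exp P has_real_derivative flat_exp ([:0,0,1:] * (P - pderiv P)) s) (at s)"
proof -
  consider "s > 0" | "s < 0" | "s = 0" by linarith
  then show ?thesis
  proof cases
    case 1
    have "((\<lambda>s. poly P (1/s) * exp (- (1/s))) has_real_derivative
       poly (pderiv P) (1/s) * (- (1 / (s * s))) * exp (- (1/s)) + exp (- (1/s)) * (1 / (s * s)) * poly P (1/s)) (at s)"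
      using 1 by (auto intro!: derivative_eq_intros DERIV_chain'[where g="poly P" and f="\<lambda>s. 1/s"] poly_DERIV simp: field_simps)
    moreover have "poly (pderiv P) (1/s) * (- (1 / (s * s))) * exp (- (1/s)) + exp (- (1/s)) * (1 / (s * s)) * poly P (1/s)
        = flat_exp ([:0,0,1:] * (P - pderiv P)) s"
      using 1 by (simp add: flat_exp_def field_simps)
    ultimately have "((\<lambda>s. poly P (1/s) * exp (- (1/s))) has_real_derivative flat_exp ([:0,0,1:] * (P - pderiv P)) s) (at s)" by simp
    then show ?thesis
      by (rule has_field_derivative_transform_within_open[where S="{0<..}"]) (use 1 in \<open>auto simp: flat_exp_def\<close>)
  next
    case 2
    have "((\<lambda>s. 0) has_real_derivative flat_exp ([:0,0,1:] * (P - pderiv P)) s) (at s)"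
      using 2 by (auto simp: flat_exp_def)
    then show ?thesis
      by (rule has_field_derivative_transform_within_open[where S="{..<0}"]) (use 2 in \<open>auto simp: flat_exp_def\<close>)
  next
    case 3
    have r: "((\<lambda>h. flat_exp P h / h) \<longlongrightarrow> 0) (at_right 0)"
    proof -
      have "((\<lambda>h. poly ([:0,1:] * P) (1/h) * exp (-(1/h))) \<longlongrightarrow> 0) (at_right (0::real))"
        using poly_mult_exp_minus_tendsto_0[of "[:0,1:] * P"]
        by (auto simp: filterlim_at_top_to_right inverse_eq_divide)
      then show ?thesis
        by (rule Lim_transform_eventually) (auto simp: flat_exp_def eventually_at_filter field_simps)
    qed
    have l: "((\<lambda>h. flat_exp P h / h) \<longlongrightarrow> 0) (at_left 0)"
      by (rule Lim_transform_eventually[OF tendsto_const[of 0]]) (auto simp: flat_exp_def eventually_at_filter)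
    have "((\<lambda>h. flat_exp P h / h) \<longlongrightarrow> 0) (at 0)"
      using r l by (simp add: filterlim_split_at)
    then show ?thesis using 3 by (simp add: DERIV_def flat_exp_def)
  qed
qed

text \<open>\<open>Cinf\<close> is coinductive, so establishing it requires a class closed under
  taking derivatives. Products of the generators give bumps, and the antiderivative rule adds smooth
  step functions.\<close>

inductive smooth1 :: "(real \<Rightarrow> real) \<Rightarrow> bool" where
  smooth1_exp: "smooth1 (\<lambda>x. flat_exp P (a * x + b))"
| smooth1_const: "smooth1 (\<lambda>x. c)"
| smooth1_add: "smooth1 g \<Longrightarrow> smooth1 h \<Longrightarrow> smooth1 (\<lambda>x. g x + h x)"
| smooth1_mult: "smooth1 g \<Longrightarrow> smooth1 h \<Longrightarrow> smooth1 (\<lambda>x. g x * h x)"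
| smooth1_antideriv: "smooth1 g \<Longrightarrow> (\<And>x. (G has_real_derivative g x) (at x)) \<Longrightarrow> smooth1 G"

lemma smooth1_deriv:
  assumes "smooth1 g" shows "\<exists>g'. smooth1 g' \<and> (\<forall>x. (g has_real_derivative g' x) (at x))"
  using assms
proof induction
  case (smooth1_exp P a b)
  show ?case
  proof (intro exI conjI allI)
    show "smooth1 (\<lambda>x. flat_exp ([:0,0,1:] * (P - pderiv P)) (a * x + b) * a)"
      by (intro smooth1.intros)
    show "((\<lambda>x. flat_exp P (a * x + b)) has_real_derivative flat_exp ([:0,0,1:] * (P - pderiv P)) (a * x + b) * a) (at x)" for x
      by (rule DERIV_chain'[OF _ flat_exp_has_derivative]) (auto intro!: derivative_eq_intros)
  qed
next
  case (smooth1_const c)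
  show ?case by (rule exI[of _ "\<lambda>x. 0"]) (auto intro: smooth1.intros(2))
next
  case (smooth1_add g h)
  then obtain g' h' where "smooth1 g'" "smooth1 h'" "\<forall>x. (g has_real_derivative g' x) (at x)" "\<forall>x. (h has_real_derivative h' x) (at x)"
    by blast
  then show ?case by (intro exI[of _ "\<lambda>x. g' x + h' x"]) (auto intro: smooth1.intros(3) DERIV_add)
next
  case (smooth1_mult g h)
  then obtain g' h' where *: "smooth1 g'" "smooth1 h'" "\<forall>x. (g has_real_derivative g' x) (at x)" "\<forall>x. (h has_real_derivative h' x) (at x)"
    by blast
  show ?case 
  proof (intro exI conjI allI)
    show "smooth1 (\<lambda>x. g x * h' x + g' x * h x)"
      using * smooth1_mult by (intro smooth1.intros(3,4)) auto
    show "((\<lambda>x. g x * h x) has_real_derivative g x * h' x + g' x * h x) (at x)" for x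
      using * by (intro DERIV_mult') auto
  qed
next
  case (smooth1_antideriv g G)
  then show ?case by blast
qed

lemma smooth1_continuous: "smooth1 g \<Longrightarrow> continuous_on S g"
  using smooth1_deriv[of g] by (auto intro!: continuous_at_imp_continuous_on intro: DERIV_isCont)

lemma smooth1_ident: "smooth1 (\<lambda>x. x)"
  by (rule smooth1_antideriv[OF smooth1_const[of 1]]) (auto intro!: derivative_eq_intros)

lemma smooth1_shift:
  assumes "smooth1 g" shows "smooth1 (\<lambda>x. g (x + c))"
  using assms
proof induction
  case (smooth1_exp P a b)
  have "smooth1 (\<lambda>x. flat_exp P (a * x + (a * c + b)))" by (rule smooth1.intros)
  then show ?case by (simp add: algebra_simps)
next
  case (smooth1_antideriv g G)
  show ?case
    by (rule smooth1.smooth1_antideriv[OF smooth1_antideriv(3)])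
       (use DERIV_shift smooth1_antideriv(2) in blast)
qed (auto intro: smooth1.intros(2-4))

lemma prod_has_derivative:
  assumes "\<And>x. (g has_real_derivative g' x) (at x)" "\<And>x. (h has_real_derivative h' x) (at x)"
  shows "((\<lambda>z::real\<times>real. g (fst z) * h (snd z)) has_derivative
     (\<lambda>k. fst k * (g' (fst z) * h (snd z)) + snd k * (g (fst z) * h' (snd z)))) (at z)"
proof -
  have a: "((\<lambda>z. g (fst z)) has_derivative (\<lambda>k. g' (fst z) * fst k)) (at z)"
    using has_derivative_compose[OF has_derivative_fst[OF has_derivative_ident] assms(1)[unfolded has_field_derivative_def], of z UNIV] by simp
  have b: "((\<lambda>z. h (snd z)) has_derivative (\<lambda>k. h' (snd z) * snd k)) (at z)"
    using has_derivative_compose[OF has_derivative_snd[OF has_derivative_ident] assms(2)[unfolded has_field_derivative_def], of z UNIV] by simp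
  show ?thesis
    by (rule has_derivative_eq_rhs[OF has_derivative_mult[OF a b]]) (auto simp: algebra_simps)
qed

text \<open>The tensor products of \<open>smooth1\<close> functions form the coinduction invariant:
  both partials of such a product are again of this form.\<close>

lemma Cinf_prod:
  assumes "smooth1 g" "smooth1 h"
  shows "Cinf (\<lambda>z. g (fst z) * h (snd z))"
proof -
  let ?X = "\<lambda>f. \<exists>g h. smooth1 g \<and> smooth1 h \<and> f = (\<lambda>z::real\<times>real. g (fst z) * h (snd z))"
  show ?thesis
  proof (rule Cinf.coinduct[of ?X])
    show "?X (\<lambda>z. g (fst z) * h (snd z))" using assms by blast
    fix x :: "real \<times> real \<Rightarrow> real" assume "?X x"
    then obtain g h where gh: "smooth1 g" "smooth1 h" "x = (\<lambda>z. g (fst z) * h (snd z))" by blast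
    obtain g' where g': "smooth1 g'" "\<And>x. (g has_real_derivative g' x) (at x)" using smooth1_deriv[OF gh(1)] by blast
    obtain h' where h': "smooth1 h'" "\<And>x. (h has_real_derivative h' x) (at x)" using smooth1_deriv[OF gh(2)] by blast
    show "\<exists>g g1 g2. x = g \<and> (\<forall>z. (g has_derivative (\<lambda>h. fst h * g1 z + snd h * g2 z)) (at z)) \<and>
       (?X g1 \<or> Cinf g1) \<and> (?X g2 \<or> Cinf g2)"
    proof (intro exI conjI allI)
      show "x = x" ..
      show "(x has_derivative (\<lambda>k. fst k * (g' (fst z) * h (snd z)) + snd k * (g (fst z) * h' (snd z)))) (at z)" for z
        unfolding gh(3) by (rule prod_has_derivative[OF g'(2) h'(2)])
      show "?X (\<lambda>z. g' (fst z) * h (snd z)) \<or> Cinf (\<lambda>z. g' (fst z) * h (snd z))" using g' gh by blast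
      show "?X (\<lambda>z. g (fst z) * h' (snd z)) \<or> Cinf (\<lambda>z. g (fst z) * h' (snd z))" using h' gh by blast
    qed
  qed
qed

lemma exists_kernel:
  fixes r :: real assumes "r > 0"
  shows "\<exists>k. smooth1 k \<and> (\<forall>t. 0 \<le> k t) \<and> (\<forall>t. r \<le> \<bar>t\<bar> \<longrightarrow> k t = 0) \<and> has_bochner_integral lborel k 1"
proof -
  define b where "b t = flat_exp 1 (1 * t + r) * flat_exp 1 ((-1) * t + r)" for t
  have smb: "smooth1 b" unfolding b_def by (intro smooth1.intros)
  have b0: "0 \<le> b t" for t by (simp add: b_def flat_exp_def)
  have bz: "b t = 0" if "r \<le> \<bar>t\<bar>" for t using that by (auto simp: b_def flat_exp_def abs_if split: if_splits)
  have bp: "b t > 0" if "\<bar>t\<bar> < r" for t using that by (auto simp: b_def flat_exp_def)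
  have cb: "continuous_on UNIV b" by (rule smooth1_continuous[OF smb])
  have ib: "integrable lborel (\<lambda>t. indicator {-r..r} t *\<^sub>R b t)"
    by (rule borel_integrable_compact) (auto intro: continuous_on_subset[OF cb])
  have eq: "(\<lambda>t. indicator {-r..r} t *\<^sub>R b t) = b"
  proof
    fix t show "indicator {-r..r} t *\<^sub>R b t = b t"
      using bz[of t] by (cases "r \<le> \<bar>t\<bar>") (auto simp: indicator_def)
  qed
  have ib: "integrable lborel b" using ib unfolding eq .
  define I where "I = (LINT t|lborel. b t)"
  have "I \<noteq> 0"
  proof
    assume "I = 0"
    then have "AE t in lborel. b t = 0"
      using integral_nonneg_eq_0_iff_AE[OF ib] b0 by (auto simp: I_def)
    then have "AE t in lborel. t \<notin> {-r<..<r}" by eventually_elim (use bp in \<open>force simp: abs_less_iff\<close>)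
    then have "emeasure lborel {-r<..<r} = 0"
      by (subst (asm) AE_iff_measurable[of "{-r<..<r}"]) auto
    then show False using assms by simp
  qed
  moreover have "I \<ge> 0" unfolding I_def by (rule integral_nonneg_AE) (use b0 in auto)
  ultimately have I: "I > 0" by simp
  have "has_bochner_integral lborel (\<lambda>t. b t * (1/I)) (I * (1/I))"
    using ib by (intro has_bochner_integral_mult_left) (auto simp: I_def has_bochner_integral_iff)
  moreover have "smooth1 (\<lambda>t. b t * (1/I))" using smb by (intro smooth1.intros(2,4))
  ultimately show ?thesis using I b0 bz
    by (intro exI[of _ "\<lambda>t. b t * (1/I)"]) auto
qed

section \<open>Convolution with smooth kernels of bounded support\<close>

definition bounded_support :: "('a::real_normed_vector \<Rightarrow> real) \<Rightarrow> bool" where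
  "bounded_support k \<longleftrightarrow> (\<exists>R. \<forall>z. R < norm z \<longrightarrow> k z = 0)"

definition locally_bounded :: "('a::real_normed_vector \<Rightarrow> real) \<Rightarrow> bool" where
  "locally_bounded g \<longleftrightarrow> (\<forall>R. \<exists>B. \<forall>z. norm z \<le> R \<longrightarrow> \<bar>g z\<bar> \<le> B)"

lemma continuous_bounded_support_uniformly_continuous:
  fixes k :: "'a::euclidean_space \<Rightarrow> real"
  assumes "continuous_on UNIV k" "bounded_support k"
  shows "uniformly_continuous_on UNIV k"
proof -
  obtain R where R: "\<And>z. R < norm z \<Longrightarrow> k z = 0" using assms(2) unfolding bounded_support_def by blast
  have u: "uniformly_continuous_on (cball 0 (R+1)) k"
    by (rule compact_uniformly_continuous) (auto intro: continuous_on_subset[OF assms(1)])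
  show ?thesis unfolding uniformly_continuous_on_def
  proof (intro allI impI)
    fix e :: real assume "e > 0"
    then obtain d where d: "d > 0" "\<And>x y. x \<in> cball 0 (R+1) \<Longrightarrow> y \<in> cball 0 (R+1) \<Longrightarrow> dist y x < d \<Longrightarrow> dist (k y) (k x) < e"
      using u unfolding uniformly_continuous_on_def by metis
    show "\<exists>d>0. \<forall>x\<in>UNIV. \<forall>x'\<in>UNIV. dist x' x < d \<longrightarrow> dist (k x') (k x) < e"
    proof (intro exI[of _ "min d 1"] conjI ballI impI)
      fix x y :: 'a assume xy: "dist y x < min d 1"
      show "dist (k y) (k x) < e"
      proof (cases "x \<in> cball 0 (R+1) \<and> y \<in> cball 0 (R+1)")
        case True then show ?thesis using d xy by auto
      next
        case False
        have "norm y \<le> norm x + dist y x" "norm x \<le> norm y + dist y x"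
          using norm_triangle_ineq2[of y x] norm_triangle_ineq2[of x y] by (auto simp: dist_norm norm_minus_commute)
        then have "R < norm x" "R < norm y" using False xy by auto
        then show ?thesis using R \<open>e > 0\<close> by simp
      qed
    qed (use d in auto)
  qed
qed

lemma bounded_support_continuous_bounded:
  fixes k :: "'a::euclidean_space \<Rightarrow> real"
  assumes "continuous_on UNIV k" "bounded_support k"
  shows "\<exists>B. \<forall>z. \<bar>k z\<bar> \<le> B"
proof -
  obtain R where R: "\<And>z. R < norm z \<Longrightarrow> k z = 0" using assms(2) unfolding bounded_support_def by blast
  have "compact (k ` cball 0 R)"
    by (intro compact_continuous_image continuous_on_subset[OF assms(1)]) auto
  then obtain B where B: "\<forall>x\<in>k ` cball 0 R. norm x \<le> B" using compact_imp_bounded bounded_iff by metis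
  show ?thesis
  proof (intro exI allI)
    fix z show "\<bar>k z\<bar> \<le> max B 0"
      using R[of z] B by (cases "R < norm z") (auto simp: le_max_iff_disj)
  qed
qed

lemma continuous_locally_bounded:
  fixes g :: "'a::euclidean_space \<Rightarrow> real"
  assumes "continuous_on UNIV g" shows "locally_bounded g"
  unfolding locally_bounded_def
proof
  fix R
  have "compact (g ` cball 0 R)"
    by (intro compact_continuous_image continuous_on_subset[OF assms(1)]) auto
  then obtain B where B: "\<forall>x\<in>g ` cball 0 R. norm x \<le> B" using compact_imp_bounded bounded_iff by metis
  then show "\<exists>B. \<forall>z. norm z \<le> R \<longrightarrow> \<bar>g z\<bar> \<le> B" by (intro exI[of _ B]) auto
qed

lemma integrable_bounded_support:
  fixes g :: "'a::euclidean_space \<Rightarrow> real"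
  assumes "g \<in> borel_measurable borel" "\<And>z. norm z \<le> R \<Longrightarrow> \<bar>g z\<bar> \<le> B" "\<And>z. R < norm z \<Longrightarrow> g z = 0"
  shows "integrable lborel g"
  by (rule integrableI_bounded_set[where A="cball 0 R" and B=B])
     (use assms emeasure_lborel_cball_finite[of "0::'a" R] in auto)

lemma integrable_conv:
  fixes k \<Psi> :: "'a::euclidean_space \<Rightarrow> real"
  assumes k: "continuous_on UNIV k" "bounded_support k" and P: "\<Psi> \<in> borel_measurable borel" "locally_bounded \<Psi>"
  shows "integrable lborel (\<lambda>y. \<Psi> y * k (y - z))"
proof -
  obtain R where R: "\<And>z. R < norm z \<Longrightarrow> k z = 0" using k(2) unfolding bounded_support_def by blast
  obtain Bk where Bk: "\<And>z. \<bar>k z\<bar> \<le> Bk" using bounded_support_continuous_bounded[OF k] by blast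
  obtain B where B: "\<And>y. norm y \<le> R + norm z \<Longrightarrow> \<bar>\<Psi> y\<bar> \<le> B" using P(2) unfolding locally_bounded_def by blast
  have [measurable]: "k \<in> borel_measurable borel" "\<Psi> \<in> borel_measurable borel"
    using k P by (auto intro: borel_measurable_continuous_onI)
  show ?thesis
  proof (rule integrable_bounded_support[where R="R + norm z" and B="B * Bk"])
    show "norm y \<le> R + norm z \<Longrightarrow> \<bar>\<Psi> y * k (y - z)\<bar> \<le> B * Bk" for y
      unfolding abs_mult using B[of y] Bk[of "y-z"] by (intro mult_mono) auto
    show "R + norm z < norm y \<Longrightarrow> \<Psi> y * k (y - z) = 0" for y
      using R[of "y - z"] norm_triangle_ineq2[of y z] by auto
  qed measurable
qed

lemma gradient_bounded_support:
  assumes "\<And>z. (k has_derivative (\<lambda>h. fst h * k1 z + snd h * k2 z)) (at (z::real\<times>real))"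
    and "bounded_support k"
  shows "bounded_support k1" "bounded_support k2"
proof -
  obtain R where R: "\<And>z. R < norm z \<Longrightarrow> k z = 0" using assms(2) unfolding bounded_support_def by blast
  have "k1 z = 0 \<and> k2 z = 0" if z: "R < norm z" for z
  proof -
    have "open {z::real\<times>real. R < norm z}" by (intro open_Collect_less continuous_intros)
    then have "(k has_derivative (\<lambda>h. 0)) (at z)"
      using z R by (intro has_derivative_transform_within_open[OF has_derivative_const[of 0], where s="{z. R < norm z}"]) auto
    then have "(\<lambda>h. fst h * k1 z + snd h * k2 z) = (\<lambda>h. 0)" 
      using has_derivative_unique assms(1) by blast
    from fun_cong[OF this, of "(1,0)"] fun_cong[OF this, of "(0,1)"] show ?thesis by simp
  qed
  then show "bounded_support k1" "bounded_support k2" unfolding bounded_support_def by blast+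
qed

text \<open>The density \<Psi> is merely measurable and locally bounded, so the derivative must fall
  on the kernel; the minus signs come from its argument y - z. Uniform continuity of the partials
  makes the linearisation error of k small uniformly in y, and it is then integrated over a fixed
  ball.\<close>

lemma conv_has_derivative:
  fixes k :: "real \<times> real \<Rightarrow> real"
  assumes k: "\<And>z. (k has_derivative (\<lambda>h. fst h * k1 z + snd h * k2 z)) (at z)"
    and c: "continuous_on UNIV k1" "continuous_on UNIV k2" and s: "bounded_support k"
    and P: "\<Psi> \<in> borel_measurable borel" "locally_bounded \<Psi>"
  shows "((\<lambda>z. LINT y|lborel. \<Psi> y * k (y - z)) has_derivative
     (\<lambda>h. fst h * (- (LINT y|lborel. \<Psi> y * k1 (y - z))) + snd h * (- (LINT y|lborel. \<Psi> y * k2 (y - z))))) (at z)"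
proof -
  have ck: "continuous_on UNIV k" by (rule has_derivative_continuous_on[OF has_derivative_at_withinI[OF k]])
  note s12 = gradient_bounded_support[OF k s]
  note int = integrable_conv[OF ck s P] integrable_conv[OF c(1) s12(1) P] integrable_conv[OF c(2) s12(2) P]
  obtain R where R: "\<And>z. R < norm z \<Longrightarrow> k z = 0 \<and> k1 z = 0 \<and> k2 z = 0"
  proof -
    obtain R0 R1 R2 where "\<And>z. R0 < norm z \<Longrightarrow> k z = 0" "\<And>z. R1 < norm z \<Longrightarrow> k1 z = 0" "\<And>z. R2 < norm z \<Longrightarrow> k2 z = 0"
      using s s12 unfolding bounded_support_def by blast
    then show ?thesis using that[of "max R0 (max R1 R2)"] by simp
  qed
  obtain B where B: "\<And>y. norm y \<le> R + norm z + 1 \<Longrightarrow> \<bar>\<Psi> y\<bar> \<le> B" using P(2) unfolding locally_bounded_def by blast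
  \<comment> \<open>For |z' - z| < 1 this ball contains the supports of both kernels, the one
    centred at z and the one centred at z'.\<close>
  define S where "S = cball (0::real\<times>real) (R + norm z + 1)"
  define m where "m = measure lborel S"
  have fS: "emeasure lborel S < \<infinity>" unfolding S_def using emeasure_lborel_cball_finite[of "0::real\<times>real" "R + norm z + 1"] by simp
  define B' where "B' = max B 0"
  have lin: "\<bar>k (w - h) - k w + (fst h * k1 w + snd h * k2 w)\<bar> \<le> norm h * e"
    if d: "\<And>x y. dist x y < d \<Longrightarrow> \<bar>k1 x - k1 y\<bar> \<le> e/2" "\<And>x y. dist x y < d \<Longrightarrow> \<bar>k2 x - k2 y\<bar> \<le> e/2" and h: "norm h < d" and e: "e > 0" for w h e d
  proof -
    have "norm (k (w - h) - k w - (\<lambda>h. fst h * k1 w + snd h * k2 w) ((w - h) - w)) \<le> norm ((w - h) - w) * e"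
    proof (rule differentiable_bound_linearization[where S="ball w d" and f'="\<lambda>z h. fst h * k1 z + snd h * k2 z"])
      show "w + t *\<^sub>R (w - h - w) \<in> ball w d" if "t \<in> {0..1}" for t
        using that h mult_right_mono[of t 1 "norm h"] by (auto simp: dist_norm)
      show "(k has_derivative (\<lambda>h. fst h * k1 x + snd h * k2 x)) (at x within ball w d)" for x
        using k by (rule has_derivative_at_withinI)
      show "w \<in> ball w d" using h norm_ge_zero[of h] by (simp del: norm_ge_zero)
      show "onorm ((\<lambda>h. fst h * k1 x + snd h * k2 x) - (\<lambda>h. fst h * k1 w + snd h * k2 w)) \<le> e" if x: "x \<in> ball w d" for x
      proof (rule onorm_le)
        fix h :: "real \<times> real"
        have "\<bar>fst h * (k1 x - k1 w) + snd h * (k2 x - k2 w)\<bar> \<le> \<bar>fst h\<bar> * \<bar>k1 x - k1 w\<bar> + \<bar>snd h\<bar> * \<bar>k2 x - k2 w\<bar>"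
          unfolding abs_mult[symmetric] by (rule abs_triangle_ineq)
        also have "\<dots> \<le> norm h * (e/2) + norm h * (e/2)"
          using d[of x w] x norm_fst_le[of "fst h" "snd h"] norm_snd_le[of "snd h" "fst h"]
          by (intro add_mono mult_mono) (auto simp: dist_commute)
        finally show "norm (((\<lambda>h. fst h * k1 x + snd h * k2 x) - (\<lambda>h. fst h * k1 w + snd h * k2 w)) h) \<le> e * norm h"
          by (simp add: algebra_simps)
      qed
    qed
    then show ?thesis by (simp add: algebra_simps)
  qed
  show ?thesis unfolding has_derivative_at_alt
  proof (intro conjI allI impI)
    show "bounded_linear (\<lambda>h. fst h * - (LINT y|lborel. \<Psi> y * k1 (y - z)) + snd h * - (LINT y|lborel. \<Psi> y * k2 (y - z)))"
      by (rule bounded_linear_add[OF bounded_linear_mult_const[OF bounded_linear_fst] bounded_linear_mult_const[OF bounded_linear_snd]])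
    fix e :: real assume e: "e > 0"
    \<comment> \<open>\<open>B' * m\<close> bounds the integral of |\<Psi>| over S; the added 1
      keeps the denominator positive.\<close>
    define e' where "e' = e / (B' * m + 1)"
    have Bm: "B' * m \<ge> 0" by (simp add: B'_def m_def)
    then have e': "e' > 0" using e unfolding e'_def by (intro divide_pos_pos) auto
    have "\<exists>d>0. \<forall>x\<in>UNIV. \<forall>x'\<in>UNIV. dist x' x < d \<longrightarrow> dist (k1 x') (k1 x) < e'/2"
      using continuous_bounded_support_uniformly_continuous[OF c(1) s12(1)] half_gt_zero[OF e'] unfolding uniformly_continuous_on_def by (elim allE impE)
    then obtain d1 where d1: "d1 > 0" "\<And>x y. dist x y < d1 \<Longrightarrow> \<bar>k1 x - k1 y\<bar> < e'/2"
      by (auto simp: dist_real_def)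
    have "\<exists>d>0. \<forall>x\<in>UNIV. \<forall>x'\<in>UNIV. dist x' x < d \<longrightarrow> dist (k2 x') (k2 x) < e'/2"
      using continuous_bounded_support_uniformly_continuous[OF c(2) s12(2)] half_gt_zero[OF e'] unfolding uniformly_continuous_on_def by (elim allE impE)
    then obtain d2 where d2: "d2 > 0" "\<And>x y. dist x y < d2 \<Longrightarrow> \<bar>k2 x - k2 y\<bar> < e'/2"
      by (auto simp: dist_real_def)
    show "\<exists>d>0. \<forall>z'. norm (z' - z) < d \<longrightarrow>
        norm ((LINT y|lborel. \<Psi> y * k (y - z')) - (LINT y|lborel. \<Psi> y * k (y - z)) -
          (fst (z' - z) * - (LINT y|lborel. \<Psi> y * k1 (y - z)) + snd (z' - z) * - (LINT y|lborel. \<Psi> y * k2 (y - z))))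
        \<le> e * norm (z' - z)"
    proof (intro exI[of _ "min (min d1 d2) 1"] conjI allI impI)
      fix z' assume z': "norm (z' - z) < min (min d1 d2) 1"
      define h where "h = z' - z"
      define r where "r y = \<Psi> y * (k (y - z - h) - k (y - z) + (fst h * k1 (y - z) + snd h * k2 (y - z)))" for y
      have eq: "(LINT y|lborel. \<Psi> y * k (y - z')) - (LINT y|lborel. \<Psi> y * k (y - z)) -
          (fst (z' - z) * - (LINT y|lborel. \<Psi> y * k1 (y - z)) + snd (z' - z) * - (LINT y|lborel. \<Psi> y * k2 (y - z)))
        = (LINT y|lborel. r y)"
      proof -
        have "r = (\<lambda>y. \<Psi> y * k (y - z') - \<Psi> y * k (y - z) + (fst h * (\<Psi> y * k1 (y - z)) + snd h * (\<Psi> y * k2 (y - z))))"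
          by (auto simp: r_def h_def algebra_simps)
        then show ?thesis using int by (simp add: h_def algebra_simps)
      qed
      have "norm (LINT y|lborel. r y) \<le> (LINT y|lborel. indicator S y * (B' * (norm h * e')))"
      proof (rule Bochner_Integration.integral_norm_bound_integral)
        have "r = (\<lambda>y. \<Psi> y * k (y - z') - \<Psi> y * k (y - z) + (fst h * (\<Psi> y * k1 (y - z)) + snd h * (\<Psi> y * k2 (y - z))))"
          by (auto simp: r_def h_def algebra_simps)
        then show "integrable lborel r" using int by (simp add: Bochner_Integration.integrable_add Bochner_Integration.integrable_diff)
        show "integrable lborel (\<lambda>y. indicator S y * (B' * (norm h * e')))"
          using fS unfolding S_def by (intro integrable_mult_left) auto
        show "norm (r y) \<le> indicator S y * (B' * (norm h * e'))" for y
        proof (cases "y \<in> S")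
          case True
          have "\<bar>\<Psi> y\<bar> \<le> B'" using B[of y] True by (auto simp: S_def B'_def)
          moreover have "\<bar>k (y - z - h) - k (y - z) + (fst h * k1 (y - z) + snd h * k2 (y - z))\<bar> \<le> norm h * e'"
            by (rule lin[where d="min d1 d2"]) (use d1 d2 z' e' in \<open>auto simp: h_def less_imp_le\<close>)
          ultimately show ?thesis using True
            by (auto simp: r_def abs_mult B'_def intro!: mult_mono)
        next
          case False
          have "R < norm (y - z)" "R < norm (y - z - h)"
            using False norm_triangle_ineq2[of y z] norm_triangle_ineq2[of y "z+h"] norm_triangle_ineq[of z h] z'
            by (auto simp: S_def h_def algebra_simps)
          then show ?thesis using R False by (simp add: r_def)
        qed
      qed
      also have "\<dots> = (B' * m) * e' * norm h" by (simp add: m_def S_def algebra_simps)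
      also have "\<dots> \<le> e * norm h"
      proof -
        have "(B' * m) * e' \<le> e" using Bm e by (simp add: e'_def field_simps)
        then show ?thesis by (intro mult_right_mono) auto
      qed
      finally show "norm ((LINT y|lborel. \<Psi> y * k (y - z')) - (LINT y|lborel. \<Psi> y * k (y - z)) -
          (fst (z' - z) * - (LINT y|lborel. \<Psi> y * k1 (y - z)) + snd (z' - z) * - (LINT y|lborel. \<Psi> y * k2 (y - z))))
        \<le> e * norm (z' - z)" unfolding eq h_def .
    qed (use d1 d2 in auto)
  qed
qed

lemma Cinf_gradient:
  assumes "Cinf g"
  obtains g1 g2 where "\<And>z. (g has_derivative (\<lambda>h. fst h * g1 z + snd h * g2 z)) (at z)" "Cinf g1" "Cinf g2"
  using assms by (cases rule: Cinf.cases) blast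

lemma Cinf_continuous:
  assumes "Cinf g" shows "continuous_on S g"
proof -
  obtain g1 g2 where g: "\<And>z. (g has_derivative (\<lambda>h. fst h * g1 z + snd h * g2 z)) (at z)"
    using Cinf_gradient[OF assms] by blast
  show ?thesis by (rule has_derivative_continuous_on[OF has_derivative_at_withinI[OF g]])
qed

text \<open>The two-dimensional counterpart of \<open>smooth1\<close>, again closed under partial
  derivatives. Composition and convolution are included because the decisive test function is a flat
  function of a paraboloid minus the mollified potential.\<close>

inductive smooth2 :: "(real \<times> real \<Rightarrow> real) \<Rightarrow> bool" where
  smooth2_Cinf: "Cinf g \<Longrightarrow> smooth2 g"
| smooth2_add: "smooth2 g \<Longrightarrow> smooth2 h \<Longrightarrow> smooth2 (\<lambda>x. g x + h x)"
| smooth2_mult: "smooth2 g \<Longrightarrow> smooth2 h \<Longrightarrow> smooth2 (\<lambda>x. g x * h x)"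
| smooth2_comp: "smooth2 g \<Longrightarrow> smooth1 h \<Longrightarrow> smooth2 (\<lambda>x. h (g x))"
| smooth2_conv: "Cinf k \<Longrightarrow> bounded_support k \<Longrightarrow> \<Psi> \<in> borel_measurable borel \<Longrightarrow> locally_bounded \<Psi> \<Longrightarrow>
    smooth2 (\<lambda>z. LINT y|lborel. \<Psi> y * k (y - z))"

lemma smooth2_const: "smooth2 (\<lambda>z. c)"
  using smooth2_Cinf[OF Cinf_prod[OF smooth1_const[of c] smooth1_const[of 1]]] by simp

lemma smooth2_deriv:
  assumes "smooth2 g" shows "\<exists>g1 g2. smooth2 g1 \<and> smooth2 g2 \<and> (\<forall>z. (g has_derivative (\<lambda>h. fst h * g1 z + snd h * g2 z)) (at z))"
  using assms
proof induction
  case (smooth2_Cinf g)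
  obtain g1 g2 where "\<And>z. (g has_derivative (\<lambda>h. fst h * g1 z + snd h * g2 z)) (at z)" "Cinf g1" "Cinf g2"
    using Cinf_gradient[OF smooth2_Cinf] by blast
  then show ?case by (intro exI[of _ g1] exI[of _ g2]) (simp add: smooth2.smooth2_Cinf)
next
  case (smooth2_add g h)
  then obtain g1 g2 h1 h2 where *: "smooth2 g1" "smooth2 g2" "smooth2 h1" "smooth2 h2"
    "\<And>z. (g has_derivative (\<lambda>h. fst h * g1 z + snd h * g2 z)) (at z)"
    "\<And>z. (h has_derivative (\<lambda>h. fst h * h1 z + snd h * h2 z)) (at z)" by blast
  show ?case
  proof (intro exI conjI allI)
    show "smooth2 (\<lambda>z. g1 z + h1 z)" "smooth2 (\<lambda>z. g2 z + h2 z)" using * by (auto intro: smooth2.smooth2_add)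
    show "((\<lambda>z. g z + h z) has_derivative (\<lambda>k. fst k * (g1 z + h1 z) + snd k * (g2 z + h2 z))) (at z)" for z
      by (rule has_derivative_eq_rhs[OF has_derivative_add[OF *(5,6)]]) (auto simp: algebra_simps)
  qed
next
  case (smooth2_mult g h)
  then obtain g1 g2 h1 h2 where *: "smooth2 g1" "smooth2 g2" "smooth2 h1" "smooth2 h2"
    "\<And>z. (g has_derivative (\<lambda>h. fst h * g1 z + snd h * g2 z)) (at z)"
    "\<And>z. (h has_derivative (\<lambda>h. fst h * h1 z + snd h * h2 z)) (at z)" by blast
  show ?case
  proof (intro exI conjI allI)
    show "smooth2 (\<lambda>z. g z * h1 z + g1 z * h z)" "smooth2 (\<lambda>z. g z * h2 z + g2 z * h z)"
      by (rule smooth2.smooth2_add[OF smooth2.smooth2_mult[OF smooth2_mult(1) *(3)] smooth2.smooth2_mult[OF *(1) smooth2_mult(2)]],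
          rule smooth2.smooth2_add[OF smooth2.smooth2_mult[OF smooth2_mult(1) *(4)] smooth2.smooth2_mult[OF *(2) smooth2_mult(2)]])
    show "((\<lambda>z. g z * h z) has_derivative (\<lambda>k. fst k * (g z * h1 z + g1 z * h z) + snd k * (g z * h2 z + g2 z * h z))) (at z)" for z
      by (rule has_derivative_eq_rhs[OF has_derivative_mult[OF *(5,6)]]) (auto simp: algebra_simps)
  qed
next
  case (smooth2_comp g h)
  then obtain g1 g2 where *: "smooth2 g1" "smooth2 g2"
    "\<And>z. (g has_derivative (\<lambda>h. fst h * g1 z + snd h * g2 z)) (at z)" by blast
  obtain h' where h': "smooth1 h'" "\<And>x. (h has_real_derivative h' x) (at x)" using smooth1_deriv[OF smooth2_comp(2)] by blast
  show ?case
  proof (intro exI conjI allI)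
    show "smooth2 (\<lambda>z. h' (g z) * g1 z)" "smooth2 (\<lambda>z. h' (g z) * g2 z)" by (rule smooth2.smooth2_mult[OF smooth2.smooth2_comp[OF smooth2_comp(1) h'(1)] *(1)], rule smooth2.smooth2_mult[OF smooth2.smooth2_comp[OF smooth2_comp(1) h'(1)] *(2)])
    show "((\<lambda>z. h (g z)) has_derivative (\<lambda>k. fst k * (h' (g z) * g1 z) + snd k * (h' (g z) * g2 z))) (at z)" for z
      by (rule has_derivative_eq_rhs[OF has_derivative_compose[OF *(3) h'(2)[unfolded has_field_derivative_def]]])
         (auto simp: algebra_simps)
  qed
next
  case (smooth2_conv k \<Psi>)
  obtain k1 k2 where k: "\<And>z. (k has_derivative (\<lambda>h. fst h * k1 z + snd h * k2 z)) (at z)" "Cinf k1" "Cinf k2"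
    using Cinf_gradient[OF smooth2_conv(1)] by blast
  note s12 = gradient_bounded_support[OF k(1) smooth2_conv(2)]
  show ?case
  proof (intro exI conjI allI)
    have "smooth2 (\<lambda>z. (-1) * (LINT y|lborel. \<Psi> y * k1 (y - z)))" "smooth2 (\<lambda>z. (-1) * (LINT y|lborel. \<Psi> y * k2 (y - z)))"
      by (rule smooth2.smooth2_mult[OF smooth2_const smooth2.smooth2_conv[OF k(2) s12(1) smooth2_conv(3,4)]],
          rule smooth2.smooth2_mult[OF smooth2_const smooth2.smooth2_conv[OF k(3) s12(2) smooth2_conv(3,4)]])
    then show "smooth2 (\<lambda>z. - (LINT y|lborel. \<Psi> y * k1 (y - z)))" "smooth2 (\<lambda>z. - (LINT y|lborel. \<Psi> y * k2 (y - z)))" by simp_all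
    show "((\<lambda>z. LINT y|lborel. \<Psi> y * k (y - z)) has_derivative
     (\<lambda>h. fst h * (- (LINT y|lborel. \<Psi> y * k1 (y - z))) + snd h * (- (LINT y|lborel. \<Psi> y * k2 (y - z))))) (at z)" for z
      by (rule conv_has_derivative[OF k(1) _ _ smooth2_conv(2,3,4)]) (use k in \<open>auto intro: Cinf_continuous\<close>)
  qed
qed

lemma smooth2_imp_Cinf: "smooth2 g \<Longrightarrow> Cinf g"
proof (rule Cinf.coinduct[of smooth2])
  fix x assume "smooth2 x"
  from smooth2_deriv[OF this] obtain g1 g2 where "smooth2 g1" "smooth2 g2" "\<And>z. (x has_derivative (\<lambda>h. fst h * g1 z + snd h * g2 z)) (at z)" by auto
  then show "\<exists>g g1 g2. x = g \<and> (\<forall>z. (g has_derivative (\<lambda>h. fst h * g1 z + snd h * g2 z)) (at z)) \<and>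
       (smooth2 g1 \<or> Cinf g1) \<and> (smooth2 g2 \<or> Cinf g2)"
    by (intro exI[of _ x] exI[of _ g1] exI[of _ g2]) simp
qed (simp)

lemma dt_dx_eq:
  assumes "(\<phi> has_derivative (\<lambda>h. fst h * g1 + snd h * g2)) (at z)"
  shows "dt \<phi> z = g1" "dx \<phi> z = g2"
proof -
  have "((\<lambda>s. (s, snd z)) has_derivative (\<lambda>s. (s, 0))) (at (fst z))"
    by (intro derivative_intros)
  from has_derivative_compose[OF this, of \<phi> "\<lambda>h. fst h * g1 + snd h * g2"] assms
  have "((\<lambda>s. \<phi> (s, snd z)) has_derivative (\<lambda>s. s * g1)) (at (fst z))" by simp
  then show "dt \<phi> z = g1" unfolding dt_def
    by (intro DERIV_imp_deriv) (simp add: has_field_derivative_def mult.commute[of _ g1])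
  have "((\<lambda>y. (fst z, y)) has_derivative (\<lambda>s. (0, s))) (at (snd z))"
    by (intro derivative_intros)
  from has_derivative_compose[OF this, of \<phi> "\<lambda>h. fst h * g1 + snd h * g2"] assms
  have "((\<lambda>y. \<phi> (fst z, y)) has_derivative (\<lambda>s. s * g2)) (at (snd z))" by simp
  then show "dx \<phi> z = g2" unfolding dx_def
    by (intro DERIV_imp_deriv) (simp add: has_field_derivative_def mult.commute[of _ g2])
qed

section \<open>Convergence of mollifications in L1 and almost everywhere\<close>

lemma cball_borel_measurable[measurable]: "cball (c::'a::euclidean_space) R \<in> sets borel" by simp

lemma integral_translate:
  fixes f :: "'a::euclidean_space \<Rightarrow> real"
  assumes [measurable]: "f \<in> borel_measurable borel"
  shows "(LINT z|lborel. f (z + y)) = (LINT z|lborel. f z)"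
proof -
  have "(LINT z|lborel. f z) = (LINT z|distr lborel borel ((+) y). f z)" by (simp add: lborel_distr_plus)
  also have "\<dots> = (LINT z|lborel. f (y + z))" by (rule integral_distr) auto
  finally show ?thesis by (simp add: add.commute)
qed

lemma nn_integral_translate:
  fixes f :: "'a::euclidean_space \<Rightarrow> ennreal"
  assumes [measurable]: "f \<in> borel_measurable borel"
  shows "(\<integral>\<^sup>+z. f (z + y) \<partial>lborel) = (\<integral>\<^sup>+z. f z \<partial>lborel)"
proof -
  have "(\<integral>\<^sup>+z. f z \<partial>lborel) = (\<integral>\<^sup>+z. f z \<partial>distr lborel borel ((+) y))" by (simp add: lborel_distr_plus)
  also have "\<dots> = (\<integral>\<^sup>+z. f (y + z) \<partial>lborel)" by (rule nn_integral_distr) auto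
  finally show ?thesis by (simp add: add.commute)
qed

text \<open>A measurable function is an a.e. limit of continuous ones. Truncating these at -B and B
  keeps the limit and supplies the dominating function on the ball.\<close>

lemma L1_approx_continuous:
  fixes g :: "'a::euclidean_space \<Rightarrow> real"
  assumes [measurable]: "g \<in> borel_measurable borel" and B: "\<And>z. \<bar>g z\<bar> \<le> B" and e: "e > 0"
  shows "\<exists>c. continuous_on UNIV c \<and> (\<integral>\<^sup>+z. ennreal (indicator (cball 0 R) z * \<bar>c z - g z\<bar>) \<partial>lborel) \<le> ennreal e"
proof -
  have "g \<in> borel_measurable lebesgue" by (rule measurable_completion) simp
  then have "g measurable_on UNIV" by (intro lebesgue_measurable_imp_measurable_on_real) auto
  then obtain N c where N: "negligible N" and c: "\<And>n::nat. continuous_on UNIV (c n)"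
     and lim: "\<And>x. x \<notin> N \<Longrightarrow> (\<lambda>n. c n x) \<longlonglongrightarrow> g x"
    unfolding measurable_on_def by auto
  define d where "d n x = max (-B) (min B (c n x))" for n x
  have B0: "B \<ge> 0" using B[of 0] by linarith
  have dc: "continuous_on UNIV (d n)" for n unfolding d_def by (intro continuous_intros c)
  have [measurable]: "d n \<in> borel_measurable borel" for n by (rule borel_measurable_continuous_onI[OF dc])
  have dB: "\<bar>d n x\<bar> \<le> B" for n x using B0 by (auto simp: d_def)
  have "AE x in lebesgue. x \<notin> N" using N by (intro AE_not_in) (simp add: negligible_iff_null_sets)
  then have "AE x in lborel. x \<notin> N" by (simp add: AE_completion_iff)
  then have ae: "AE x in lborel. (\<lambda>n. indicator (cball 0 R) x * \<bar>d n x - g x\<bar>) \<longlonglongrightarrow> 0"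
  proof eventually_elim
    case (elim x)
    have "(\<lambda>n. d n x) \<longlonglongrightarrow> max (-B) (min B (g x))" unfolding d_def by (intro tendsto_intros lim elim)
    moreover have "max (-B) (min B (g x)) = g x" using B[of x] by (simp add: abs_le_iff min_def max_def)
    ultimately have "(\<lambda>n. d n x) \<longlonglongrightarrow> g x" by simp
    then have "(\<lambda>n. indicator (cball 0 R) x * \<bar>d n x - g x\<bar>) \<longlonglongrightarrow> indicator (cball 0 R) x * \<bar>g x - g x\<bar>"
      by (intro tendsto_intros)
    then show ?case by simp
  qed
  have fin: "emeasure lborel (cball (0::'a) R) < \<infinity>" using emeasure_lborel_cball_finite by blast
  have "(\<lambda>n. LINT x|lborel. indicator (cball 0 R) x * \<bar>d n x - g x\<bar>) \<longlonglongrightarrow> (LINT x|(lborel::'a measure). 0)"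
  proof (rule integral_dominated_convergence[where w="\<lambda>x. indicator (cball 0 R) x * (2 * B)"])
    show "integrable lborel (\<lambda>x::'a. indicator (cball 0 R) x * (2 * B))"
      using fin by (intro integrable_mult_left) auto
    show "AE x in lborel. norm (indicator (cball 0 R) x * \<bar>d n x - g x\<bar>) \<le> indicator (cball 0 R) x * (2 * B)" for n
    proof (intro AE_I2)
      fix x show "norm (indicator (cball 0 R) x * \<bar>d n x - g x\<bar>) \<le> indicator (cball 0 R) x * (2 * B)"
        using dB[of n x] B[of x] by (auto simp: indicator_def)
    qed
  qed (use ae in auto)
  then have "\<forall>\<^sub>F n in sequentially. (LINT x|lborel. indicator (cball 0 R) x * \<bar>d n x - g x\<bar>) < e"
    using e by (auto dest: order_tendstoD)
  then obtain n where n: "(LINT x|lborel. indicator (cball 0 R) x * \<bar>d n x - g x\<bar>) < e"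
    by (auto simp: eventually_sequentially)
  have int: "integrable lborel (\<lambda>x. indicator (cball 0 R) x * \<bar>d n x - g x\<bar>)"
  proof (rule integrable_bounded_support[where R=R and B="2*B"])
    show "\<bar>indicator (cball 0 R) x * \<bar>d n x - g x\<bar>\<bar> \<le> 2 * B" for x
      using dB[of n x] B[of x] B0 by (auto simp: indicator_def)
    show "(\<lambda>x. indicator (cball 0 R) x * \<bar>d n x - g x\<bar>) \<in> borel_measurable borel" by measurable
  qed auto
  have "(\<integral>\<^sup>+z. ennreal (indicator (cball 0 R) z * \<bar>d n z - g z\<bar>) \<partial>lborel) \<le> ennreal e"
    using n by (subst nn_integral_eq_integral[OF int]) (auto intro!: ennreal_leI)
  then show ?thesis using dc by blast
qed

text \<open>Three errors of e/3: replacing g by a continuous c at z + y and at z, which cost the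
  same by translation invariance, and moving c itself. The ball is enlarged by 1 so that it contains
  z + y as well as z.\<close>

lemma L1_translation_continuous:
  fixes g :: "'a::euclidean_space \<Rightarrow> real"
  assumes g[measurable]: "g \<in> borel_measurable borel" and B: "\<And>z. \<bar>g z\<bar> \<le> B" and e: "e > 0"
  shows "\<exists>d>0. \<forall>y. norm y < d \<longrightarrow> (\<integral>\<^sup>+z. ennreal (indicator (cball 0 R) z * \<bar>g (z + y) - g z\<bar>) \<partial>lborel) \<le> ennreal e"
proof -
  define m where "m = measure lborel (cball (0::'a) R)"
  have fin: "emeasure lborel (cball (0::'a) R) < \<infinity>" using emeasure_lborel_cball_finite by blast
  have m: "emeasure lborel (cball (0::'a) R) = ennreal m" using fin by (simp add: m_def emeasure_eq_ennreal_measure)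
  have m0: "m \<ge> 0" by (simp add: m_def)
  obtain c where c: "continuous_on UNIV c" and cg: "(\<integral>\<^sup>+z. ennreal (indicator (cball 0 (R+1)) z * \<bar>c z - g z\<bar>) \<partial>lborel) \<le> ennreal (e/3)"
    using L1_approx_continuous[OF g B, of "e/3" "R+1"] e by auto
  have [measurable]: "c \<in> borel_measurable borel" by (rule borel_measurable_continuous_onI[OF c])
  have "uniformly_continuous_on (cball 0 (R+1)) c"
    by (rule compact_uniformly_continuous) (auto intro: continuous_on_subset[OF c])
  moreover have "e / (3 * (m + 1)) > 0" using e m0 by simp
  ultimately obtain d where d: "d > 0" "\<And>x y. x \<in> cball 0 (R+1) \<Longrightarrow> y \<in> cball 0 (R+1) \<Longrightarrow> dist y x < d \<Longrightarrow> dist (c y) (c x) < e / (3 * (m + 1))"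
    unfolding uniformly_continuous_on_def by metis
  show ?thesis
  proof (intro exI[of _ "min d 1"] conjI allI impI)
    fix y :: 'a assume y: "norm y < min d 1"
    let ?I = "\<lambda>z::'a. indicator (cball 0 R) z :: real" and ?J = "\<lambda>z::'a. indicator (cball 0 (R+1)) z :: real"
    have pt: "?I z * \<bar>g (z + y) - g z\<bar> \<le> ?J (z + y) * \<bar>c (z + y) - g (z + y)\<bar> + (?J z * \<bar>c z - g z\<bar> + ?I z * (e / (3 * (m + 1))))" for z
    proof (cases "z \<in> cball 0 R")
      case True
      have "norm (z + y) \<le> R + 1" using norm_triangle_ineq[of z y] True y by simp
      then have in1: "z + y \<in> cball 0 (R+1)" "z \<in> cball 0 (R+1)" using True by auto
      have "dist (c (z+y)) (c z) < e / (3 * (m + 1))" using d(2)[OF in1(2,1)] y by (simp add: dist_norm)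
      then show ?thesis using in1 True by (simp add: dist_real_def)
    next
      case False
      then show ?thesis by (auto simp: indicator_def)
    qed
    have e3: "e / (3 * (m + 1)) \<ge> 0" using e m0 by simp
    have "(\<integral>\<^sup>+z. ennreal (?I z * \<bar>g (z + y) - g z\<bar>) \<partial>lborel) \<le> (\<integral>\<^sup>+z. ennreal (?J (z + y) * \<bar>c (z + y) - g (z + y)\<bar>) + (ennreal (?J z * \<bar>c z - g z\<bar>) + ennreal (?I z * (e / (3 * (m + 1))))) \<partial>lborel)"
      
    proof (intro nn_integral_mono)
      fix z
      have "ennreal (?I z * \<bar>g (z + y) - g z\<bar>) \<le> ennreal (?J (z + y) * \<bar>c (z + y) - g (z + y)\<bar> + (?J z * \<bar>c z - g z\<bar> + ?I z * (e / (3 * (m + 1)))))"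
        by (rule ennreal_leI[OF pt])
      also have "\<dots> = ennreal (?J (z + y) * \<bar>c (z + y) - g (z + y)\<bar>) + (ennreal (?J z * \<bar>c z - g z\<bar>) + ennreal (?I z * (e / (3 * (m + 1)))))"
        using e3 by (simp only: ennreal_plus mult_nonneg_nonneg indicator_pos_le abs_ge_zero add_nonneg_nonneg)
      finally show "ennreal (?I z * \<bar>g (z + y) - g z\<bar>) \<le> \<dots>" .
    qed
    also have "\<dots> = (\<integral>\<^sup>+z. ennreal (?J (z + y) * \<bar>c (z + y) - g (z + y)\<bar>) \<partial>lborel) + ((\<integral>\<^sup>+z. ennreal (?J z * \<bar>c z - g z\<bar>) \<partial>lborel) + (\<integral>\<^sup>+z. ennreal (?I z * (e / (3 * (m + 1)))) \<partial>lborel))"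
    proof -
      have [measurable]: "(\<lambda>z. ennreal (?J (z + y) * \<bar>c (z + y) - g (z + y)\<bar>)) \<in> borel_measurable lborel"
        "(\<lambda>z. ennreal (?J z * \<bar>c z - g z\<bar>)) \<in> borel_measurable lborel" 
        "(\<lambda>z. ennreal (?I z * (e / (3 * (m + 1))))) \<in> borel_measurable lborel" by measurable
      show ?thesis by (subst nn_integral_add, measurable, subst nn_integral_add, measurable)
    qed
    also have "(\<integral>\<^sup>+z. ennreal (?J (z + y) * \<bar>c (z + y) - g (z + y)\<bar>) \<partial>lborel) = (\<integral>\<^sup>+z. ennreal (?J z * \<bar>c z - g z\<bar>) \<partial>lborel)"
      by (rule nn_integral_translate) measurable
    also have "(\<integral>\<^sup>+z. ennreal (?I z * (e / (3 * (m + 1)))) \<partial>lborel) = ennreal (m * (e / (3 * (m + 1))))"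
    proof -
      have "(\<integral>\<^sup>+z. ennreal (?I z * (e / (3 * (m + 1)))) \<partial>lborel) = (\<integral>\<^sup>+z. ennreal (e / (3 * (m + 1))) * indicator (cball 0 R) z \<partial>(lborel::'a measure))"
        by (rule nn_integral_cong) (auto simp: indicator_def)
      also have "\<dots> = ennreal (e / (3 * (m + 1))) * ennreal m" by (subst nn_integral_cmult_indicator) (auto simp: m)
      finally show ?thesis using m0 e3 by (simp add: ennreal_mult[symmetric] mult.commute)
    qed
    also have "(\<integral>\<^sup>+z. ennreal (?J z * \<bar>c z - g z\<bar>) \<partial>lborel) + ((\<integral>\<^sup>+z. ennreal (?J z * \<bar>c z - g z\<bar>) \<partial>lborel) + ennreal (m * (e / (3 * (m + 1)))))
        \<le> ennreal (e/3) + (ennreal (e/3) + ennreal (e/3))"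
    proof (intro add_mono cg ennreal_leI)
      show "m * (e / (3 * (m + 1))) \<le> e / 3" using e m0 by (simp add: field_simps)
    qed
    also have "\<dots> = ennreal e" using e by (simp add: ennreal_plus[symmetric] del: ennreal_plus)
    finally show "(\<integral>\<^sup>+z. ennreal (?I z * \<bar>g (z + y) - g z\<bar>) \<partial>lborel) \<le> ennreal e" .
  qed (use d in auto)
qed

text \<open>Minkowski's inequality for integrals, by Tonelli: the error at z is at most the
  \<open>k\<close>-average of |g(z + y) - g(z)|, and k carries mass only where |y| < d.\<close>

lemma mollification_L1:
  fixes g k :: "'a::euclidean_space \<Rightarrow> real"
  assumes g[measurable]: "g \<in> borel_measurable borel" and B: "\<And>z. \<bar>g z\<bar> \<le> B"
    and d: "\<And>y. norm y < d \<Longrightarrow> (\<integral>\<^sup>+z. ennreal (indicator (cball 0 R) z * \<bar>g (z + y) - g z\<bar>) \<partial>lborel) \<le> ennreal e"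
    and k[measurable]: "k \<in> borel_measurable borel" and k0: "\<And>y. 0 \<le> k y" "\<And>y. d \<le> norm y \<Longrightarrow> k y = 0"
    and k1: "has_bochner_integral lborel k 1" and e: "e \<ge> 0"
  shows "(\<integral>\<^sup>+z. ennreal (indicator (cball 0 R) z * \<bar>(LINT y|lborel. g y * k (y - z)) - g z\<bar>) \<partial>lborel) \<le> ennreal e"
proof -
  have ki: "integrable lborel k" "(LINT y|lborel. k y) = 1" using k1 by (auto simp: has_bochner_integral_iff)
  have gi: "integrable lborel (\<lambda>y. g (y + z) * k y)" for z
  proof (rule Bochner_Integration.integrable_bound[OF integrable_mult_right[OF ki(1), of B]])
    show "AE y in lborel. norm (g (y + z) * k y) \<le> norm (B * k y)"
      using B k0 by (intro AE_I2) (auto simp: abs_mult intro!: mult_mono order_trans[OF B])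
  qed measurable
  have nk: "(\<integral>\<^sup>+y. ennreal (k y) \<partial>lborel) = 1" using ki k0 by (subst nn_integral_eq_integral) auto
  have pt: "ennreal (indicator (cball 0 R) z * \<bar>(LINT y|lborel. g y * k (y - z)) - g z\<bar>) \<le>
     (\<integral>\<^sup>+y. ennreal (k y) * ennreal (indicator (cball 0 R) z * \<bar>g (z + y) - g z\<bar>) \<partial>lborel)" for z
  proof -
    have "(LINT y|lborel. g y * k (y - z)) = (LINT y|lborel. g (y + z) * k y)"
      using integral_translate[of "\<lambda>y. g y * k (y - z)" z] by simp
    moreover have "g z = (LINT y|lborel. g z * k y)" using ki by simp
    ultimately have "(LINT y|lborel. g y * k (y - z)) - g z = (LINT y|lborel. g (y + z) * k y - g z * k y)"
      using gi ki by simp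
    then have "ennreal \<bar>(LINT y|lborel. g y * k (y - z)) - g z\<bar> \<le> (\<integral>\<^sup>+y. norm (g (y + z) * k y - g z * k y) \<partial>lborel)"
      using integral_norm_bound_ennreal[of lborel "\<lambda>y. g (y + z) * k y - g z * k y"] gi ki by simp
    also have "\<dots> = (\<integral>\<^sup>+y. ennreal (k y) * ennreal (\<bar>g (z + y) - g z\<bar>) \<partial>lborel)"
    proof (rule nn_integral_cong)
      fix y
      have "norm (g (y + z) * k y - g z * k y) = k y * \<bar>g (z + y) - g z\<bar>"
        using k0(1)[of y] by (simp add: left_diff_distrib[symmetric] abs_mult add.commute)
      then show "ennreal (norm (g (y + z) * k y - g z * k y)) = ennreal (k y) * ennreal (\<bar>g (z + y) - g z\<bar>)"
        using k0(1)[of y] by (simp add: ennreal_mult)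
    qed
    finally show ?thesis by (auto simp: indicator_def)
  qed
  have "(\<integral>\<^sup>+z. ennreal (indicator (cball 0 R) z * \<bar>(LINT y|lborel. g y * k (y - z)) - g z\<bar>) \<partial>lborel)
     \<le> (\<integral>\<^sup>+z. (\<integral>\<^sup>+y. ennreal (k y) * ennreal (indicator (cball 0 R) z * \<bar>g (z + y) - g z\<bar>) \<partial>lborel) \<partial>lborel)"
    by (intro nn_integral_mono pt)
  also have "\<dots> = (\<integral>\<^sup>+y. (\<integral>\<^sup>+z. ennreal (k y) * ennreal (indicator (cball 0 R) z * \<bar>g (z + y) - g z\<bar>) \<partial>lborel) \<partial>lborel)"
    by (rule lborel_pair.Fubini') measurable
  also have "\<dots> \<le> (\<integral>\<^sup>+y. ennreal (k y) * ennreal e \<partial>lborel)"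
  proof (intro nn_integral_mono)
    fix y
    have "(\<integral>\<^sup>+z. ennreal (k y) * ennreal (indicator (cball 0 R) z * \<bar>g (z + y) - g z\<bar>) \<partial>lborel)
       = ennreal (k y) * (\<integral>\<^sup>+z. ennreal (indicator (cball 0 R) z * \<bar>g (z + y) - g z\<bar>) \<partial>lborel)"
      by (rule nn_integral_cmult) measurable
    also have "\<dots> \<le> ennreal (k y) * ennreal e"
      using d[of y] k0(2)[of y] by (cases "norm y < d") (auto intro: mult_left_mono)
    finally show "(\<integral>\<^sup>+z. ennreal (k y) * ennreal (indicator (cball 0 R) z * \<bar>g (z + y) - g z\<bar>) \<partial>lborel) \<le> ennreal (k y) * ennreal e" .
  qed
  also have "\<dots> = ennreal e" by (subst nn_integral_multc) (auto simp: nk)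
  finally show ?thesis .
qed

definition ker1 :: "nat \<Rightarrow> real \<Rightarrow> real" where
  "ker1 n = (SOME k. smooth1 k \<and> (\<forall>t. 0 \<le> k t) \<and> (\<forall>t. 1 / Suc n \<le> \<bar>t\<bar> \<longrightarrow> k t = 0) \<and> has_bochner_integral lborel k 1)"

lemma ker1: "smooth1 (ker1 n)" "0 \<le> ker1 n t" "1 / Suc n \<le> \<bar>t\<bar> \<Longrightarrow> ker1 n t = 0" "has_bochner_integral lborel (ker1 n) 1"
  using someI_ex[OF exists_kernel[of "1 / Suc n"]] unfolding ker1_def[symmetric] by auto

definition ker :: "nat \<Rightarrow> real \<times> real \<Rightarrow> real" where
  "ker n z = ker1 n (fst z) * ker1 n (snd z)"

lemma ker1_measurable[measurable]: "ker1 n \<in> borel_measurable borel"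
  by (intro borel_measurable_continuous_onI smooth1_continuous ker1)

lemma ker_Cinf: "Cinf (ker n)"
  using Cinf_prod[OF ker1(1) ker1(1), of n n] unfolding ker_def[abs_def] .

lemma ker_nonneg: "0 \<le> ker n z" by (simp add: ker_def ker1)

text \<open>The kernel is supported in a square of half-side 1/(n + 1); the 2 comes from comparing
  the Euclidean norm with the sum of the coordinates.\<close>

lemma ker_zero:
  assumes "2 / Suc n \<le> norm z" shows "ker n z = 0"
proof -
  have "norm z \<le> \<bar>fst z\<bar> + \<bar>snd z\<bar>" using norm_Pair_le[of "fst z" "snd z"] by simp
  then have "1 / Suc n \<le> \<bar>fst z\<bar> \<or> 1 / Suc n \<le> \<bar>snd z\<bar>" using assms by auto
  then show ?thesis using ker1(3) by (auto simp: ker_def)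
qed

lemma ker_bounded_support: "bounded_support (ker n)"
  unfolding bounded_support_def using ker_zero[of n] by (intro exI[of _ "2 / Suc n"]) auto

lemma ker_measurable[measurable]: "ker n \<in> borel_measurable borel"
  by (intro borel_measurable_continuous_onI Cinf_continuous ker_Cinf)

lemma ker_integral: "has_bochner_integral lborel (ker n) 1"
proof -
  have k1: "(\<integral>\<^sup>+t. ennreal (ker1 n t) \<partial>lborel) = 1"
    using ker1(4)[of n] ker1(2)[of n] by (subst nn_integral_eq_integral) (auto simp: has_bochner_integral_iff)
  have "(\<integral>\<^sup>+z. ennreal (ker n z) \<partial>(lborel :: (real\<times>real) measure)) = (\<integral>\<^sup>+z. ennreal (ker n z) \<partial>(lborel \<Otimes>\<^sub>M lborel))"
    by (simp add: lborel_prod)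
  also have "\<dots> = (\<integral>\<^sup>+t. \<integral>\<^sup>+x. ennreal (ker n (t, x)) \<partial>lborel \<partial>lborel)"
    by (rule lborel.nn_integral_fst[symmetric]) (simp add: lborel_prod)
  also have "\<dots> = (\<integral>\<^sup>+t. ennreal (ker1 n t) * (\<integral>\<^sup>+x. ennreal (ker1 n x) \<partial>lborel) \<partial>lborel)"
    by (intro nn_integral_cong) (simp add: ker_def ennreal_mult ker1 nn_integral_cmult)
  also have "\<dots> = 1" by (simp add: k1)
  finally have "(\<integral>\<^sup>+z. ennreal (ker n z) \<partial>(lborel :: (real\<times>real) measure)) = ennreal 1" by simp
  then show ?thesis using ker_nonneg by (intro has_bochner_integral_nn_integral) auto
qed

text \<open>The kernel is centred at z through y - z, so differentiating in z produces a minus sign,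
  which the integrations by parts in y later cancel.\<close>

definition moll :: "nat \<Rightarrow> (real \<times> real \<Rightarrow> real) \<Rightarrow> real \<times> real \<Rightarrow> real" where
  "moll n g z = (LINT y|lborel. g y * ker n (y - z))"

lemma locally_bounded_bounded: "(\<And>z. \<bar>g z\<bar> \<le> B) \<Longrightarrow> locally_bounded g"
  by (auto simp: locally_bounded_def)

lemma moll_Cinf:
  assumes "g \<in> borel_measurable borel" "locally_bounded g" shows "Cinf (moll n g)"
  unfolding moll_def[abs_def] by (intro smooth2_imp_Cinf smooth2_conv ker_Cinf ker_bounded_support assms)

lemma moll_integrable:
  assumes "g \<in> borel_measurable borel" "locally_bounded g" shows "integrable lborel (\<lambda>y. g y * ker n (y - z))"
  by (intro integrable_conv Cinf_continuous ker_Cinf ker_bounded_support assms)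

lemma ker_shift_integral: "integrable lborel (\<lambda>y. ker n (y - z))" "(LINT y|lborel. ker n (y - z)) = 1"
proof -
  show "integrable lborel (\<lambda>y. ker n (y - z))" using moll_integrable[OF _ locally_bounded_bounded[of "\<lambda>_. 1" 1], of n z] by simp
  show "(LINT y|lborel. ker n (y - z)) = 1"
    using integral_translate[of "\<lambda>y. ker n (y - z)" z] ker_integral[of n] by (simp add: has_bochner_integral_iff)
qed

lemma moll_mono:
  assumes "g \<in> borel_measurable borel" "locally_bounded g" "h \<in> borel_measurable borel" "locally_bounded h"
    and le: "\<And>y. norm (y - z) < 2 / Suc n \<Longrightarrow> g y \<le> h y"
  shows "moll n g z \<le> moll n h z"
  unfolding moll_def
proof (rule integral_mono)
  show "integrable lborel (\<lambda>y. g y * ker n (y - z))" "integrable lborel (\<lambda>y. h y * ker n (y - z))"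
    using assms by (auto intro: moll_integrable)
  show "g y * ker n (y - z) \<le> h y * ker n (y - z)" for y
    using le[of y] ker_zero[of n "y - z"] ker_nonneg[of n "y - z"]
    by (cases "norm (y - z) < 2 / Suc n") (auto intro: mult_right_mono)
qed

lemma moll_const: "moll n (\<lambda>_. c) z = c"
  using ker_shift_integral by (simp add: moll_def)

text \<open>Both functions converge along one subsequence because the sum of their L1 errors tends
  to 0. This is needed for the pair u and f(u), which appear together in the tested entropy
  inequality.\<close>

lemma moll_AE_subseq:
  assumes g[measurable]: "g \<in> borel_measurable borel" "h \<in> borel_measurable borel"
    and B: "\<And>z. \<bar>g z\<bar> \<le> B" "\<And>z. \<bar>h z\<bar> \<le> B"
  shows "\<exists>r. strict_mono r \<and> (AE z in lborel. norm z \<le> R \<longrightarrow> (\<lambda>n. moll (r n) g z) \<longlonglongrightarrow> g z \<and> (\<lambda>n. moll (r n) h z) \<longlonglongrightarrow> h z)"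
proof -
  have L: "locally_bounded g" "locally_bounded h" by (rule locally_bounded_bounded[OF B(1)], rule locally_bounded_bounded[OF B(2)])
  have [measurable]: "moll n g \<in> borel_measurable borel" "moll n h \<in> borel_measurable borel" for n
    using moll_Cinf[OF g(1) L(1)] moll_Cinf[OF g(2) L(2)] by (auto intro!: borel_measurable_continuous_onI Cinf_continuous)
  define q where "q n z = indicator (cball 0 R) z * \<bar>moll n g z - g z\<bar> + indicator (cball 0 R) z * \<bar>moll n h z - h z\<bar>" for n z
  have lim: "\<forall>\<^sub>F n in sequentially. (\<integral>\<^sup>+z. ennreal (indicator (cball 0 R) z * \<bar>moll n f z - f z\<bar>) \<partial>lborel) \<le> ennreal e"
    if f[measurable]: "f \<in> borel_measurable borel" and fB: "\<And>z. \<bar>f z\<bar> \<le> B" and e: "e > 0" for f e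
  proof -
    obtain d where d: "d > 0" "\<And>y. norm y < d \<Longrightarrow> (\<integral>\<^sup>+z. ennreal (indicator (cball 0 R) z * \<bar>f (z + y) - f z\<bar>) \<partial>lborel) \<le> ennreal e"
      using L1_translation_continuous[OF f fB e] by blast
    have "(\<lambda>n. 2 * (1 / real (Suc n))) \<longlonglongrightarrow> 2 * 0" by (intro tendsto_intros LIMSEQ_Suc lim_1_over_n)
    then have "\<forall>\<^sub>F n in sequentially. 2 * (1 / real (Suc n)) < d" using d(1) by (auto dest: order_tendstoD)
    then show ?thesis
    proof eventually_elim
      case (elim n)
      show ?case unfolding moll_def
        by (rule mollification_L1[OF f fB d(2), of ])
           (use elim e in \<open>auto simp: ker_nonneg ker_integral intro!: ker_zero\<close>)
    qed
  qed
  have mB: "\<bar>moll n f z\<bar> \<le> B" if "f \<in> borel_measurable borel" "\<And>z. \<bar>f z\<bar> \<le> B" for f n z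
  proof -
    have "moll n f z \<le> moll n (\<lambda>_. B) z" "moll n (\<lambda>_. - B) z \<le> moll n f z"
      using that by (auto intro!: moll_mono locally_bounded_bounded[where B=B] simp: abs_le_iff) (smt (verit))+
    then show ?thesis by (simp add: moll_const)
  qed
  have qi: "integrable lborel (q n)" for n
  proof (rule integrable_bounded_support[where R=R and B="4*B"])
    fix z show "\<bar>q n z\<bar> \<le> 4 * B"
      using mB[OF g(1) B(1), of n z] mB[OF g(2) B(2), of n z] B[of z] unfolding q_def by (auto simp: indicator_def)
    show "q n \<in> borel_measurable borel" unfolding q_def by measurable
  qed (auto simp: q_def)
  have "(\<lambda>n. LINT z|lborel. norm (q n z)) \<longlonglongrightarrow> 0"
  proof (rule order_tendstoI)
    fix a :: real assume "a < 0"
    then show "\<forall>\<^sub>F n in sequentially. a < (LINT z|lborel. norm (q n z))"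
      by (auto intro!: always_eventually less_le_trans[of a 0])
  next
    fix a :: real assume a: "a > 0"
    have "\<forall>\<^sub>F n in sequentially. (\<integral>\<^sup>+z. ennreal (indicator (cball 0 R) z * \<bar>moll n g z - g z\<bar>) \<partial>lborel) \<le> ennreal (a/3)"
         "\<forall>\<^sub>F n in sequentially. (\<integral>\<^sup>+z. ennreal (indicator (cball 0 R) z * \<bar>moll n h z - h z\<bar>) \<partial>lborel) \<le> ennreal (a/3)"
      using lim[OF g(1) B(1), of "a/3"] lim[OF g(2) B(2), of "a/3"] a by auto
    then show "\<forall>\<^sub>F n in sequentially. (LINT z|lborel. norm (q n z)) < a"
    proof eventually_elim
      case (elim n)
      have "ennreal (LINT z|lborel. norm (q n z)) = (\<integral>\<^sup>+z. ennreal (norm (q n z)) \<partial>lborel)"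
        using qi by (subst nn_integral_eq_integral) auto
      also have "\<dots> = (\<integral>\<^sup>+z. ennreal (indicator (cball 0 R) z * \<bar>moll n g z - g z\<bar>) + ennreal (indicator (cball 0 R) z * \<bar>moll n h z - h z\<bar>) \<partial>lborel)"
        by (intro nn_integral_cong) (simp add: q_def ennreal_plus[symmetric] del: ennreal_plus)
      also have "\<dots> = (\<integral>\<^sup>+z. ennreal (indicator (cball 0 R) z * \<bar>moll n g z - g z\<bar>) \<partial>lborel) + (\<integral>\<^sup>+z. ennreal (indicator (cball 0 R) z * \<bar>moll n h z - h z\<bar>) \<partial>lborel)"
        by (rule nn_integral_add) measurable
      also have "\<dots> \<le> ennreal (a/3) + ennreal (a/3)" by (intro add_mono elim)
      also have "\<dots> = ennreal (2*a/3)" using a by (simp add: ennreal_plus[symmetric] del: ennreal_plus)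
      finally have "(LINT z|lborel. norm (q n z)) \<le> 2*a/3" using a by (simp add: ennreal_le_iff)
      then show ?case using a by simp
    qed
  qed
  from tendsto_L1_AE_subseq[OF qi this] obtain r where r: "strict_mono r" "AE z in lborel. (\<lambda>n. q (r n) z) \<longlonglongrightarrow> 0" by blast
  have "AE z in lborel. norm z \<le> R \<longrightarrow> (\<lambda>n. moll (r n) g z) \<longlonglongrightarrow> g z \<and> (\<lambda>n. moll (r n) h z) \<longlonglongrightarrow> h z"
    using r(2)
  proof eventually_elim
    case (elim z)
    show ?case
    proof (intro impI conjI)
      assume z: "norm z \<le> R"
      have "(\<lambda>n. moll (r n) g z - g z) \<longlonglongrightarrow> 0" by (rule Lim_null_comparison[OF _ elim]) (use z in \<open>auto simp: q_def\<close>)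
      then show "(\<lambda>n. moll (r n) g z) \<longlonglongrightarrow> g z" by (simp add: LIM_zero_iff)
      have "(\<lambda>n. moll (r n) h z - h z) \<longlonglongrightarrow> 0" by (rule Lim_null_comparison[OF _ elim]) (use z in \<open>auto simp: q_def\<close>)
      then show "(\<lambda>n. moll (r n) h z) \<longlonglongrightarrow> h z" by (simp add: LIM_zero_iff)
    qed
  qed
  with r show ?thesis by blast
qed

section \<open>Fubini, integration by parts and cutoff functions\<close>

lemma lborel2_fubini:
  fixes F :: "real \<times> real \<Rightarrow> real"
  assumes "integrable lborel F"
  shows "(LINT z|lborel. F z) = (LINT t|lborel. LINT x|lborel. F (t, x))"
    and "(LINT z|lborel. F z) = (LINT x|lborel. LINT t|lborel. F (t, x))"
    and "AE x in lborel. integrable lborel (\<lambda>t. F (t, x))"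
    and "integrable lborel (\<lambda>x. LINT t|lborel. F (t, x))"
proof -
  have F: "integrable (lborel \<Otimes>\<^sub>M lborel) (case_prod (\<lambda>t x. F (t, x)))" using assms by (simp add: lborel_prod)
  show 1: "(LINT z|lborel. F z) = (LINT t|lborel. LINT x|lborel. F (t, x))"
    using lborel_pair.integral_fst[OF F] by (simp add: lborel_prod)
  show "(LINT z|lborel. F z) = (LINT x|lborel. LINT t|lborel. F (t, x))"
    using 1 lborel_pair.Fubini_integral[OF F] by simp
  show "AE x in lborel. integrable lborel (\<lambda>t. F (t, x))" using lborel_pair.AE_integrable_snd[OF F] .
  show "integrable lborel (\<lambda>x. LINT t|lborel. F (t, x))" using lborel_pair.integrable_snd[OF F] .
qed

lemma AE_lborel2_snd:
  assumes "AE z in lborel. P (z::real\<times>real)"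
  shows "AE x in lborel. AE t in lborel. P (t, x)"
proof -
  obtain N where N: "{z \<in> space lborel. \<not> P z} \<subseteq> N" "N \<in> null_sets (lborel :: (real\<times>real) measure)"
    using assms unfolding eventually_ae_filter by blast
  have Nl: "N \<in> sets (lborel \<Otimes>\<^sub>M lborel)" by (subst lborel_prod) (rule null_setsD2[OF N(2)])
  have "AE z in lborel \<Otimes>\<^sub>M lborel. z \<notin> N" using N by (simp add: lborel_prod AE_not_in)
  then have "AE t in lborel. AE x in lborel. (t, x) \<notin> N" by (rule lborel_pair.AE_pair)
  then have "AE x in lborel. AE t in lborel. (t, x) \<notin> N"
  proof -
    have "{z \<in> space (lborel \<Otimes>\<^sub>M lborel). (fst z, snd z) \<notin> N} = space (lborel \<Otimes>\<^sub>M lborel) - N" by (auto simp: space_pair_measure)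
    then have "{z \<in> space (lborel \<Otimes>\<^sub>M lborel). (fst z, snd z) \<notin> N} \<in> sets (lborel \<Otimes>\<^sub>M lborel)" by (simp only: sets.compl_sets[OF Nl])
    then show ?thesis using \<open>AE t in lborel. AE x in lborel. (t, x) \<notin> N\<close> by (subst (asm) lborel_pair.AE_commute)
  qed
  then show ?thesis
  proof eventually_elim
    case (elim x)
    then show ?case by eventually_elim (use N in auto)
  qed
qed

text \<open>Fubini on the half-plane r \<le> y. It replaces the product rule when one factor is only
  the indefinite integral of an integrable function.\<close>

lemma integral_triangle_swap:
  fixes q p :: "real \<Rightarrow> real"
  assumes q: "integrable lborel q" and p: "integrable lborel p"
  shows "(LINT y|lborel. q y * (LINT r|lborel. indicator {..y} r * p r)) = (LINT r|lborel. p r * (LINT y|lborel. indicator {r..} y * q y))"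
proof -
  have [measurable]: "q \<in> borel_measurable borel" "p \<in> borel_measurable borel" using q p by auto
  define F where "F y r = q y * (indicator {x. snd x \<le> fst x} (y, r) * p r)" for y r
  have [measurable]: "{x::real\<times>real. snd x \<le> fst x} \<in> sets (borel \<Otimes>\<^sub>M borel)" 
    by (subst borel_prod) (auto intro!: borel_closed closed_Collect_le continuous_intros)
  have Fm: "case_prod F \<in> borel_measurable (lborel \<Otimes>\<^sub>M lborel)" unfolding F_def by measurable
  have "integrable (lborel \<Otimes>\<^sub>M lborel) (case_prod F)"
  proof (rule lborel_pair.Fubini_integrable[OF Fm])
    have nb: "norm (F y r) \<le> \<bar>q y\<bar> * \<bar>p r\<bar>" for y r by (auto simp: F_def abs_mult indicator_def)
    have i: "integrable lborel (\<lambda>r. \<bar>q y\<bar> * \<bar>p r\<bar>)" for y using p by simp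
    have [measurable]: "F y \<in> borel_measurable borel" for y unfolding F_def by measurable
    have Fi: "integrable lborel (F y)" for y
      by (rule Bochner_Integration.integrable_bound[OF i[of y]]) (use nb in \<open>auto simp: F_def[abs_def]\<close>)
    then show "AE y in lborel. integrable lborel (\<lambda>r. case_prod F (y, r))" by simp
    show "integrable lborel (\<lambda>y. LINT r|lborel. norm (case_prod F (y, r)))"
    proof (rule Bochner_Integration.integrable_bound[of _ "\<lambda>y. \<bar>q y\<bar> * (LINT r|lborel. \<bar>p r\<bar>)"])
      show "integrable lborel (\<lambda>y. \<bar>q y\<bar> * (LINT r|lborel. \<bar>p r\<bar>))" using q by simp
      show "(\<lambda>y. LINT r|lborel. norm (case_prod F (y, r))) \<in> borel_measurable lborel"
        using Fm by measurable
      show "AE y in lborel. norm (LINT r|lborel. norm (case_prod F (y, r))) \<le> norm (\<bar>q y\<bar> * (LINT r|lborel. \<bar>p r\<bar>))"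
      proof (intro AE_I2)
        fix y
        have "(LINT r|lborel. norm (F y r)) \<le> (LINT r|lborel. \<bar>q y\<bar> * \<bar>p r\<bar>)"
          by (rule integral_mono[OF integrable_norm[OF Fi] i nb])
        moreover have "0 \<le> (LINT r|lborel. norm (F y r))" by simp
        ultimately show "norm (LINT r|lborel. norm (case_prod F (y, r))) \<le> norm (\<bar>q y\<bar> * (LINT r|lborel. \<bar>p r\<bar>))" by simp
      qed
    qed
  qed
  from lborel_pair.Fubini_integral[OF this]
  have "(LINT r|lborel. LINT y|lborel. F y r) = (LINT y|lborel. LINT r|lborel. F y r)" .
  moreover have "(LINT y|lborel. F y r) = p r * (LINT y|lborel. indicator {r..} y * q y)" for r
  proof -
    have "F y r = p r * (indicator {r..} y * q y)" for y by (auto simp: F_def indicator_def)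
    then show ?thesis by simp
  qed
  moreover have "(LINT r|lborel. F y r) = q y * (LINT r|lborel. indicator {..y} r * p r)" for y
  proof -
    have "F y r = q y * (indicator {..y} r * p r)" for r by (auto simp: F_def indicator_def)
    then show ?thesis by simp
  qed
  ultimately show ?thesis by simp
qed

text \<open>P need not be differentiable everywhere, so the integration by parts is Fubini on a
  triangle followed by the fundamental theorem for the smooth factor \<beta>. The condition
  \<open>\<beta> b = 0\<close> removes the boundary term on the right.\<close>

lemma ibp_indefinite:
  fixes p P \<beta> \<beta>' :: "real \<Rightarrow> real"
  assumes ab: "a \<le> b" and p: "integrable lborel (\<lambda>r. indicator {a<..b} r * p r)"
    and P: "\<And>y. y \<in> {a..b} \<Longrightarrow> P y = P a + (LINT r|lborel. indicator {a<..y} r * p r)"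
    and \<beta>: "\<And>y. (\<beta> has_real_derivative \<beta>' y) (at y)" and c: "continuous_on UNIV \<beta>'" and b: "\<beta> b = 0"
  shows "(LINT y|lborel. indicator {a..b} y * (P y * \<beta>' y)) = - P a * \<beta> a - (LINT r|lborel. indicator {a<..b} r * (p r * \<beta> r))"
proof -
  have ftc: "has_bochner_integral lborel (\<lambda>y. \<beta>' y * indicator {r..b} y) (\<beta> b - \<beta> r)" if "r \<le> b" for r
    by (rule has_bochner_integral_FTC_Icc_real[OF that \<beta>]) (use c in \<open>auto simp: continuous_on_eq_continuous_at\<close>)
  define q where "q y = indicator {a..b} y * \<beta>' y" for y
  define ph where "ph r = indicator {a<..b} r * p r" for r
  have q: "integrable lborel q" "(LINT y|lborel. q y) = - \<beta> a"
    using ftc[OF ab] b by (auto simp: q_def[abs_def] has_bochner_integral_iff mult.commute)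
  have ph: "integrable lborel ph" using p by (simp add: ph_def[abs_def])
  have Pq: "indicator {a..b} y * (P y * \<beta>' y) = P a * q y + q y * (LINT r|lborel. indicator {..y} r * ph r)" for y
  proof (cases "y \<in> {a..b}")
    case True
    have "indicator {..y} r * ph r = indicator {a<..y} r * p r" for r using True by (auto simp: ph_def indicator_def)
    then show ?thesis using P[OF True] True by (simp add: q_def algebra_simps)
  qed (simp add: q_def)
  have i2: "integrable lborel (\<lambda>y. q y * (LINT r|lborel. indicator {..y} r * ph r))"
  proof (rule Bochner_Integration.integrable_bound[of _ "\<lambda>y. q y * (LINT r|lborel. \<bar>ph r\<bar>)"])
    show "integrable lborel (\<lambda>y. q y * (LINT r|lborel. \<bar>ph r\<bar>))" using q by simp
    have [measurable]: "q \<in> borel_measurable borel" "ph \<in> borel_measurable borel" using q ph by auto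
    have "(\<lambda>y. LINT r|lborel. indicator {x. snd x \<le> fst x} (y, r) * ph r) \<in> borel_measurable lborel"
    proof -
      have [measurable]: "{x::real\<times>real. snd x \<le> fst x} \<in> sets (borel \<Otimes>\<^sub>M borel)" 
        by (subst borel_prod) (auto intro!: borel_closed closed_Collect_le continuous_intros)
      show ?thesis by measurable
    qed
    moreover have "indicator {x. snd x \<le> fst x} (y, r) = (indicator {..y} r :: real)" for y r :: real by (auto simp: indicator_def)
    ultimately have [measurable]: "(\<lambda>y. LINT r|lborel. indicator {..y} r * ph r) \<in> borel_measurable borel" by simp
    show "(\<lambda>y. q y * (LINT r|lborel. indicator {..y} r * ph r)) \<in> borel_measurable lborel" by measurable
    show "AE y in lborel. norm (q y * (LINT r|lborel. indicator {..y} r * ph r)) \<le> norm (q y * (LINT r|lborel. \<bar>ph r\<bar>))"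
    proof (intro AE_I2)
      fix y
      have "\<bar>LINT r|lborel. indicator {..y} r * ph r\<bar> \<le> (LINT r|lborel. \<bar>ph r\<bar>)"
      proof (rule Bochner_Integration.integral_abs_bound_integral)
        show "integrable lborel (\<lambda>r. indicator {..y} r * ph r)"
          by (rule Bochner_Integration.integrable_bound[OF ph]) (auto simp: indicator_def)
      qed (use ph in \<open>auto simp: indicator_def\<close>)
      then show "norm (q y * (LINT r|lborel. indicator {..y} r * ph r)) \<le> norm (q y * (LINT r|lborel. \<bar>ph r\<bar>))"
        by (auto simp: abs_mult intro!: mult_left_mono)
    qed
  qed
  have "(LINT y|lborel. indicator {a..b} y * (P y * \<beta>' y)) = P a * (LINT y|lborel. q y) + (LINT y|lborel. q y * (LINT r|lborel. indicator {..y} r * ph r))"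
    unfolding Pq using q i2 by simp
  also have "(LINT y|lborel. q y * (LINT r|lborel. indicator {..y} r * ph r)) = (LINT r|lborel. ph r * (LINT y|lborel. indicator {r..} y * q y))"
    by (rule integral_triangle_swap[OF q(1) ph])
  also have "\<dots> = (LINT r|lborel. - (indicator {a<..b} r * (p r * \<beta> r)))"
  proof (rule Bochner_Integration.integral_cong[OF refl])
    fix r
    show "ph r * (LINT y|lborel. indicator {r..} y * q y) = - (indicator {a<..b} r * (p r * \<beta> r))"
    proof (cases "r \<in> {a<..b}")
      case True
      have "(\<lambda>y. indicator {r..} y * q y) = (\<lambda>y. \<beta>' y * indicator {r..b} y)" using True by (auto simp: q_def indicator_def)
      then have "(LINT y|lborel. indicator {r..} y * q y) = \<beta> b - \<beta> r" using ftc[of r] True by (simp add: has_bochner_integral_iff)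
      then show ?thesis using True b by (simp add: ph_def)
    qed (simp add: ph_def)
  qed
  also have "\<dots> = - (LINT r|lborel. indicator {a<..b} r * (p r * \<beta> r))" by simp
  finally show ?thesis using q by simp
qed

lemma exists_step:
  "\<exists>K. smooth1 K \<and> (\<forall>s. (K has_real_derivative ker1 n s) (at s)) \<and> (\<forall>s. s \<le> - (1 / Suc n) \<longrightarrow> K s = 0)
     \<and> (\<forall>s. 1 / Suc n \<le> s \<longrightarrow> K s = 1) \<and> (\<forall>s. 0 \<le> K s \<and> K s \<le> 1)"
proof -
  \<comment> \<open>The base point -2 lies to the left of the support of \<open>ker1 n\<close>,
    since 1/(n + 1) \<le> 1.\<close>
  define K where "K s = integral {-2..s} (ker1 n)" for s
  have c: "continuous_on S (ker1 n)" for S by (rule smooth1_continuous[OF ker1(1)])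
  define d where "d = 1 / real (Suc n)"
  have r1: "d \<le> 1" "d > 0" by (auto simp: d_def)
  note kz = ker1(3)[of n, folded d_def]
  have z: "K s = 0" if "s \<le> - (d)" for s
  proof -
    have "K s = integral {-2..s} (\<lambda>_. 0::real)" unfolding K_def
      by (rule integral_cong) (use that in \<open>auto intro!: kz\<close>)
    then show ?thesis by simp
  qed
  have D: "(K has_real_derivative ker1 n s) (at s)" for s
  proof (cases "s < - (d)")
    case True
    have "((\<lambda>_. 0) has_real_derivative ker1 n s) (at s)" using True kz[of s] by simp
    then show ?thesis
      by (rule has_field_derivative_transform_within_open[where S="{..< - (d)}"]) (use True z in auto)
  next
    case False
    then have s: "s \<in> {-2<..<s+1}" using r1 by auto
    have "(K has_real_derivative ker1 n s) (at s within {-2..s+1})"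
      unfolding K_def by (rule integral_has_real_derivative[OF c]) (use s in auto)
    then have "(K has_real_derivative ker1 n s) (at s within {-2<..<s+1})" by (rule DERIV_subset) auto
    then show ?thesis using s by (subst (asm) at_within_open) auto
  qed
  have o: "K s = 1" if s: "d \<le> s" for s
  proof -
    have "has_bochner_integral lborel (\<lambda>x. ker1 n x * indicator {-2..s} x) (K s - K (-2))"
      by (rule has_bochner_integral_FTC_Icc_real[OF _ D]) (use s r1 c[of UNIV] in \<open>auto simp: continuous_on_eq_continuous_at\<close>)
    moreover have "(\<lambda>x. ker1 n x * indicator {-2..s} x) = ker1 n"
    proof
      fix x show "ker1 n x * indicator {-2..s} x = ker1 n x"
      proof (cases "x \<in> {-2..s}")
        case False
        then have "d \<le> \<bar>x\<bar>" using s r1 by auto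
        then show ?thesis using kz by simp
      qed simp
    qed
    ultimately have "has_bochner_integral lborel (ker1 n) (K s - K (-2))" by simp
    then have "K s - K (-2) = 1" using ker1(4)[of n] by (auto simp: has_bochner_integral_iff)
    moreover have "K (-2) = 0" by (simp add: K_def)
    ultimately show ?thesis by simp
  qed
  have mono: "K s \<le> K t" if "s \<le> t" for s t
    by (rule DERIV_nonneg_imp_nondecreasing[OF that]) (use D ker1(2) in blast)
  have "0 \<le> K s \<and> K s \<le> 1" for s
  proof -
    have "K (min s (- 2)) = 0" "K (max s 1) = 1" using z[of "min s (-2)"] o[of "max s 1"] r1 by (auto simp: min_le_iff_disj le_max_iff_disj)
    then show ?thesis using mono[of "min s (-2)" s] mono[of s "max s 1"] by simp
  qed
  moreover have "smooth1 K" by (rule smooth1_antideriv[OF ker1(1)[of n] D])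
  ultimately show ?thesis unfolding d_def[symmetric] using D z o by blast
qed

lemma test_fun_bounded_support:
  assumes "Cinf \<phi>" "bounded_support \<phi>" "\<And>z. 0 \<le> \<phi> z"
  shows "test_fun \<phi>"
proof -
  obtain R where R: "\<And>z. R < norm z \<Longrightarrow> \<phi> z = 0" using assms(2) unfolding bounded_support_def by blast
  have "closure {z. \<phi> z \<noteq> 0} \<subseteq> cball 0 R"
    by (rule closure_minimal) (use R in \<open>force simp: not_less\<close>)+
  then have "compact (closure {z. \<phi> z \<noteq> 0})"
    by (meson bounded_cball bounded_subset closed_closure compact_eq_bounded_closed)
  then show ?thesis using assms by (simp add: test_fun_def)
qed

text \<open>The divergence theorem on t > 0, where only the initial line contributes. It evaluates
  those terms of the entropy inequality in which c and f(c) multiply a pure derivative of the test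
  function.\<close>

lemma integral_half_plane_derivative:
  assumes \<phi>: "\<And>z. (\<phi> has_derivative (\<lambda>h. fst h * g1 z + snd h * g2 z)) (at (z::real\<times>real))"
    and c: "continuous_on UNIV g1" "continuous_on UNIV g2" and s: "bounded_support \<phi>"
  shows "integrable lborel (\<lambda>z. indicator ({0<..} \<times> UNIV) z * g1 z)" "integrable lborel (\<lambda>z. indicator ({0<..} \<times> UNIV) z * g2 z)"
    "(LINT z|lborel. indicator ({0<..} \<times> UNIV) z * g1 z) = - (LINT y|lborel. \<phi> (0, y))"
    "(LINT z|lborel. indicator ({0<..} \<times> UNIV) z * g2 z) = 0"
proof -
  note s12 = gradient_bounded_support[OF \<phi> s]
  obtain R where R: "\<And>z. R < norm z \<Longrightarrow> \<phi> z = 0 \<and> g1 z = 0 \<and> g2 z = 0"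
  proof -
    obtain R0 R1 R2 where "\<And>z. R0 < norm z \<Longrightarrow> \<phi> z = 0" "\<And>z. R1 < norm z \<Longrightarrow> g1 z = 0" "\<And>z. R2 < norm z \<Longrightarrow> g2 z = 0"
      using s s12 unfolding bounded_support_def by blast
    then show ?thesis using that[of "max R0 (max R1 R2)"] by simp
  qed
  define R' where "R' = max R 0 + 1"
  have z0: "\<phi> z = 0 \<and> g1 z = 0 \<and> g2 z = 0" if "R' \<le> \<bar>fst z\<bar> \<or> R' \<le> \<bar>snd z\<bar>" for z
    using R[of z] that norm_fst_le[of "fst z" "snd z"] norm_snd_le[of "snd z" "fst z"] by (auto simp: R'_def)
  have [measurable]: "g1 \<in> borel_measurable borel" "g2 \<in> borel_measurable borel" using c by (auto intro: borel_measurable_continuous_onI)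
  have [measurable]: "({0<..} \<times> UNIV :: (real\<times>real) set) \<in> sets borel" by (intro borel_open open_Times) auto
  show i: "integrable lborel (\<lambda>z. indicator ({0<..} \<times> UNIV) z * g1 z)" "integrable lborel (\<lambda>z. indicator ({0<..} \<times> UNIV) z * g2 z)"
  proof -
    obtain B1 B2 where B: "\<And>z. \<bar>g1 z\<bar> \<le> B1" "\<And>z. \<bar>g2 z\<bar> \<le> B2"
      using bounded_support_continuous_bounded[OF c(1) s12(1)] bounded_support_continuous_bounded[OF c(2) s12(2)] by auto
    show "integrable lborel (\<lambda>z. indicator ({0<..} \<times> UNIV) z * g1 z)"
      by (rule integrable_bounded_support[where R=R and B=B1]) (use R B in \<open>auto simp: indicator_def intro: order_trans[OF abs_ge_zero B(1)]\<close>)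
    show "integrable lborel (\<lambda>z. indicator ({0<..} \<times> UNIV) z * g2 z)"
      by (rule integrable_bounded_support[where R=R and B=B2]) (use R B in \<open>auto simp: indicator_def intro: order_trans[OF abs_ge_zero B(2)]\<close>)
  qed
  have d1: "((\<lambda>t. \<phi> (t, x)) has_real_derivative g1 (t, x)) (at t)" for t x
  proof -
    have "((\<lambda>s. (s, x)) has_derivative (\<lambda>s. (s, 0))) (at t)" by (intro derivative_intros)
    from has_derivative_compose[OF this \<phi>] show ?thesis by (simp add: has_field_derivative_def mult.commute[of _ "g1 (t,x)"])
  qed
  have d2: "((\<lambda>x. \<phi> (t, x)) has_real_derivative g2 (t, x)) (at x)" for t x
  proof -
    have "((\<lambda>s. (t, s)) has_derivative (\<lambda>s. (0, s))) (at x)" by (intro derivative_intros)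
    from has_derivative_compose[OF this \<phi>] show ?thesis by (simp add: has_field_derivative_def mult.commute[of _ "g2 (t,x)"])
  qed
  have c1: "isCont (\<lambda>t. g1 (t, x)) t" "isCont (\<lambda>x. g2 (t, x)) x" for t x
    using continuous_on_compose2[OF c(1), of UNIV "\<lambda>t. (t, x)"] continuous_on_compose2[OF c(2), of UNIV "\<lambda>x. (t, x)"]
    by (auto simp: continuous_on_eq_continuous_at continuous_intros)
  have R'0: "R' \<ge> 0" by (simp add: R'_def)
  have in1: "(LINT t|lborel. indicator ({0<..} \<times> UNIV) (t, x) * g1 (t, x)) = - \<phi> (0, x)" for x
  proof -
    have "(LINT t|lborel. indicator ({0<..} \<times> UNIV) (t, x) * g1 (t, x)) = (LINT t|lborel. g1 (t, x) * indicator {0..R'} t)"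
    proof (rule integral_cong_AE)
      have [measurable]: "(\<lambda>t. g1 (t, x)) \<in> borel_measurable borel" by measurable
      show "(\<lambda>t. indicator ({0<..} \<times> UNIV) (t, x) * g1 (t, x)) \<in> borel_measurable lborel" by (simp add: indicator_times)
      show "(\<lambda>t. g1 (t, x) * indicator {0..R'} t) \<in> borel_measurable lborel" by measurable
      show "AE t in lborel. indicator ({0<..} \<times> UNIV) (t, x) * g1 (t, x) = g1 (t, x) * indicator {0..R'} t"
        using AE_lborel_singleton[of 0]
      proof eventually_elim
        case (elim t) then show ?case using z0[of "(t,x)"] by (auto simp: indicator_def)
      qed
    qed
    also have "\<dots> = \<phi> (R', x) - \<phi> (0, x)"
      by (rule integral_FTC_Icc_real[OF R'0 d1 c1(1)])
    finally show ?thesis using z0[of "(R',x)"] R'0 by simp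
  qed
  have in2: "(LINT x|lborel. indicator ({0<..} \<times> UNIV) (t, x) * g2 (t, x)) = 0" for t
  proof -
    have "(LINT x|lborel. indicator ({0<..} \<times> UNIV) (t, x) * g2 (t, x)) = (LINT x|lborel. indicator {0<..} t * (g2 (t, x) * indicator {-R'..R'} x))"
    proof (rule Bochner_Integration.integral_cong[OF refl])
      fix x show "indicator ({0<..} \<times> UNIV) (t, x) * g2 (t, x) = indicator {0<..} t * (g2 (t, x) * indicator {-R'..R'} x)"
        using z0[of "(t,x)"] by (cases "R' \<le> \<bar>x\<bar>") (auto simp: indicator_def)
    qed
    also have "\<dots> = indicator {0<..} t * (\<phi> (t, R') - \<phi> (t, -R'))"
      using integral_FTC_Icc_real[OF _ d2 c1(2), of "-R'" R'] R'0 by simp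
    finally show ?thesis using z0[of "(t,R')"] z0[of "(t,-R')"] R'0 by simp
  qed
  show "(LINT z|lborel. indicator ({0<..} \<times> UNIV) z * g1 z) = - (LINT y|lborel. \<phi> (0, y))"
    unfolding lborel2_fubini(2)[OF i(1)] in1 by simp
  show "(LINT z|lborel. indicator ({0<..} \<times> UNIV) z * g2 z) = 0"
    unfolding lborel2_fubini(1)[OF i(2)] in2 by simp
qed

section \<open>The Legendre transform and semiconcavity in time\<close>

text \<open>For t > 0 this is t f*(z/t), where f* is the conjugate of the flux set to infinity
  outside [-K, K].\<close>

definition legendre :: "(real \<Rightarrow> real) \<Rightarrow> real \<Rightarrow> real \<Rightarrow> real \<Rightarrow> real" where
  "legendre f K t z = Sup ((\<lambda>p. p * z - t * f p) ` {-K..K})"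

text \<open>The normalisation makes \<open>e * p\<^sup>2\<close> itself attain equality, so adding
  it to a convex function produces modulus exactly e.\<close>

definition strongly_convex :: "real \<Rightarrow> real set \<Rightarrow> (real \<Rightarrow> real) \<Rightarrow> bool" where
  "strongly_convex e S f \<longleftrightarrow> (\<forall>p\<in>S. \<forall>q\<in>S. \<forall>l\<in>{0..1}.
     f (l * p + (1 - l) * q) \<le> l * f p + (1 - l) * f q - e * l * (1 - l) * (p - q)\<^sup>2)"

lemma strongly_convex_add_square:
  assumes "convex_on UNIV f" shows "strongly_convex e S (\<lambda>p. f p + e * p\<^sup>2)"
  unfolding strongly_convex_def
proof (intro ballI)
  fix p q l :: real assume l: "l \<in> {0..1}"
  have "f (l * p + (1 - l) * q) \<le> l * f p + (1 - l) * f q"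
    using convex_onD[OF assms, of l q p] l by (simp add: algebra_simps)
  moreover have "e * (l * p + (1 - l) * q)\<^sup>2 = l * (e * p\<^sup>2) + (1 - l) * (e * q\<^sup>2) - e * l * (1 - l) * (p - q)\<^sup>2"
    by (simp add: power2_eq_square algebra_simps)
  ultimately show "f (l * p + (1 - l) * q) + e * (l * p + (1 - l) * q)\<^sup>2
       \<le> l * (f p + e * p\<^sup>2) + (1 - l) * (f q + e * q\<^sup>2) - e * l * (1 - l) * (p - q)\<^sup>2"
    by (simp add: algebra_simps)
qed

locale flux =
  fixes f :: "real \<Rightarrow> real" and K F F0 :: real
  assumes K: "K > 0"
    and Lip: "\<And>p q. p \<in> {-K..K} \<Longrightarrow> q \<in> {-K..K} \<Longrightarrow> \<bar>f p - f q\<bar> \<le> F * \<bar>p - q\<bar>"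
    and F0: "\<And>p. p \<in> {-K..K} \<Longrightarrow> \<bar>f p\<bar> \<le> F0"
    and F: "F \<ge> 0"
begin

lemma cont: "continuous_on {-K..K} f"
proof (rule continuous_onI)
  fix x e :: real assume x: "x \<in> {-K..K}" "e > 0"
  show "\<exists>d>0. \<forall>x'\<in>{- K..K}. dist x' x < d \<longrightarrow> dist (f x') (f x) \<le> e"
  proof (intro exI[of _ "e / (F + 1)"] conjI ballI impI)
    show "0 < e / (F + 1)" using x F by simp
    fix y assume y: "y \<in> {-K..K}" "dist y x < e / (F + 1)"
    have "\<bar>f y - f x\<bar> \<le> F * \<bar>y - x\<bar>" using Lip x y by simp
    also have "\<dots> \<le> (F + 1) * \<bar>y - x\<bar>" by (intro mult_right_mono) auto
    also have "\<dots> \<le> e" using y F by (simp add: dist_real_def field_simps)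
    finally show "dist (f y) (f x) \<le> e" by (simp add: dist_real_def)
  qed
qed

abbreviation "G \<equiv> legendre f K"

lemma attained: "\<exists>p\<in>{-K..K}. G t z = p * z - t * f p \<and> (\<forall>q\<in>{-K..K}. q * z - t * f q \<le> p * z - t * f p)"
proof -
  have c: "continuous_on {-K..K} (\<lambda>p. p * z - t * f p)" by (intro continuous_intros cont)
  have "\<exists>p\<in>{-K..K}. \<forall>q\<in>{-K..K}. q * z - t * f q \<le> p * z - t * f p"
    by (rule continuous_attains_sup[OF _ _ c]) (use K in auto)
  then obtain p where p: "p\<in>{-K..K}" "\<forall>q\<in>{-K..K}. q * z - t * f q \<le> p * z - t * f p" by blast
  then have "G t z = p * z - t * f p" unfolding legendre_def by (intro cSup_eq_maximum) auto
  with p show ?thesis by blast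
qed

lemma ge: "q \<in> {-K..K} \<Longrightarrow> q * z - t * f q \<le> G t z"
  using attained[of t z] by auto

text \<open>Testing with the endpoint p = K or p = -K gives growth at rate K in z. A datum with
  Lipschitz constant below K therefore cannot push the minimising foot to infinity.\<close>

lemma coercive:
  assumes "t \<ge> 0" shows "K * \<bar>z\<bar> - t * F0 \<le> G t z"
proof -
  define p where "p = (if z \<ge> 0 then K else - K)"
  have p: "p \<in> {-K..K}" "p * z = K * \<bar>z\<bar>" using K by (auto simp: p_def)
  have "t * f p \<le> t * F0" using F0[OF p(1)] assms by (intro mult_left_mono) auto
  then show ?thesis using ge[OF p(1), of z t] p by linarith
qed

lemma Lipschitz: "\<bar>G t z - G t' z'\<bar> \<le> F0 * \<bar>t - t'\<bar> + K * \<bar>z - z'\<bar>"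
proof -
  have *: "G t z - G t' z' \<le> F0 * \<bar>t - t'\<bar> + K * \<bar>z - z'\<bar>" for t z t' z'
  proof -
    obtain p where p: "p \<in> {-K..K}" "G t z = p * z - t * f p" using attained by blast
    have "G t z - G t' z' \<le> p * (z - z') - (t - t') * f p" using ge[OF p(1), of z' t'] p by (simp add: algebra_simps)
    also have "\<dots> \<le> \<bar>p\<bar> * \<bar>z - z'\<bar> + \<bar>t - t'\<bar> * \<bar>f p\<bar>" 
      unfolding abs_mult[symmetric] by linarith
    also have "\<dots> \<le> K * \<bar>z - z'\<bar> + \<bar>t - t'\<bar> * F0"
      using p F0[OF p(1)] by (intro add_mono mult_left_mono mult_right_mono) auto
    finally show ?thesis by (simp add: algebra_simps)
  qed
  show ?thesis using *[of t z t' z'] *[of t' z' t z] by (simp add: abs_minus_commute abs_le_iff)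
qed

lemma zero_le: "t \<ge> 0 \<Longrightarrow> \<bar>G t 0\<bar> \<le> t * F0"
  using attained[of t 0] F0 by (auto simp: abs_mult intro!: mult_left_mono)

text \<open>An exchange of maximisers: p for (t', z) and p' for (t, z') are reused at (t, z) and
  (t', z'). If f(p') \<le> f(p) they exchange times, if p \<le> p' they exchange places; were both
  to fail, p would beat p' at (t, z'). This inequality is what forces the feet to move monotonically
  in time.\<close>

lemma submodular:
  assumes z: "0 \<le> z'" "z' \<le> z" and t: "0 < t" "t \<le> t'"
  shows "G t z' + G t' z \<le> G t z + G t' z'"
proof -
  obtain p where p: "p \<in> {-K..K}" "G t' z = p * z - t' * f p" using attained by blast
  obtain p' where p': "p' \<in> {-K..K}" "G t z' = p' * z' - t * f p'" "\<And>q. q\<in>{-K..K} \<Longrightarrow> q * z' - t * f q \<le> p' * z' - t * f p'"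
    using attained[of t z'] by blast
  have "f p' \<le> f p \<or> p \<le> p'"
  proof (rule ccontr)
    assume "\<not> ?thesis"
    then have "f p < f p'" "p' < p" by auto
    have "t * (f p' - f p) \<le> (p' - p) * z'" using p'(3)[OF p(1)] by (simp add: algebra_simps)
    moreover have "(p' - p) * z' \<le> 0" using \<open>p' < p\<close> z by (simp add: mult_nonpos_nonneg)
    moreover have "0 < t * (f p' - f p)" using \<open>f p < f p'\<close> t by simp
    ultimately show False by linarith
  qed
  then show ?thesis
  proof
    assume "f p' \<le> f p"
    then have "0 \<le> (t' - t) * (f p - f p')" using t by simp
    moreover have "p * z - t * f p \<le> G t z" "p' * z' - t' * f p' \<le> G t' z'" using ge p p' by auto
    ultimately show ?thesis using p p' by (simp add: algebra_simps)
  next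
    assume "p \<le> p'"
    then have "0 \<le> (p' - p) * (z - z')" using z by simp
    moreover have "p' * z - t * f p' \<le> G t z" "p * z' - t' * f p \<le> G t' z'" using ge p p' by auto
    ultimately show ?thesis using p p' by (simp add: algebra_simps)
  qed
qed

end

locale sc_flux = flux +
  fixes e :: real
  assumes e: "e > 0" and sc: "strongly_convex e {-K..K} f"
begin

text \<open>If a competitor p came closer to the maximum than the quadratic gap, strong convexity
  would put a point between p and p0 strictly above the maximum.\<close>

lemma maximizer_gap:
  assumes p0: "p0 \<in> {-K..K}" and mx: "\<And>q. q\<in>{-K..K} \<Longrightarrow> q * z - t * f q \<le> p0 * z - t * f p0"
    and p: "p \<in> {-K..K}" and t: "t \<ge> 0"
  shows "p * z - t * f p + t * e * (p - p0)\<^sup>2 \<le> p0 * z - t * f p0"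
proof (rule ccontr)
  assume n: "\<not> ?thesis"
  define a where "a = (p0 * z - t * f p0) - (p * z - t * f p)"
  define c where "c = t * e * (p - p0)\<^sup>2"
  have a: "0 \<le> a" "a < c" using mx[OF p] n by (auto simp: a_def c_def)
  \<comment> \<open>With this fraction \<open>c * (1 - l)\<close> is the mean of c and a, hence
    above a, which contradicts maximality at q.\<close>
  define l where "l = (c - a) / (2 * c)"
  have l: "0 < l" "l < 1" using a by (auto simp: l_def field_simps)
  define q where "q = l * p + (1 - l) * p0"
  have q: "q \<in> {-K..K}"
  proof -
    have "q \<in> closed_segment p0 p" unfolding closed_segment_def q_def using l by (auto intro!: exI[of _ l])
    moreover have "closed_segment p0 p \<subseteq> {-K..K}" using p p0 by (intro closed_segment_subset) auto
    ultimately show ?thesis by blast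
  qed
  have "f q \<le> l * f p + (1 - l) * f p0 - e * l * (1 - l) * (p - p0)\<^sup>2"
    using sc p p0 l unfolding strongly_convex_def q_def by auto
  then have "t * f q \<le> t * (l * f p + (1 - l) * f p0 - e * l * (1 - l) * (p - p0)\<^sup>2)"
    using t by (intro mult_left_mono) auto
  moreover have "q * z - t * f q \<le> p0 * z - t * f p0" using mx q by blast
  ultimately have "q * z - t * (l * f p + (1 - l) * f p0 - e * l * (1 - l) * (p - p0)\<^sup>2) \<le> p0 * z - t * f p0" by linarith
  then have "l * (c * (1 - l)) \<le> l * a" unfolding q_def a_def c_def by (simp add: algebra_simps)
  then have "c * (1 - l) \<le> a" using l by simp
  moreover have "c * (1 - l) = (c + a) / 2" using a by (auto simp: l_def field_simps)
  ultimately show False using a by simp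
qed

text \<open>Strong convexity of the flux becomes a quadratic upper bound for its conjugate: the
  maximiser p0 is a spatial slope and -f(p0) a time slope, up to a quadratic error. Moving to (t',
  z') gains at most d D for a maximiser at distance d from p0, while the gap costs t e d^2;
  completing the square leaves D^2 / (4 t e).\<close>

lemma quadratic_bound:
  assumes p0: "p0 \<in> {-K..K}" and mx: "\<And>q. q\<in>{-K..K} \<Longrightarrow> q * z - t * f q \<le> p0 * z - t * f p0"
    and t: "t > 0"
  shows "G t' z' \<le> G t z + p0 * (z' - z) - (t' - t) * f p0 + (\<bar>z' - z\<bar> + F * \<bar>t' - t\<bar>)\<^sup>2 / (4 * t * e)"
proof -
  define D where "D = \<bar>z' - z\<bar> + F * \<bar>t' - t\<bar>"
  obtain p where p: "p \<in> {-K..K}" "G t' z' = p * z' - t' * f p" using attained by blast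
  define d where "d = \<bar>p - p0\<bar>"
  have g: "G t z = p0 * z - t * f p0" using ge[OF p0, of z t] attained[of t z] mx by force
  have 1: "p * z - t * f p + t * e * (p - p0)\<^sup>2 \<le> G t z" using maximizer_gap[OF p0 mx p(1)] t g by auto
  have 2: "(p - p0) * (z' - z) \<le> d * \<bar>z' - z\<bar>" unfolding d_def abs_mult[symmetric] by simp
  have 3: "(t' - t) * (f p0 - f p) \<le> \<bar>t' - t\<bar> * (F * d)"
  proof -
    have "(t' - t) * (f p0 - f p) \<le> \<bar>t' - t\<bar> * \<bar>f p0 - f p\<bar>" unfolding abs_mult[symmetric] by simp
    also have "\<dots> \<le> \<bar>t' - t\<bar> * (F * d)" using Lip[OF p0 p(1)] by (intro mult_left_mono) (auto simp: d_def abs_minus_commute)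
    finally show ?thesis .
  qed
  have 4: "d * D \<le> t * e * d\<^sup>2 + D\<^sup>2 / (4 * t * e)"
  proof -
    have "0 \<le> (2 * t * e * d - D)\<^sup>2 / (4 * t * e)" using t e by simp
    also have "\<dots> = t * e * d\<^sup>2 + D\<^sup>2 / (4 * t * e) - d * D"
      using t e by (simp add: field_simps power2_eq_square)
    finally show ?thesis by simp
  qed
  have "G t' z' = (p * z - t * f p) + p0 * (z' - z) - (t' - t) * f p0 + (p - p0) * (z' - z) + (t' - t) * (f p0 - f p)"
    using p by (simp add: algebra_simps)
  also have "\<dots> \<le> G t z - t * e * d\<^sup>2 + p0 * (z' - z) - (t' - t) * f p0 + d * D"
    using 1 2 3 by (simp add: d_def D_def algebra_simps)
  also have "\<dots> \<le> G t z + p0 * (z' - z) - (t' - t) * f p0 + D\<^sup>2 / (4 * t * e)" using 4 by linarith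
  finally show ?thesis unfolding D_def .
qed

end

text \<open>Splitting the way from t to s into n equal steps reduces the quadratic error to C (s -
  t)^2 / n. The slopes met on the way may be replaced by k(t) because k is nonincreasing; for s < t
  the slopes are larger but the steps are negative.\<close>

lemma supergradient_of_approx:
  fixes Fn k :: "real \<Rightarrow> real"
  assumes A: "\<And>s t. \<lbrakk>s \<ge> \<tau>; t \<ge> \<tau>\<rbrakk> \<Longrightarrow> Fn s - Fn t \<le> k t * (s - t) + C * (s - t)\<^sup>2"
    and k: "\<And>s t. \<lbrakk>\<tau> \<le> t; t \<le> s\<rbrakk> \<Longrightarrow> k s \<le> k t"
    and st: "s \<ge> \<tau>" "t \<ge> \<tau>" and C: "C \<ge> 0"
  shows "Fn s - Fn t \<le> k t * (s - t)"
proof -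
  have *: "real n * (Fn s - Fn t - k t * (s - t)) \<le> C * (s - t)\<^sup>2" for n
  proof (cases "n = 0")
    case True then show ?thesis using C by simp
  next
    case False
    define r where "r i = t + real i * ((s - t) / n)" for i :: nat
    have r0: "r 0 = t" and rn: "r n = s" using False by (auto simp: r_def)
    have rb: "r i \<ge> \<tau>" if "i \<le> n" for i
    proof -
      have "real i / n \<le> 1" using that False by simp
      then have "r i \<in> closed_segment t s" unfolding closed_segment_def r_def
        by (auto intro!: exI[of _ "real i / n"] simp: algebra_simps add_divide_distrib diff_divide_distrib)
      then show ?thesis using st by (auto simp: closed_segment_eq_real_ivl split: if_splits)
    qed
    have step: "Fn (r (Suc i)) - Fn (r i) \<le> k t * ((s - t) / n) + C * ((s - t) / n)\<^sup>2" if i: "i < n" for i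
    proof -
      have d: "r (Suc i) - r i = (s - t) / n" by (simp add: r_def algebra_simps add_divide_distrib diff_divide_distrib)
      have "Fn (r (Suc i)) - Fn (r i) \<le> k (r i) * ((s - t) / n) + C * ((s - t) / n)\<^sup>2"
        using A[of "r (Suc i)" "r i"] rb[of i] rb[of "Suc i"] i d by simp
      moreover have "k (r i) * ((s - t) / n) \<le> k t * ((s - t) / n)"
      proof (cases "t \<le> s")
        case True
        then have "t \<le> r i" by (simp add: r_def)
        then show ?thesis using k[of t "r i"] st True by (intro mult_right_mono) auto
      next
        case False
        then have "r i \<le> t" by (simp add: r_def mult_nonneg_nonpos divide_nonpos_nonneg)
        then show ?thesis using k[of "r i" t] rb[of i] i False by (intro mult_right_mono_neg) (auto simp: divide_nonpos_nonneg)
      qed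
      ultimately show ?thesis by linarith
    qed
    have "Fn s - Fn t = (\<Sum>i<n. Fn (r (Suc i)) - Fn (r i))"
      using sum_lessThan_telescope[of "\<lambda>i. Fn (r i)" n] by (simp only: r0 rn)
    also have "\<dots> \<le> (\<Sum>i<n. k t * ((s - t) / n) + C * ((s - t) / n)\<^sup>2)"
      by (intro sum_mono step) auto
    also have "\<dots> = k t * (s - t) + C * (s - t)\<^sup>2 / n" using False by (simp add: field_simps power2_eq_square)
    finally show ?thesis using False by (simp add: field_simps)
  qed
  show ?thesis
  proof (rule ccontr)
    assume "\<not> ?thesis"
    then have pos: "0 < Fn s - Fn t - k t * (s - t)" by simp
    obtain n where "C * (s - t)\<^sup>2 < real n * (Fn s - Fn t - k t * (s - t))"
      using reals_Archimedean3[OF pos] by blast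
    then show False using *[of n] by linarith
  qed
qed

text \<open>Choosing the smallest minimiser yields a strict inequality against all smaller
  arguments, which the monotonicity of the feet relies on.\<close>

lemma smallest_minimizer:
  fixes Q :: "real \<Rightarrow> real"
  assumes c: "continuous_on {0..} Q" and R: "\<And>y. y > R \<Longrightarrow> Q 0 < Q y"
  shows "\<exists>z\<ge>0. (\<forall>y\<ge>0. Q z \<le> Q y) \<and> (\<forall>y. 0 \<le> y \<and> y < z \<longrightarrow> Q z < Q y)"
proof -
  define R' where "R' = max R 0"
  have c': "continuous_on {0..R'} Q" by (rule continuous_on_subset[OF c]) auto
  have "\<exists>z0\<in>{0..R'}. \<forall>y\<in>{0..R'}. Q z0 \<le> Q y"
    by (rule continuous_attains_inf[OF _ _ c']) (auto simp: R'_def)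
  then obtain z0 where z0: "z0 \<in> {0..R'}" "\<And>y. y \<in> {0..R'} \<Longrightarrow> Q z0 \<le> Q y" by blast
  have min: "Q z0 \<le> Q y" if "y \<ge> 0" for y
    using that z0(2)[of y] z0(2)[of 0] R[of y] by (cases "y \<le> R'"; cases "R < y") (auto simp: R'_def)
  define S where "S = {0..R'} \<inter> Q -` {..Q z0}"
  have cl: "closed S" unfolding S_def by (rule continuous_closed_preimage[OF c']) auto
  have S0: "S \<noteq> {}" using z0 by (auto simp: S_def)
  have bb: "bdd_below S" by (auto simp: S_def intro: bdd_belowI[of _ 0])
  have in_S: "Inf S \<in> S" by (rule closed_contains_Inf[OF S0 bb cl])
  show ?thesis
  proof (intro exI[of _ "Inf S"] conjI allI impI)
    show "0 \<le> Inf S" using in_S by (auto simp: S_def)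
    show "0 \<le> y \<Longrightarrow> Q (Inf S) \<le> Q y" for y using in_S min[of y] by (auto simp: S_def)
    fix y assume y: "0 \<le> y \<and> y < Inf S"
    then have "y \<notin> S" using cInf_lower[OF _ bb] by fastforce
    moreover have "y \<in> {0..R'}" using y in_S by (auto simp: S_def)
    ultimately have "Q z0 < Q y" by (auto simp: S_def)
    then show "Q (Inf S) < Q y" using in_S by (auto simp: S_def)
  qed
qed

context sc_flux begin

text \<open>Half of the Hopf-Lax formula: only feet of characteristics on one side of the
  observation point compete, and these feet move away from it as time grows.\<close>

lemma half_line_semiconcave:
  fixes U r Nh :: "real \<Rightarrow> real"
  assumes Uc: "continuous_on {0..} U" and UL: "\<And>z. z \<ge> 0 \<Longrightarrow> U 0 - K0 * z \<le> U z" and K0: "K0 < K"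
    and U': "\<And>z. z > 0 \<Longrightarrow> (U has_real_derivative - r z) (at z)"
    and fL: "\<And>z z'. \<lbrakk>0 < z; 0 < z'\<rbrakk> \<Longrightarrow> \<bar>f (r z) - f (r z')\<bar> \<le> L * \<bar>r z - r z'\<bar>" and L: "L \<ge> 0"
    and Nh: "\<And>z z'. \<lbrakk>0 \<le> z; z \<le> z'\<rbrakk> \<Longrightarrow> Nh z \<le> Nh z'" "\<And>z. 0 \<le> z \<Longrightarrow> 0 \<le> Nh z \<and> Nh z \<le> c"
    and rN: "\<And>z z'. \<lbrakk>0 < z; z \<le> z'\<rbrakk> \<Longrightarrow> \<bar>r z - r z'\<bar> \<le> Nh z' - Nh z"
  shows "\<exists>A A1 N. (\<forall>t>0. (\<forall>z\<ge>0. A t \<le> U z + G t z) \<and> (\<exists>z\<ge>0. A t = U z + G t z)) \<and>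
     (\<forall>t>0. 0 \<le> N t \<and> N t \<le> L * c) \<and>
     (\<forall>t>0. \<forall>s>0. A1 t + N t * (s - t) \<le> A1 s) \<and>
     (\<forall>t>0. \<exists>k. \<forall>s>0. A s - A1 s \<le> A t - A1 t + k * (s - t))"
proof -
  have ex: "\<exists>z\<ge>0. (\<forall>y\<ge>0. U z + G t z \<le> U y + G t y) \<and> (\<forall>y. 0 \<le> y \<and> y < z \<longrightarrow> U z + G t z < U y + G t y)" if t: "t > 0" for t
  \<comment> \<open>Beyond this radius the gain (K - K0) y in coercivity exceeds 2 t F0, the
    combined bound for G(t, 0) and the loss in \<open>coercive\<close>.\<close>
  proof (rule smallest_minimizer[where R="max 0 (2 * t * F0 / (K - K0))"])
    have "continuous_on {0..} (G t)"
    proof (rule continuous_onI)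
      fix x d :: real assume d: "d > 0"
      show "\<exists>e>0. \<forall>x'\<in>{0..}. dist x' x < e \<longrightarrow> dist (G t x') (G t x) \<le> d"
      proof (intro exI[of _ "d / K"] conjI ballI impI)
        fix y assume "dist y x < d / K"
        then show "dist (G t y) (G t x) \<le> d" using Lipschitz[of t y t x] K by (simp add: dist_real_def field_simps)
      qed (use d K in auto)
    qed
    then show "continuous_on {0..} (\<lambda>y. U y + G t y)" by (intro continuous_intros Uc)
    fix y assume "max 0 (2 * t * F0 / (K - K0)) < y"
    then have y: "0 < y" "2 * t * F0 < (K - K0) * y" using K0 by (auto simp: field_simps)
    show "U 0 + G t 0 < U y + G t y"
      using coercive[of t y] zero_le[of t] UL[of y] y t by (simp add: algebra_simps abs_le_iff)
  qed
  then obtain zt where zt: "\<And>t. t > 0 \<Longrightarrow> zt t \<ge> 0" "\<And>t y. \<lbrakk>t > 0; y \<ge> 0\<rbrakk> \<Longrightarrow> U (zt t) + G t (zt t) \<le> U y + G t y"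
    "\<And>t y. \<lbrakk>t > 0; y \<ge> 0; y < zt t\<rbrakk> \<Longrightarrow> U (zt t) + G t (zt t) < U y + G t y" by metis
  define A where "A t = U (zt t) + G t (zt t)" for t
  have mono: "zt t \<le> zt s" if t: "0 < t" "t \<le> s" for t s
  proof (rule ccontr)
    assume "\<not> zt t \<le> zt s"
    then have l: "zt s < zt t" by simp
    have s: "s > 0" using t by simp
    have "U (zt t) + G t (zt t) < U (zt s) + G t (zt s)" using zt(3)[OF t(1) zt(1)[OF s] l] .
    moreover have "U (zt s) + G s (zt s) \<le> U (zt t) + G s (zt t)" using zt(2)[OF s zt(1)[OF t(1)]] .
    moreover have "G t (zt s) + G s (zt t) \<le> G t (zt t) + G s (zt s)"
      using submodular[of "zt s" "zt t" t s] zt(1)[OF s] l t by simp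
    ultimately show False by linarith
  qed
  have "\<exists>p\<in>{-K..K}. \<forall>q\<in>{-K..K}. q * zt t - t * f q \<le> p * zt t - t * f p" for t
    using attained[of t "zt t"] by blast
  then obtain p where p: "\<And>t. p t \<in> {-K..K}" "\<And>t q. q\<in>{-K..K} \<Longrightarrow> q * zt t - t * f q \<le> p t * zt t - t * f (p t)"
    by metis
  \<comment> \<open>First-order condition at an interior foot: replacing G by its touching
    paraboloid keeps the foot a local minimum and makes the function differentiable there.\<close>
  have pr: "p t = r (zt t)" if t: "t > 0" and z: "zt t > 0" for t
  proof -
    define C where "C = 1 / (4 * t * e)"
    define H where "H y = U y + p t * (y - zt t) + C * (y - zt t)\<^sup>2" for y
    have D: "(H has_real_derivative - r (zt t) + p t) (at (zt t))"
      unfolding H_def by (auto intro!: derivative_eq_intros U' z)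
    have "H (zt t) \<le> H y" if "\<bar>zt t - y\<bar> < zt t" for y
    proof -
      have y: "y \<ge> 0" using that by linarith
      have "G t y \<le> G t (zt t) + p t * (y - zt t) + C * (y - zt t)\<^sup>2"
        using quadratic_bound[OF p t, of t y] by (simp add: C_def)
      then show ?thesis using zt(2)[OF t y] by (simp add: H_def)
    qed
    then have "- r (zt t) + p t = 0" using DERIV_local_min[OF D z] by blast
    then show ?thesis by simp
  qed
  \<comment> \<open>\<open>a t\<close> is the time slope of A at t, and \<open>N t\<close> is L
    times the variation swept by the foot so far. The value 0 for t \<le> 0 makes N monotone on the
    whole line, so it can be integrated from 0.\<close>
  define a where "a t = - f (p t)" for t
  define N where "N t = (if t > 0 then L * Nh (zt t) else 0)" for t
  have N0: "0 \<le> N t" for t using Nh(2) zt(1) L by (auto simp: N_def)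
  have Nmono: "N t \<le> N s" if "t \<le> s" for t s
  proof (cases "t > 0")
    case True
    then show ?thesis using that mono[of t s] Nh(1)[of "zt t" "zt s"] zt(1)[of t] L by (auto simp: N_def intro!: mult_left_mono)
  next
    case False
    then have "N t = 0" by (simp add: N_def)
    then show ?thesis using N0[of s] by simp
  qed
  define A1 where "A1 t = integral {0..t} N" for t
  have Nint: "N integrable_on {x..y}" for x y
    by (rule integrable_on_mono_on) (auto simp: mono_on_def Nmono)
  have A1: "A1 t + N t * (s - t) \<le> A1 s" if "t > 0" "s > 0" for t s
  proof (cases "t \<le> s")
    case True
    have "A1 s = A1 t + integral {t..s} N" unfolding A1_def
      using Henstock_Kurzweil_Integration.integral_combine[of 0 t s N] that True Nint by simp
    moreover have "N t * (s - t) \<le> integral {t..s} N"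
      using integral_le[of "\<lambda>x. N t" "{t..s}" N] Nint Nmono True integrable_const_ivl[of "N t" t s] by (simp add: mult.commute)
    ultimately show ?thesis by simp
  next
    case False
    have "A1 t = A1 s + integral {s..t} N" unfolding A1_def
      using Henstock_Kurzweil_Integration.integral_combine[of 0 s t N] that False Nint by simp
    moreover have "integral {s..t} N \<le> N t * (t - s)"
      using integral_le[of N "{s..t}" "\<lambda>x. N t"] Nint Nmono False integrable_const_ivl[of "N t" s t] by (simp add: mult.commute)
    ultimately show ?thesis by (simp add: algebra_simps)
  qed
  \<comment> \<open>At foot 0 the maximiser p(t) minimises f over [-K, K], so a cannot increase
    afterwards. Once the foot is positive, a is determined by the slope of the datum there, and its
    increase is paid for by N.\<close>
  have kd: "a s - N s \<le> a t - N t" if t: "0 < t" "t \<le> s" for t s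
  proof (cases "zt t = 0")
    case True
    have "t * f (p t) \<le> t * f (p s)" using p(2)[OF p(1)[of s], of t] True by simp
    then have "f (p t) \<le> f (p s)" using t by simp
    then show ?thesis using Nmono[OF t(2)] by (simp add: a_def)
  next
    case False
    then have z: "0 < zt t" "0 < zt s" using zt(1)[OF t(1)] mono[OF t] by auto
    have "f (r (zt t)) - f (r (zt s)) \<le> L * \<bar>r (zt t) - r (zt s)\<bar>" using fL[OF z] by simp
    also have "\<dots> \<le> L * (Nh (zt s) - Nh (zt t))" using rN[OF z(1) mono[OF t]] L by (intro mult_left_mono)
    finally show ?thesis using pr[OF t(1) z(1)] pr[of s] z t by (simp add: a_def N_def algebra_simps)
  qed
  have sg: "A s - A1 s \<le> A t - A1 t + (a t - N t) * (s - t)" if st: "s > 0" "t > 0" for s t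
  proof -
    \<comment> \<open>The quadratic error has a factor 1/t and blows up at time 0; starting at the
      smaller of the two times gives one constant for the whole interval between them.\<close>
    define \<tau> where "\<tau> = min s t"
    have \<tau>: "\<tau> > 0" using st by (simp add: \<tau>_def)
    have "(A s - A1 s) - (A t - A1 t) \<le> (a t - N t) * (s - t)"
    proof (rule supergradient_of_approx[where \<tau>=\<tau> and C="F\<^sup>2 / (4 * \<tau> * e)" and Fn="\<lambda>s. A s - A1 s" and k="\<lambda>t. a t - N t"])
      fix s t assume s: "\<tau> \<le> s" and t: "\<tau> \<le> t"
      have t0: "t > 0" "s > 0" using s t \<tau> by auto
      have "A s \<le> U (zt t) + G s (zt t)" unfolding A_def using zt(2)[OF t0(2) zt(1)[OF t0(1)]] .
      also have "\<dots> \<le> A t + a t * (s - t) + (F * \<bar>s - t\<bar>)\<^sup>2 / (4 * t * e)"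
        using quadratic_bound[OF p t0(1), of s "zt t"] by (simp add: A_def a_def algebra_simps)
      also have "(F * \<bar>s - t\<bar>)\<^sup>2 / (4 * t * e) \<le> (F * \<bar>s - t\<bar>)\<^sup>2 / (4 * \<tau> * e)"
        using t \<tau> e t0 by (intro divide_left_mono mult_right_mono) auto
      also have "\<dots> = F\<^sup>2 / (4 * \<tau> * e) * (s - t)\<^sup>2" by (simp add: power_mult_distrib)
      finally show "(A s - A1 s) - (A t - A1 t) \<le> (a t - N t) * (s - t) + F\<^sup>2 / (4 * \<tau> * e) * (s - t)\<^sup>2"
        using A1[OF t0] by (simp add: algebra_simps)
    next
      show "a s - N s \<le> a t - N t" if "\<tau> \<le> t" "t \<le> s" for s t using kd that \<tau> by simp
    qed (use \<tau> e in \<open>auto simp: \<tau>_def\<close>)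
    then show ?thesis by simp
  qed
  show ?thesis
  proof (rule exI[of _ A], rule exI[of _ A1], rule exI[of _ N], intro conjI)
    show "\<forall>t>0. (\<forall>z\<ge>0. A t \<le> U z + G t z) \<and> (\<exists>z\<ge>0. A t = U z + G t z)"
      using zt(1,2) by (auto simp: A_def)
    show "\<forall>t>0. 0 \<le> N t \<and> N t \<le> L * c"
      using N0 Nh(2)[OF zt(1)] L by (auto simp: N_def intro!: mult_left_mono)
    show "\<forall>t>0. \<forall>s>0. A1 t + N t * (s - t) \<le> A1 s" using A1 by blast
    show "\<forall>t>0. \<exists>k. \<forall>s>0. A s - A1 s \<le> A t - A1 t + k * (s - t)"
    proof (intro allI impI)
      fix t :: real assume "t > 0"
      then show "\<exists>k. \<forall>s>0. A s - A1 s \<le> A t - A1 t + k * (s - t)"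
        using sg by (intro exI[of _ "a t - N t"]) simp
    qed
  qed
qed

end

section \<open>Secant slopes and their positive variation\<close>

definition slope :: "(real \<Rightarrow> real) \<Rightarrow> real \<Rightarrow> real \<Rightarrow> real" where
  "slope \<phi> a b = (\<phi> b - \<phi> a) / (b - a)"

text \<open>Supergradients at every point are concavity on the positive half-line; the secant slopes
  are compared through the supergradients at the inner endpoints b and c.\<close>

lemma supergradient_slope_antimono:
  assumes sg: "\<forall>t>0. \<exists>k. \<forall>s>0. D s \<le> D t + k * (s - t)" and o: "0 < a" "a < b" "b \<le> c" "c < (d::real)"
  shows "slope D c d \<le> slope D a b"
proof -
  obtain k where k: "\<And>s. s > 0 \<Longrightarrow> D s \<le> D b + k * (s - b)" using sg o by force
  obtain k' where k': "\<And>s. s > 0 \<Longrightarrow> D s \<le> D c + k' * (s - c)" using sg o by force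
  have 1: "k \<le> slope D a b" using k[of a] o by (simp add: slope_def field_simps)
  have 2: "slope D c d \<le> k'" using k'[of d] o by (simp add: slope_def field_simps)
  show ?thesis
  proof (cases "b = c")
    case True
    have "slope D c d \<le> k" using k[of d] o True by (simp add: slope_def field_simps)
    then show ?thesis using 1 by simp
  next
    case False
    have "D c \<le> D b + k * (c - b)" "D b \<le> D c + k' * (b - c)" using k[of c] k'[of b] o by auto
    then have "0 \<le> (k - k') * (c - b)" by (simp add: algebra_simps)
    then have "k' \<le> k" using False o by (simp add: zero_le_mult_iff)
    then show ?thesis using 1 2 by simp
  qed
qed

text \<open>The function is a concave part plus the convex part M. Slopes of the concave part only
  decrease, so each positive increment is at most the increment for M; these telescope, and the
  slopes of M lie between 0 and c. Secants replace derivatives because they survive pointwise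
  limits.\<close>

lemma slope_positive_variation:
  fixes \<phi> M N :: "real \<Rightarrow> real" and l r :: "nat \<Rightarrow> real"
  assumes N: "\<And>t. t > 0 \<Longrightarrow> 0 \<le> N t \<and> N t \<le> c"
    and M: "\<And>t s. \<lbrakk>t > 0; s > 0\<rbrakk> \<Longrightarrow> M t + N t * (s - t) \<le> M s"
    and D: "\<forall>t>0. \<exists>k. \<forall>s>0. \<phi> s - M s \<le> \<phi> t - M t + k * (s - t)"
    and lr: "\<And>j. j \<le> n \<Longrightarrow> 0 < l j \<and> l j < r j" "\<And>j. j < n \<Longrightarrow> r j \<le> l (Suc j)"
  shows "(\<Sum>j<n. max 0 (slope \<phi> (l (Suc j)) (r (Suc j)) - slope \<phi> (l j) (r j))) \<le> c"
proof -
  have split: "slope \<phi> a b = slope (\<lambda>t. \<phi> t - M t) a b + slope M a b" for a b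
    by (simp add: slope_def diff_divide_distrib[symmetric] add_divide_distrib[symmetric])
  have neg: "\<forall>t>0. \<exists>k. \<forall>s>0. - M s \<le> - M t + k * (s - t)"
  proof (intro allI impI)
    fix t :: real assume "t > 0"
    then show "\<exists>k. \<forall>s>0. - M s \<le> - M t + k * (s - t)" using M by (intro exI[of _ "- N t"]) force
  qed
  have sneg: "slope (\<lambda>t. - M t) a b = - slope M a b" for a b
    by (simp add: slope_def minus_divide_left)
  have "max 0 (slope \<phi> (l (Suc j)) (r (Suc j)) - slope \<phi> (l j) (r j)) \<le> slope M (l (Suc j)) (r (Suc j)) - slope M (l j) (r j)" if "j < n" for j
    using supergradient_slope_antimono[OF D, of "l j" "r j" "l (Suc j)" "r (Suc j)"]
      supergradient_slope_antimono[OF neg, of "l j" "r j" "l (Suc j)" "r (Suc j)"]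
      lr(1)[of j] lr(1)[of "Suc j"] lr(2)[of j] that unfolding split sneg by simp
  then have "(\<Sum>j<n. max 0 (slope \<phi> (l (Suc j)) (r (Suc j)) - slope \<phi> (l j) (r j)))
     \<le> (\<Sum>j<n. slope M (l (Suc j)) (r (Suc j)) - slope M (l j) (r j))" by (intro sum_mono) auto
  also have "\<dots> = slope M (l n) (r n) - slope M (l 0) (r 0)"
    using sum_lessThan_telescope[of "\<lambda>j. slope M (l j) (r j)" n] by simp
  also have "\<dots> \<le> c"
  proof -
    have "M (l n) + N (l n) * (r n - l n) \<le> M (r n)" "M (r n) + N (r n) * (l n - r n) \<le> M (l n)"
       "M (l 0) + N (l 0) * (r 0 - l 0) \<le> M (r 0)" using M lr(1)[of n] lr(1)[of 0] by (meson le0 less_trans order_refl)+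
    moreover have "0 \<le> N (l 0) * (r 0 - l 0)" using N[of "l 0"] lr(1)[of 0] by simp
    moreover have "N (r n) * (r n - l n) \<le> c * (r n - l n)" using N[of "r n"] lr(1)[of n] by (intro mult_right_mono) auto
    ultimately have "0 \<le> slope M (l 0) (r 0)" "slope M (l n) (r n) \<le> c"
      using lr(1)[of n] lr(1)[of 0] by (auto simp: slope_def field_simps)
    then show ?thesis by simp
  qed
  finally show ?thesis .
qed

section \<open>The potential of a Kruzkov solution\<close>

lemma integrable_mult_bounded:
  fixes g h :: "'a \<Rightarrow> real"
  assumes g: "integrable M g" and [measurable]: "h \<in> borel_measurable M" and C: "\<And>x. \<bar>h x\<bar> \<le> C"
  shows "integrable M (\<lambda>x. g x * h x)"
proof (rule Bochner_Integration.integrable_bound[OF integrable_mult_left[OF g, of C]])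
  have [measurable]: "g \<in> borel_measurable M" using g by auto
  show "(\<lambda>x. g x * h x) \<in> borel_measurable M" by measurable
  show "AE x in M. norm (g x * h x) \<le> norm (g x * C)"
    using C by (auto simp: abs_mult intro!: AE_I2 mult_left_mono order_trans[OF C abs_ge_self])
qed

lemma integrable_indicator_Ioc[simp]: "integrable lborel (indicator {a<..b::real} :: real \<Rightarrow> real)"
  using emeasure_bounded_finite[of "{a<..b}"] by (intro integrable_real_indicator) auto

lemma AE_open_imp_empty:
  fixes S :: "'a::euclidean_space set"
  assumes "AE x in lborel. x \<notin> S" "open S"
  shows "S = {}"
proof (rule ccontr)
  assume "S \<noteq> {}"
  then have "\<not> negligible S" using assms(2) by (rule open_not_negligible[rotated])
  moreover have "S \<in> sets lborel" using assms(2) by simp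
  then have "emeasure lborel S = 0" using assms(1) by (subst (asm) AE_iff_measurable[of S]) auto
  then have "S \<in> null_sets lborel" using assms(2) by (auto intro: null_setsI)
  then have "negligible S" by (simp add: negligible_iff_null_sets null_sets_completionI)
  ultimately show False by simp
qed

lemma AE_continuous_le:
  fixes a :: "real \<Rightarrow> real"
  assumes "continuous_on UNIV a" "AE x in lborel. a x \<le> c"
  shows "a x \<le> c"
proof -
  have "open (a -` {c<..})" using assms(1) by (intro continuous_open_vimage) (auto simp: continuous_on_eq_continuous_at)
  moreover have "AE x in lborel. x \<notin> a -` {c<..}" using assms(2) by eventually_elim auto
  ultimately have "a -` {c<..} = {}" by (intro AE_open_imp_empty)
  then show ?thesis by (auto simp: vimage_def not_less)
qed

abbreviation "half_plane \<equiv> ({0<..} \<times> UNIV) :: (real \<times> real) set"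

lemma half_plane_measurable[measurable]: "half_plane \<in> sets borel" by (intro borel_open open_Times) auto

lemma half_plane_indicator: "indicator half_plane (t, x) = indicator {0<..} t"
  by (auto simp: indicator_def)

text \<open>The solution and the datum are normalised: measurability and bounds hold everywhere
  instead of almost everywhere. Changes on null sets reduce the general case to this one.\<close>

locale kruzkov_data =
  fixes f :: "real \<Rightarrow> real" and u0 :: "real \<Rightarrow> real" and u :: "real \<times> real \<Rightarrow> real"
    and W :: "real \<Rightarrow> real \<Rightarrow> real" and B Bf :: real
  assumes f_cont: "continuous_on UNIV f"
    and fB: "\<And>p. \<bar>p\<bar> \<le> B \<Longrightarrow> \<bar>f p\<bar> \<le> Bf"
    and u0m[measurable]: "u0 \<in> borel_measurable borel" and u0B: "\<And>x. \<bar>u0 x\<bar> \<le> B"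
    and um[measurable]: "u \<in> borel_measurable borel" and uB: "\<And>z. \<bar>u z\<bar> \<le> B"
    and entropy: "\<And>c \<phi>. test_fun \<phi> \<Longrightarrow>
        0 \<le> (LINT z : half_plane | lborel. dt \<phi> z * \<bar>u z - c\<bar> + dx \<phi> z * sgn (u z - c) * (f (u z) - f c))
        + (LINT y | lborel. \<phi> (0, y) * \<bar>u0 y - c\<bar>)"
    and Wae: "AE z in lborel. z \<in> half_plane \<longrightarrow> W (fst z) (snd z) = f (u z)"
    and Wm: "\<And>x. set_borel_measurable lborel {0<..} (\<lambda>t. W t x)"
    and Wb: "\<And>x. \<exists>M. AE t in lborel. t > 0 \<longrightarrow> \<bar>W t x\<bar> \<le> M"
    and Wc: "\<And>g. set_integrable lborel {0<..} g \<Longrightarrow> continuous_on UNIV (\<lambda>x. LINT t : {0<..} | lborel. W t x * g t)"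
begin

lemma fm[measurable]: "f \<in> borel_measurable borel" by (rule borel_measurable_continuous_onI[OF f_cont])

lemma B0: "B \<ge> 0" "Bf \<ge> 0" using u0B[of 0] fB[OF u0B[of 0]] by linarith+

lemma fuB: "\<bar>f (u z)\<bar> \<le> Bf" by (rule fB[OF uB])

text \<open>For c above or below the range of u the absolute values are linear and the sign is
  constant, so the two entropy inequalities are the weak equation with opposite signs.\<close>

lemma weak_form:
  assumes \<phi>: "\<And>z. (\<phi> has_derivative (\<lambda>h. fst h * g1 z + snd h * g2 z)) (at z)"
    and c: "continuous_on UNIV g1" "continuous_on UNIV g2" and s: "bounded_support \<phi>" and t: "test_fun \<phi>"
  shows "(LINT z|lborel. indicator half_plane z * (g1 z * u z + g2 z * f (u z))) + (LINT y|lborel. \<phi> (0, y) * u0 y) = 0"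
proof -
  note H = integral_half_plane_derivative[OF \<phi> c s]
  have [simp]: "dt \<phi> z = g1 z" "dx \<phi> z = g2 z" for z using dt_dx_eq[OF \<phi>] by auto
  obtain R where R: "\<And>z. R < norm z \<Longrightarrow> \<phi> z = 0" using s unfolding bounded_support_def by blast
  have c\<phi>: "continuous_on UNIV \<phi>" by (rule has_derivative_continuous_on[OF has_derivative_at_withinI[OF \<phi>]])
  have c0: "continuous_on UNIV (\<lambda>y. \<phi> (0, y))" by (rule continuous_on_compose2[OF c\<phi>]) (auto intro!: continuous_intros)
  have s0: "bounded_support (\<lambda>y. \<phi> (0, y))" unfolding bounded_support_def
    by (rule exI[of _ R]) (auto intro!: R)
  have i0: "integrable lborel (\<lambda>y. \<phi> (0, y))"
    using integrable_conv[OF c0 s0, of "\<lambda>_. 1" 0] by (simp add: locally_bounded_bounded[of "\<lambda>_. 1" 1])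
  have iu0: "integrable lborel (\<lambda>y. \<phi> (0, y) * u0 y)" by (rule integrable_mult_bounded[OF i0 _ u0B]) simp
  have i1: "integrable lborel (\<lambda>z. indicator half_plane z * g1 z * u z)" by (rule integrable_mult_bounded[OF H(1) _ uB]) simp
  have i2: "integrable lborel (\<lambda>z. indicator half_plane z * g2 z * f (u z))" by (rule integrable_mult_bounded[OF H(2) _ fuB]) measurable
  define X where "X = (LINT z|lborel. indicator half_plane z * (g1 z * u z + g2 z * f (u z)))"
  define J where "J = (LINT y|lborel. \<phi> (0, y) * u0 y)"
  define P where "P = (LINT y|lborel. \<phi> (0, y))"
  have X: "X = (LINT z|lborel. indicator half_plane z * g1 z * u z) + (LINT z|lborel. indicator half_plane z * g2 z * f (u z))"
    unfolding X_def using i1 i2 by (simp add: distrib_left mult.assoc)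
  have up: "X + J \<le> 0"
  proof -
    define c where "c = B + 1"
    have lt: "u z < c" "u0 y < c" for z y using uB[of z] u0B[of y] by (auto simp: c_def)
    have e1: "(LINT z : half_plane | lborel. dt \<phi> z * \<bar>u z - c\<bar> + dx \<phi> z * sgn (u z - c) * (f (u z) - f c))
      = (LINT z|lborel. c * (indicator half_plane z * g1 z) + f c * (indicator half_plane z * g2 z) - (indicator half_plane z * g1 z * u z + indicator half_plane z * g2 z * f (u z)))"
      unfolding set_lebesgue_integral_def
    proof (rule Bochner_Integration.integral_cong[OF refl])
      fix z show "indicator half_plane z *\<^sub>R (dt \<phi> z * \<bar>u z - c\<bar> + dx \<phi> z * sgn (u z - c) * (f (u z) - f c)) =
        c * (indicator half_plane z * g1 z) + f c * (indicator half_plane z * g2 z) - (indicator half_plane z * g1 z * u z + indicator half_plane z * g2 z * f (u z))"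
        using lt(1)[of z] by (simp add: algebra_simps)
    qed
    also have "\<dots> = c * - P + f c * 0 - X" using H i1 i2 by (simp add: X P_def)
    finally have 1: "(LINT z : half_plane | lborel. dt \<phi> z * \<bar>u z - c\<bar> + dx \<phi> z * sgn (u z - c) * (f (u z) - f c)) = - c * P - X" by simp
    have "(LINT y | lborel. \<phi> (0, y) * \<bar>u0 y - c\<bar>) = (LINT y|lborel. \<phi> (0, y) * c - \<phi> (0, y) * u0 y)"
    proof (rule Bochner_Integration.integral_cong[OF refl])
      fix y show "\<phi> (0, y) * \<bar>u0 y - c\<bar> = \<phi> (0, y) * c - \<phi> (0, y) * u0 y" using lt(2)[of y] by (simp add: algebra_simps)
    qed
    also have "\<dots> = c * P - J" using i0 iu0 by (simp add: P_def J_def)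
    finally show ?thesis using entropy[OF t, of c] 1 by simp
  qed
  have lo: "0 \<le> X + J"
  proof -
    define c where "c = - B - 1"
    have lt: "c < u z" "c < u0 y" for z y using uB[of z] u0B[of y] by (auto simp: c_def)
    have e1: "(LINT z : half_plane | lborel. dt \<phi> z * \<bar>u z - c\<bar> + dx \<phi> z * sgn (u z - c) * (f (u z) - f c))
      = (LINT z|lborel. (indicator half_plane z * g1 z * u z + indicator half_plane z * g2 z * f (u z)) - (c * (indicator half_plane z * g1 z) + f c * (indicator half_plane z * g2 z)))"
      unfolding set_lebesgue_integral_def
    proof (rule Bochner_Integration.integral_cong[OF refl])
      fix z show "indicator half_plane z *\<^sub>R (dt \<phi> z * \<bar>u z - c\<bar> + dx \<phi> z * sgn (u z - c) * (f (u z) - f c)) =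
        (indicator half_plane z * g1 z * u z + indicator half_plane z * g2 z * f (u z)) - (c * (indicator half_plane z * g1 z) + f c * (indicator half_plane z * g2 z))"
        using lt(1)[of z] by (simp add: algebra_simps)
    qed
    also have "\<dots> = X - (c * - P + f c * 0)" using H i1 i2 by (simp add: X P_def)
    finally have 1: "(LINT z : half_plane | lborel. dt \<phi> z * \<bar>u z - c\<bar> + dx \<phi> z * sgn (u z - c) * (f (u z) - f c)) = X + c * P" by simp
    have "(LINT y | lborel. \<phi> (0, y) * \<bar>u0 y - c\<bar>) = (LINT y|lborel. \<phi> (0, y) * u0 y - \<phi> (0, y) * c)"
    proof (rule Bochner_Integration.integral_cong[OF refl])
      fix y show "\<phi> (0, y) * \<bar>u0 y - c\<bar> = \<phi> (0, y) * u0 y - \<phi> (0, y) * c" using lt(2)[of y] by (simp add: algebra_simps)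
    qed
    also have "\<dots> = J - c * P" using i0 iu0 by (simp add: P_def J_def)
    finally show ?thesis using entropy[OF t, of c] 1 by simp
  qed
  show ?thesis using up lo by (simp add: X_def J_def)
qed

section \<open>The potential and its mollified derivatives\<close>

definition V0 :: "real \<Rightarrow> real" where
  "V0 x = (LINT y|lborel. (indicator {0<..x} y - indicator {x<..0} y) * u0 y)"

text \<open>V is obtained by integrating the trace W in time rather than u in space. The time
  derivative at a fixed x is then -W by construction, for every x; that the spatial derivative is u
  has to be proved. For t \<le> 0 the interval is empty and V equals V0, which extends V to the
  whole plane.\<close>

definition V :: "real \<times> real \<Rightarrow> real" where
  "V z = V0 (snd z) - (LINT s|lborel. indicator {0<..fst z} s * W s (snd z))"

lemma u0_int: "integrable lborel (\<lambda>y. indicator {a<..b} y * u0 y)"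
  by (rule integrable_mult_bounded[OF _ _ u0B]) auto

lemma V0_diff:
  assumes "a \<le> b" shows "V0 b - V0 a = (LINT y|lborel. indicator {a<..b} y * u0 y)"
proof -
  have i: "integrable lborel (\<lambda>y. (indicator {0<..x} y - indicator {x<..0} y) * u0 y)" for x
    by (rule integrable_mult_bounded[OF _ _ u0B]) auto
  have "V0 b - V0 a = (LINT y|lborel. (indicator {0<..b} y - indicator {b<..0} y) * u0 y - (indicator {0<..a} y - indicator {a<..0} y) * u0 y)"
    unfolding V0_def using i by simp
  also have "\<dots> = (LINT y|lborel. indicator {a<..b} y * u0 y)"
    by (rule Bochner_Integration.integral_cong[OF refl]) (use assms in \<open>auto simp: indicator_def\<close>)
  finally show ?thesis .
qed

lemma V0_Lipschitz: "\<bar>V0 b - V0 a\<bar> \<le> B * \<bar>b - a\<bar>"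
proof -
  have *: "\<bar>V0 b - V0 a\<bar> \<le> B * (b - a)" if "a \<le> b" for a b
  proof -
    have "\<bar>LINT y|lborel. indicator {a<..b} y * u0 y\<bar> \<le> (LINT y|lborel. indicator {a<..b} y * B)"
    proof (rule Bochner_Integration.integral_abs_bound_integral[OF u0_int])
      show "integrable lborel (\<lambda>y. indicator {a<..b} y * B)" by simp
      show "\<bar>indicator {a<..b} y * u0 y\<bar> \<le> indicator {a<..b} y * B" for y using u0B[of y] by (simp add: indicator_def)
    qed
    also have "\<dots> = B * (b - a)" using that by simp
    finally show ?thesis using V0_diff[OF that] by simp
  qed
  show ?thesis using *[of a b] *[of b a] by (cases "a \<le> b") (auto simp: abs_minus_commute)
qed

lemma V0_cont: "continuous_on UNIV V0"
  by (rule lipschitz_on_continuous_on[of B]) (use V0_Lipschitz B0 in \<open>auto simp: lipschitz_on_def dist_real_def abs_minus_commute\<close>)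

lemma W_meas[measurable]: "(\<lambda>t. indicator {0<..} t * W t x) \<in> borel_measurable borel"
  using Wm[of x] by (simp add: set_borel_measurable_def)

lemma W_int:
  assumes g: "integrable lborel g"
  shows "integrable lborel (\<lambda>t. indicator {0<..} t * W t x * g t)"
proof -
  obtain M where M: "AE t in lborel. t > 0 \<longrightarrow> \<bar>W t x\<bar> \<le> M" using Wb by blast
  have [measurable]: "g \<in> borel_measurable borel" using g by auto
  show ?thesis
  proof (rule Bochner_Integration.integrable_bound[OF integrable_mult_right[OF g, of M]])
    show "(\<lambda>t. indicator {0<..} t * W t x * g t) \<in> borel_measurable lborel" by measurable
    show "AE t in lborel. norm (indicator {0<..} t * W t x * g t) \<le> norm (M * g t)"
      using M
    proof eventually_elim
      case (elim t)
      show ?case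
      proof (cases "t > 0")
        case True
        then have "\<bar>W t x\<bar> \<le> \<bar>M\<bar>" using elim by linarith
        then show ?thesis using True by (simp add: abs_mult mult_right_mono)
      qed simp
    qed
  qed
qed

text \<open>The pairing of the trace with a time weight: continuous in x by the weak-* hypothesis,
  but equal to the corresponding integral of f(u) only for almost every x.\<close>

definition aW :: "(real \<Rightarrow> real) \<Rightarrow> real \<Rightarrow> real" where
  "aW g x = (LINT t|lborel. indicator {0<..} t * W t x * g t)"

lemma aW_cont: assumes g: "integrable lborel g" shows "continuous_on UNIV (aW g)"
proof -
  have "set_integrable lborel {0<..} g" unfolding set_integrable_def
    by (rule integrable_mult_indicator) (use g in auto)
  from Wc[OF this] show ?thesis unfolding aW_def[abs_def] set_lebesgue_integral_def by (simp add: mult.assoc)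
qed

lemma aW_AE: assumes g: "integrable lborel g"
  shows "AE x in lborel. aW g x = (LINT t|lborel. indicator {0<..} t * f (u (t, x)) * g t)"
proof -
  have [measurable]: "g \<in> borel_measurable borel" using g by auto
  show ?thesis using AE_lborel2_snd[OF Wae]
  proof eventually_elim
    case (elim x)
    show ?case unfolding aW_def
    proof (rule integral_cong_AE)
      show "AE t in lborel. indicator {0<..} t * W t x * g t = indicator {0<..} t * f (u (t, x)) * g t"
        using elim by eventually_elim (auto simp: indicator_def)
    qed measurable
  qed
qed

text \<open>Bounds on f(u) reach the time integral of W only for almost every x; its continuity in x
  extends them to every x, in particular to the observation point.\<close>

lemma W_range:
  assumes lh: "AE z in lborel. z \<in> half_plane \<longrightarrow> lo \<le> f (u z) \<and> f (u z) \<le> hi" and t: "0 \<le> t1" "t1 \<le> t2"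
  shows "lo * (t2 - t1) \<le> (LINT s|lborel. indicator {t1<..t2} s * W s x)" "(LINT s|lborel. indicator {t1<..t2} s * W s x) \<le> hi * (t2 - t1)"
proof -
  define g where "g = (indicator {t1<..t2} :: real \<Rightarrow> real)"
  have g: "integrable lborel g" unfolding g_def by simp
  have eq: "(LINT s|lborel. indicator {t1<..t2} s * W s x) = aW g x" for x unfolding aW_def g_def
    by (rule Bochner_Integration.integral_cong[OF refl]) (use t in \<open>auto simp: indicator_def\<close>)
  have ae: "AE x in lborel. lo * (t2 - t1) \<le> aW g x \<and> aW g x \<le> hi * (t2 - t1)"
    using aW_AE[OF g] AE_lborel2_snd[OF lh]
  proof eventually_elim
    case (elim x)
    have i: "integrable lborel (\<lambda>t. indicator {0<..} t * f (u (t, x)) * g t)"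
    proof -
      have "integrable lborel (\<lambda>t. g t * (indicator {0<..} t * f (u (t, x))))"
        by (rule integrable_mult_bounded[OF g, where C=Bf]) (use fuB B0 in \<open>auto simp: indicator_def\<close>)
      then show ?thesis by (simp add: mult.commute)
    qed
    have ig: "integrable lborel (\<lambda>t. c * g t)" "(LINT t|lborel. c * g t) = c * (t2 - t1)" for c
      using t by (auto simp: g_def)
    have "(LINT t|lborel. lo * g t) \<le> (LINT t|lborel. indicator {0<..} t * f (u (t, x)) * g t)"
    proof (rule integral_mono_AE[OF ig(1) i])
      show "AE t in lborel. lo * g t \<le> indicator {0<..} t * f (u (t, x)) * g t"
        using elim(2) by eventually_elim (use t in \<open>auto simp: g_def indicator_def\<close>)
    qed
    moreover have "(LINT t|lborel. indicator {0<..} t * f (u (t, x)) * g t) \<le> (LINT t|lborel. hi * g t)"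
    proof (rule integral_mono_AE[OF i ig(1)])
      show "AE t in lborel. indicator {0<..} t * f (u (t, x)) * g t \<le> hi * g t"
        using elim(2) by eventually_elim (use t in \<open>auto simp: g_def indicator_def\<close>)
    qed
    ultimately show ?case using elim(1) unfolding ig(2) by simp
  qed
  have "aW g x \<le> hi * (t2 - t1)"
    by (rule AE_continuous_le[OF aW_cont[OF g]]) (use ae in eventually_elim, auto)
  then show "(LINT s|lborel. indicator {t1<..t2} s * W s x) \<le> hi * (t2 - t1)" using eq by simp
  have "- aW g x \<le> - (lo * (t2 - t1))"
    by (rule AE_continuous_le[OF continuous_on_minus[OF aW_cont[OF g]]]) (use ae in eventually_elim, auto)
  then show "lo * (t2 - t1) \<le> (LINT s|lborel. indicator {t1<..t2} s * W s x)" using eq by simp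
qed

lemma W_int_interval: assumes "0 \<le> t1" shows "integrable lborel (\<lambda>s. indicator {t1<..t2} s * W s x)"
proof -
  have "integrable lborel (\<lambda>t. indicator {0<..} t * W t x * indicator {t1<..t2} t)" by (rule W_int) simp
  moreover have "(\<lambda>t. indicator {0<..} t * W t x * indicator {t1<..t2} t) = (\<lambda>s. indicator {t1<..t2} s * W s x)"
    using assms by (auto simp: indicator_def)
  ultimately show ?thesis by simp
qed

lemma V_time:
  assumes "0 \<le> t1" "t1 \<le> t2"
  shows "V (t2, x) - V (t1, x) = - (LINT s|lborel. indicator {t1<..t2} s * W s x)"
proof -
  have "(LINT s|lborel. indicator {0<..t2} s * W s x) = (LINT s|lborel. indicator {0<..t1} s * W s x + indicator {t1<..t2} s * W s x)"
    by (rule Bochner_Integration.integral_cong[OF refl]) (use assms in \<open>auto simp: indicator_def\<close>)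
  also have "\<dots> = (LINT s|lborel. indicator {0<..t1} s * W s x) + (LINT s|lborel. indicator {t1<..t2} s * W s x)"
    using W_int_interval assms by (intro Bochner_Integration.integral_add) auto
  finally show ?thesis by (simp add: V_def)
qed

lemma V_nonpos: "t \<le> 0 \<Longrightarrow> V (t, x) = V0 x" by (simp add: V_def)

lemma V_Lipschitz_time: "\<bar>V (t, x) - V (t', x)\<bar> \<le> Bf * \<bar>t - t'\<bar>"
proof -
  have mx: "V (t, x) = V (max 0 t, x)" for t using V_nonpos[of t x] V_nonpos[of 0 x] by (cases "t \<le> 0") auto
  have *: "\<bar>V (t2, x) - V (t1, x)\<bar> \<le> Bf * (t2 - t1)" if "0 \<le> t1" "t1 \<le> t2" for t1 t2
  proof -
    have "AE z in lborel. z \<in> half_plane \<longrightarrow> - Bf \<le> f (u z) \<and> f (u z) \<le> Bf" using fuB by (auto simp: abs_le_iff minus_le_iff intro!: AE_I2)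
    from W_range[OF this that, of x] show ?thesis unfolding V_time[OF that] by (simp add: abs_le_iff)
  qed
  have **: "\<bar>V (a, x) - V (b, x)\<bar> \<le> Bf * \<bar>a - b\<bar>" if "0 \<le> a" "0 \<le> b" for a b
    using *[of a b] *[of b a] that by (cases "a \<le> b") (auto simp: abs_minus_commute)
  have "\<bar>V (max 0 t, x) - V (max 0 t', x)\<bar> \<le> Bf * \<bar>max 0 t - max 0 t'\<bar>" by (rule **) auto
  also have "\<dots> \<le> Bf * \<bar>t - t'\<bar>" using B0 by (intro mult_left_mono) auto
  finally show ?thesis using mx by simp
qed

lemma V_cont: "continuous_on UNIV V"
proof -
  have cx: "continuous_on UNIV (\<lambda>x. V (t, x))" for t
  proof -
    have "continuous_on UNIV (aW (indicator {0<..t}))" by (rule aW_cont) simp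
    moreover have "aW (indicator {0<..t}) x = (LINT s|lborel. indicator {0<..t} s * W s x)" for x
      unfolding aW_def by (rule Bochner_Integration.integral_cong[OF refl]) (auto simp: indicator_def)
    ultimately show ?thesis unfolding V_def using V0_cont by (auto intro!: continuous_intros)
  qed
  show ?thesis unfolding continuous_on_iff
  proof (intro ballI allI impI)
    fix z :: "real\<times>real" and e :: real assume e: "e > 0"
    obtain t0 x0 where z: "z = (t0, x0)" by (cases z)
    obtain d where d: "d > 0" "\<And>x. dist x x0 < d \<Longrightarrow> dist (V (t0, x)) (V (t0, x0)) < e/2"
      using cx[of t0] e unfolding continuous_on_iff by (meson UNIV_I half_gt_zero)
    show "\<exists>d>0. \<forall>x'\<in>UNIV. dist x' z < d \<longrightarrow> dist (V x') (V z) < e"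
    proof (intro exI[of _ "min d (e / (2 * (Bf + 1)))"] conjI ballI impI)
      show "0 < min d (e / (2 * (Bf + 1)))" using d e B0 by simp
      fix z' assume dz: "dist z' z < min d (e / (2 * (Bf + 1)))"
      obtain t x where z': "z' = (t, x)" by (cases z')
      have "dist t t0 \<le> dist z' z" "dist x x0 \<le> dist z' z" unfolding z z' using dist_fst_le[of "(t,x)" "(t0,x0)"] dist_snd_le[of "(t,x)" "(t0,x0)"] by auto
      then have a: "dist x x0 < d" "\<bar>t - t0\<bar> < e / (2 * (Bf + 1))" using dz by (auto simp: dist_real_def)
      have "\<bar>V (t, x) - V (t0, x)\<bar> \<le> Bf * \<bar>t - t0\<bar>" by (rule V_Lipschitz_time)
      also have "\<dots> \<le> (Bf + 1) * \<bar>t - t0\<bar>" by (intro mult_right_mono) auto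
      also have "\<dots> < e/2" using a(2) B0 by (simp add: field_simps)
      finally show "dist (V z') (V z) < e" using d(2)[OF a(1)] unfolding z z' dist_real_def by linarith
    qed
  qed
qed

lemma Vm[measurable]: "V \<in> borel_measurable borel" by (rule borel_measurable_continuous_onI[OF V_cont])
lemma V_locally_bounded: "locally_bounded V" by (rule continuous_locally_bounded[OF V_cont])
lemma u_locally_bounded: "locally_bounded u" by (rule locally_bounded_bounded[OF uB])
lemma fu_locally_bounded: "locally_bounded (\<lambda>z. f (u z))" by (rule locally_bounded_bounded[OF fuB])

text \<open>This is V_t = -f(u) and V_x = u after mollification. The derivative falls on the kernel.
  In time, integration by parts brings in W and Fubini replaces it by f(u). In space the
  x-derivative of the kernel remains, and the weak equation trades it for u. The assumption on t
  keeps the kernel inside t > 0.\<close>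

lemma moll_V_derivative:
  assumes t: "1 / Suc n < fst z"
  shows "(moll n V has_derivative (\<lambda>h. fst h * (- moll n (\<lambda>y. f (u y)) z) + snd h * moll n u z)) (at z)"
proof -
  obtain t x where z: "z = (t, x)" by (cases z)
  define d where "d = 1 / real (Suc n)"
  have d: "0 < d" "d \<le> 1" "d < t" using t by (auto simp: d_def z)
  define \<kappa> where "\<kappa> = ker1 n"
  have \<kappa>0: "\<kappa> s = 0" if "d \<le> \<bar>s\<bar>" for s using that ker1(3)[of n s] by (simp add: \<kappa>_def d_def)
  obtain \<kappa>' where sm': "smooth1 \<kappa>'" and \<kappa>': "\<And>s. (\<kappa> has_real_derivative \<kappa>' s) (at s)"
    using smooth1_deriv[OF ker1(1)[of n]] by (auto simp: \<kappa>_def)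
  have \<kappa>'0: "\<kappa>' s = 0" if "d < \<bar>s\<bar>" for s
  proof -
    have "open {s. d < \<bar>s\<bar>}" by (intro open_Collect_less continuous_intros)
    then have "(\<kappa> has_real_derivative 0) (at s)"
      using that \<kappa>0 by (intro has_field_derivative_transform_within_open[OF DERIV_const[of 0], where S="{s. d < \<bar>s\<bar>}"]) auto
    then show ?thesis using \<kappa>' DERIV_unique by blast
  qed
  obtain K where smK: "smooth1 K" and K': "\<And>s. (K has_real_derivative \<kappa> s) (at s)" and K0: "\<And>s. s \<le> - d \<Longrightarrow> K s = 0"
    and K1: "\<And>s. d \<le> s \<Longrightarrow> K s = 1" and Kb: "\<And>s. 0 \<le> K s" "\<And>s. K s \<le> 1"
    using exists_step[of n] unfolding d_def[symmetric] \<kappa>_def by blast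
  have ker: "ker n = (\<lambda>y. \<kappa> (fst y) * \<kappa> (snd y))" by (auto simp: ker_def \<kappa>_def)
  have c\<kappa>: "continuous_on S \<kappa>" "continuous_on S \<kappa>'" "continuous_on S K" for S
    using smooth1_continuous ker1(1)[of n] sm' smK by (auto simp: \<kappa>_def)
  have [measurable]: "\<kappa> \<in> borel_measurable borel" "\<kappa>' \<in> borel_measurable borel" "K \<in> borel_measurable borel"
    using c\<kappa> by (auto intro: borel_measurable_continuous_onI)
  have cs: "continuous_on S (\<lambda>s. \<kappa> (s - c))" "continuous_on S (\<lambda>s. \<kappa>' (s - c))" "continuous_on S (\<lambda>s. K (s - c))" for S c
    by (auto intro!: continuous_on_compose2[OF c\<kappa>(1)[of UNIV]] continuous_on_compose2[OF c\<kappa>(2)[of UNIV]] continuous_on_compose2[OF c\<kappa>(3)[of UNIV]] continuous_intros)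
  have Ds: "((\<lambda>s. \<kappa> (s - c)) has_real_derivative \<kappa>' (s - c)) (at s)" "((\<lambda>s. K (s - c)) has_real_derivative \<kappa> (s - c)) (at s)" for c s
    using DERIV_shift[of \<kappa> "\<kappa>' (s - c)" s "- c"] DERIV_shift[of K "\<kappa> (s - c)" s "- c"] \<kappa>' K' by auto
  have int\<kappa>: "integrable lborel (\<lambda>s. \<kappa> (s - c))" "integrable lborel (\<lambda>s. \<kappa>' (s - c))" for c
  proof -
    have b: "bounded_support \<kappa>" "bounded_support \<kappa>'" unfolding bounded_support_def using \<kappa>0 \<kappa>'0 by (auto intro!: exI[of _ d])
    show "integrable lborel (\<lambda>s. \<kappa> (s - c))" "integrable lborel (\<lambda>s. \<kappa>' (s - c))"
      using integrable_conv[OF c\<kappa>(1) b(1), of "\<lambda>_. 1" c] integrable_conv[OF c\<kappa>(2) b(2), of "\<lambda>_. 1" c]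
      by (simp_all add: locally_bounded_bounded[of "\<lambda>_. 1" 1])
  qed
  define k1 where "k1 y = \<kappa>' (fst y) * \<kappa> (snd y)" for y :: "real\<times>real"
  define k2 where "k2 y = \<kappa> (fst y) * \<kappa>' (snd y)" for y :: "real\<times>real"
  have kd: "(ker n has_derivative (\<lambda>h. fst h * k1 y + snd h * k2 y)) (at y)" for y
    unfolding ker k1_def k2_def by (rule prod_has_derivative[OF \<kappa>' \<kappa>'])
  have kc: "continuous_on UNIV k1" "continuous_on UNIV k2"
    unfolding k1_def k2_def by (auto intro!: continuous_intros continuous_on_compose2[OF c\<kappa>(1)[of UNIV]] continuous_on_compose2[OF c\<kappa>(2)[of UNIV]])
  note ks = gradient_bounded_support[OF kd ker_bounded_support]
  have ik: "integrable lborel (\<lambda>y. V y * k1 (y - z))" "integrable lborel (\<lambda>y. V y * k2 (y - z))"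
    using integrable_conv[OF kc(1) ks(1) Vm V_locally_bounded] integrable_conv[OF kc(2) ks(2) Vm V_locally_bounded] by auto
  have VP: "V (s, y) = V (0, y) + (LINT r|lborel. indicator {0<..s} r * - W r y)" if "s \<in> {0..t + 1}" for s y
    using V_time[of 0 s y] that by simp
  have Wi: "integrable lborel (\<lambda>r. indicator {0<..t + 1} r * - W r y)" for y
    using W_int_interval[of 0 "t+1" y] by simp

  have in1: "(LINT s|lborel. V (s, y) * k1 ((s, y) - z)) = aW (\<lambda>s. \<kappa> (s - t)) y * \<kappa> (y - x)" for y
  proof -
    have "(LINT s|lborel. V (s, y) * k1 ((s, y) - z)) = (LINT s|lborel. indicator {0..t + 1} s * (V (s, y) * \<kappa>' (s - t)) * \<kappa> (y - x))"
    proof (rule Bochner_Integration.integral_cong[OF refl])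
      fix s
      have "s \<notin> {0..t+1} \<Longrightarrow> \<kappa>' (s - t) = 0" using d by (intro \<kappa>'0) auto
      then show "V (s, y) * k1 ((s, y) - z) = indicator {0..t + 1} s * (V (s, y) * \<kappa>' (s - t)) * \<kappa> (y - x)"
        by (cases "s \<in> {0..t+1}") (auto simp: k1_def z)
    qed
    also have "\<dots> = (LINT s|lborel. indicator {0..t + 1} s * (V (s, y) * \<kappa>' (s - t))) * \<kappa> (y - x)" by simp
    also have "(LINT s|lborel. indicator {0..t + 1} s * (V (s, y) * \<kappa>' (s - t)))
       = - V (0, y) * \<kappa> (0 - t) - (LINT r|lborel. indicator {0<..t + 1} r * (- W r y * \<kappa> (r - t)))"
      by (rule ibp_indefinite[OF _ Wi VP Ds(1) cs(2)]) (use d in \<open>auto intro!: \<kappa>0\<close>)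
    also have "\<dots> = (LINT r|lborel. indicator {0<..t + 1} r * (W r y * \<kappa> (r - t)))"
      using \<kappa>0[of "0 - t"] d by simp
    also have "\<dots> = aW (\<lambda>s. \<kappa> (s - t)) y" unfolding aW_def
    proof (rule Bochner_Integration.integral_cong[OF refl])
      fix r
      have "t + 1 < r \<Longrightarrow> \<kappa> (r - t) = 0" using d by (intro \<kappa>0) auto
      then show "indicator {0<..t + 1} r * (W r y * \<kappa> (r - t)) = indicator {0<..} r * W r y * \<kappa> (r - t)"
        by (auto simp: indicator_def)
    qed
    finally show ?thesis .
  qed
  \<comment> \<open>\<open>aW\<close> agrees with the integral of f(u) only for almost every y,
    which is enough because y is integrated out.\<close>
  have T1: "(LINT y|lborel. V y * k1 (y - z)) = moll n (\<lambda>y. f (u y)) z"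
  proof -
    have im: "integrable lborel (\<lambda>y. f (u y) * ker n (y - z))" by (rule moll_integrable[OF _ fu_locally_bounded]) measurable
    have e: "(LINT s|lborel. f (u (s, y)) * ker n ((s, y) - z)) = (LINT s|lborel. indicator {0<..} s * f (u (s, y)) * \<kappa> (s - t)) * \<kappa> (y - x)" for y
    proof -
      have "(LINT s|lborel. f (u (s, y)) * ker n ((s, y) - z)) = (LINT s|lborel. indicator {0<..} s * f (u (s, y)) * \<kappa> (s - t) * \<kappa> (y - x))"
      proof (rule Bochner_Integration.integral_cong[OF refl])
        fix s
        have "s \<le> 0 \<Longrightarrow> \<kappa> (s - t) = 0" using d by (intro \<kappa>0) auto
        then show "f (u (s, y)) * ker n ((s, y) - z) = indicator {0<..} s * f (u (s, y)) * \<kappa> (s - t) * \<kappa> (y - x)"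
          by (cases "s \<le> 0") (auto simp: ker z)
      qed
      then show ?thesis by simp
    qed
    have m1: "(\<lambda>y. aW (\<lambda>s. \<kappa> (s - t)) y * \<kappa> (y - x)) \<in> borel_measurable lborel"
      using lborel2_fubini(4)[OF ik(1)] unfolding in1 by auto
    have m2: "(\<lambda>y. (LINT s|lborel. indicator {0<..} s * f (u (s, y)) * \<kappa> (s - t)) * \<kappa> (y - x)) \<in> borel_measurable lborel"
      using lborel2_fubini(4)[OF im] unfolding e by auto
    have "(LINT y|lborel. V y * k1 (y - z)) = (LINT y|lborel. aW (\<lambda>s. \<kappa> (s - t)) y * \<kappa> (y - x))"
      unfolding lborel2_fubini(2)[OF ik(1)] in1 ..
    also have "\<dots> = (LINT y|lborel. (LINT s|lborel. indicator {0<..} s * f (u (s, y)) * \<kappa> (s - t)) * \<kappa> (y - x))"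
      by (rule integral_cong_AE[OF m1 m2]) (use aW_AE[OF int\<kappa>(1)[of t]] in eventually_elim, simp)
    also have "\<dots> = moll n (\<lambda>y. f (u y)) z" unfolding moll_def lborel2_fubini(2)[OF im] e ..
    finally show ?thesis .
  qed

  \<comment> \<open>\<open>1 - K (s - t)\<close> is the mass that the time kernel centred at t has
    beyond s. Pairing W with A therefore averages the time integrals of W from 0 over the
    kernel.\<close>
  define A where "A s = (1 - K (s - t)) * indicator {0<..t+1} s" for s
  have Ai: "integrable lborel A" unfolding A_def
  proof (subst mult.commute, rule integrable_mult_bounded[OF integrable_indicator_Ioc, where C=1])
    show "\<bar>1 - K (s - t)\<bar> \<le> 1" for s using Kb[of "s - t"] by auto
  qed measurable
  have in2: "(LINT s|lborel. V (s, y) * k2 ((s, y) - z)) = (V0 y - aW A y) * \<kappa>' (y - x)" for y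
  proof -
    have "(LINT s|lborel. V (s, y) * k2 ((s, y) - z)) = (LINT s|lborel. indicator {0..t + 1} s * (V (s, y) * \<kappa> (s - t)) * \<kappa>' (y - x))"
    proof (rule Bochner_Integration.integral_cong[OF refl])
      fix s
      have "s \<notin> {0..t+1} \<Longrightarrow> \<kappa> (s - t) = 0" using d by (intro \<kappa>0) auto
      then show "V (s, y) * k2 ((s, y) - z) = indicator {0..t + 1} s * (V (s, y) * \<kappa> (s - t)) * \<kappa>' (y - x)"
        by (cases "s \<in> {0..t+1}") (auto simp: k2_def z)
    qed
    also have "\<dots> = (LINT s|lborel. indicator {0..t + 1} s * (V (s, y) * \<kappa> (s - t))) * \<kappa>' (y - x)" by simp
    also have "(LINT s|lborel. indicator {0..t + 1} s * (V (s, y) * \<kappa> (s - t)))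
       = - V (0, y) * (K (0 - t) - 1) - (LINT r|lborel. indicator {0<..t + 1} r * (- W r y * (K (r - t) - 1)))"
    proof (rule ibp_indefinite[OF _ Wi VP])
      show "((\<lambda>s. K (s - t) - 1) has_real_derivative \<kappa> (s - t)) (at s)" for s
        using DERIV_diff[OF Ds(2)[of t s] DERIV_const[of 1]] by simp
    qed (use d cs(1) K1[of 1] in auto)
    also have "\<dots> = V0 y - aW A y"
    proof -
      have "(LINT r|lborel. indicator {0<..t + 1} r * (- W r y * (K (r - t) - 1))) = aW A y"
        unfolding aW_def A_def by (rule Bochner_Integration.integral_cong[OF refl]) (auto simp: indicator_def algebra_simps)
      then show ?thesis using K0[of "0 - t"] d V_nonpos[of 0 y] by simp
    qed
    finally show ?thesis .
  qed
  have T2: "(LINT y|lborel. V y * k2 (y - z)) = - moll n u z"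
  proof -
    have iV0: "integrable lborel (\<lambda>y. V0 y * \<kappa>' (y - x))" and iA: "integrable lborel (\<lambda>y. aW A y * \<kappa>' (y - x))"
    proof -
      have b: "bounded_support \<kappa>'" unfolding bounded_support_def using \<kappa>'0 by (auto intro!: exI[of _ d])
      show "integrable lborel (\<lambda>y. V0 y * \<kappa>' (y - x))"
        by (rule integrable_conv[OF c\<kappa>(2) b borel_measurable_continuous_onI[OF V0_cont] continuous_locally_bounded[OF V0_cont]])
      show "integrable lborel (\<lambda>y. aW A y * \<kappa>' (y - x))"
        by (rule integrable_conv[OF c\<kappa>(2) b borel_measurable_continuous_onI[OF aW_cont[OF Ai]] continuous_locally_bounded[OF aW_cont[OF Ai]]])
    qed
    define J where "J = (LINT y|lborel. \<kappa> (y - x) * u0 y)"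
    \<comment> \<open>The initial part of the potential turns into the mollified datum J, which
      cancels against the initial term of the weak form.\<close>
    have J: "(LINT y|lborel. V0 y * \<kappa>' (y - x)) = - J"
    proof -
      have "(LINT y|lborel. V0 y * \<kappa>' (y - x)) = (LINT y|lborel. indicator {x - 2..x + 2} y * (V0 y * \<kappa>' (y - x)))"
      proof (rule Bochner_Integration.integral_cong[OF refl])
        fix y
        have "y \<notin> {x - 2..x + 2} \<Longrightarrow> \<kappa>' (y - x) = 0" using d by (intro \<kappa>'0) auto
        then show "V0 y * \<kappa>' (y - x) = indicator {x - 2..x + 2} y * (V0 y * \<kappa>' (y - x))" by (auto simp: indicator_def)
      qed
      also have "\<dots> = - V0 (x - 2) * \<kappa> (x - 2 - x) - (LINT r|lborel. indicator {x - 2<..x + 2} r * (u0 r * \<kappa> (r - x)))"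
      proof (rule ibp_indefinite[OF _ u0_int _ Ds(1) cs(2)])
        show "V0 y = V0 (x - 2) + (LINT r|lborel. indicator {x - 2<..y} r * u0 r)" if "y \<in> {x - 2..x + 2}" for y
          using V0_diff[of "x - 2" y] that by simp
      qed (use d in \<open>auto intro!: \<kappa>0\<close>)
      also have "\<dots> = - J"
      proof -
        have "\<kappa> (x - 2 - x) = 0" using d by (intro \<kappa>0) auto
        moreover have "(LINT r|lborel. indicator {x - 2<..x + 2} r * (u0 r * \<kappa> (r - x))) = J" unfolding J_def
        proof (rule Bochner_Integration.integral_cong[OF refl])
          fix y
          have "y \<notin> {x - 2<..x + 2} \<Longrightarrow> \<kappa> (y - x) = 0" using d by (intro \<kappa>0) auto
          then show "indicator {x - 2<..x + 2} y * (u0 y * \<kappa> (y - x)) = \<kappa> (y - x) * u0 y" by (auto simp: indicator_def)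
        qed
        ultimately show ?thesis by simp
      qed
      finally show ?thesis .
    qed
    \<comment> \<open>The factor \<open>K (s + 2)\<close> switches on before time 0 and is 1 for s
      \<ge> 0; it serves only to make the test function compactly supported on the plane. For s > 0
      the cutoff agrees with A, and its falling edge at t has derivative minus the time
      kernel.\<close>
    define \<alpha> where "\<alpha> s = K (s + 2) * (1 + (-1) * K (s + - t))" for s
    define \<alpha>' where "\<alpha>' s = K (s + 2) * (- \<kappa> (s - t)) + \<kappa> (s + 2) * (1 - K (s - t))" for s
    have sma: "smooth1 \<alpha>" unfolding \<alpha>_def by (intro smooth1.intros(2-4) smooth1_shift smK)
    have a': "(\<alpha> has_real_derivative \<alpha>' s) (at s)" for s
    proof -
      have "((\<lambda>s. K (s + 2)) has_real_derivative \<kappa> (s + 2)) (at s)" using Ds(2)[of "-2" s] by simp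
      moreover have "((\<lambda>s. 1 - K (s - t)) has_real_derivative - \<kappa> (s - t)) (at s)"
        using DERIV_diff[OF DERIV_const[of 1] Ds(2)[of t s]] by simp
      ultimately have "((\<lambda>s. K (s + 2) * (1 - K (s - t))) has_real_derivative \<alpha>' s) (at s)"
        unfolding \<alpha>'_def by (rule DERIV_mult')
      then show ?thesis by (simp add: \<alpha>_def[abs_def])
    qed
    define \<phi> where "\<phi> y = \<alpha> (fst y) * \<kappa> (snd y + - x)" for y :: "real\<times>real"
    define g1 where "g1 y = \<alpha>' (fst y) * \<kappa> (snd y - x)" for y :: "real\<times>real"
    define g2 where "g2 y = \<alpha> (fst y) * \<kappa>' (snd y - x)" for y :: "real\<times>real"
    have \<phi>d: "(\<phi> has_derivative (\<lambda>h. fst h * g1 y + snd h * g2 y)) (at y)" for y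
    proof -
      have "((\<lambda>s. \<kappa> (s + - x)) has_real_derivative \<kappa>' (s - x)) (at s)" for s using Ds(1)[of x s] by simp
      from prod_has_derivative[OF a' this] show ?thesis by (simp only: \<phi>_def[abs_def] g1_def g2_def) simp
    qed
    have C\<phi>: "Cinf \<phi>" unfolding \<phi>_def by (rule Cinf_prod[OF sma smooth1_shift]) (simp add: \<kappa>_def ker1)
    have ca': "continuous_on UNIV \<alpha>'" unfolding \<alpha>'_def
      by (intro continuous_intros continuous_on_compose2[OF c\<kappa>(1)[of UNIV]] continuous_on_compose2[OF c\<kappa>(3)[of UNIV]]) auto
    have gc: "continuous_on UNIV g1" "continuous_on UNIV g2" unfolding g1_def g2_def
      by (auto intro!: continuous_intros continuous_on_compose2[OF c\<kappa>(1)[of UNIV]] continuous_on_compose2[OF c\<kappa>(2)[of UNIV]]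
         continuous_on_compose2[OF ca'] continuous_on_compose2[OF smooth1_continuous[OF sma, of UNIV]])
    have \<phi>0: "\<phi> y = 0" if y: "3 \<le> - fst y \<or> t + 1 \<le> fst y \<or> 1 \<le> \<bar>snd y - x\<bar>" for y
    proof -
      consider "3 \<le> - fst y" | "t + 1 \<le> fst y" | "1 \<le> \<bar>snd y - x\<bar>" using y by blast
      then show ?thesis
      proof cases
        case 1 then have "K (fst y + 2) = 0" using d by (intro K0) auto
        then show ?thesis by (simp add: \<phi>_def \<alpha>_def)
      next
        case 2 then have "K (fst y - t) = 1" using d by (intro K1) auto
        then show ?thesis by (simp add: \<phi>_def \<alpha>_def)
      next
        case 3 then have "\<kappa> (snd y - x) = 0" using d by (intro \<kappa>0) auto
        then show ?thesis by (simp add: \<phi>_def)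
      qed
    qed
    have s\<phi>: "bounded_support \<phi>" unfolding bounded_support_def
    proof (intro exI[of _ "t + 4 + \<bar>x\<bar> + 1"] allI impI)
      fix y :: "real\<times>real" assume y: "t + 4 + \<bar>x\<bar> + 1 < norm y"
      have "norm y \<le> \<bar>fst y\<bar> + \<bar>snd y\<bar>" using norm_Pair_le[of "fst y" "snd y"] by simp
      then show "\<phi> y = 0" using y d by (intro \<phi>0) linarith
    qed
    have pos: "0 \<le> \<phi> y" for y unfolding \<phi>_def \<alpha>_def \<kappa>_def using Kb ker1(2) by (intro mult_nonneg_nonneg) (auto simp: add_increasing)
    have wf: "(LINT y|lborel. indicator half_plane y * (g1 y * u y + g2 y * f (u y))) + (LINT y|lborel. \<phi> (0, y) * u0 y) = 0"
      by (rule weak_form[OF \<phi>d gc s\<phi> test_fun_bounded_support[OF C\<phi> s\<phi> pos]])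
    have Qe: "indicator half_plane y * (g1 y * u y + g2 y * f (u y)) = indicator half_plane y * (f (u y)) * (A (fst y) * \<kappa>' (snd y - x)) - u y * ker n (y - z)" for y
    proof (cases "fst y > 0")
      case True
      have K2: "K (fst y + 2) = 1" "\<kappa> (fst y + 2) = 0" using True d by (auto intro!: K1 \<kappa>0)
      have Kt: "K (fst y - t) = 1 - A (fst y)"
        using True K1[of "fst y - t"] d by (auto simp: A_def indicator_def)
      show ?thesis using True K2 by (simp add: g1_def g2_def \<alpha>_def \<alpha>'_def indicator_def ker z mem_Times_iff Kt algebra_simps)
    next
      case False
      then have "\<kappa> (fst y - t) = 0" using d by (intro \<kappa>0) auto
      then show ?thesis using False by (auto simp: ker z indicator_def mem_Times_iff)
    qed
    have im: "integrable lborel (\<lambda>y. u y * ker n (y - z))" by (rule moll_integrable[OF um u_locally_bounded])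
    have iY: "integrable lborel (\<lambda>y. indicator half_plane y * (f (u y)) * (A (fst y) * \<kappa>' (snd y - x)))"
    proof -
      have "integrable lborel (\<lambda>y. indicator half_plane y * g1 y * u y)" "integrable lborel (\<lambda>y. indicator half_plane y * g2 y * f (u y))"
        using integral_half_plane_derivative(1,2)[OF \<phi>d gc s\<phi>] by (auto intro!: integrable_mult_bounded[OF _ _ uB] integrable_mult_bounded[OF _ _ fuB])
      then have "integrable lborel (\<lambda>y. indicator half_plane y * (g1 y * u y + g2 y * f (u y)) + u y * ker n (y - z))"
        using im by (simp add: distrib_left mult.assoc)
      then show ?thesis unfolding Qe by simp
    qed
    define Y where "Y = (LINT y|lborel. indicator half_plane y * (f (u y)) * (A (fst y) * \<kappa>' (snd y - x)))"
    have p0: "(LINT y|lborel. \<phi> (0, y) * u0 y) = J"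
    proof -
      have "K 2 = 1" "K (- t) = 0" using d by (auto intro!: K1 K0)
      then show ?thesis by (simp add: J_def \<phi>_def \<alpha>_def)
    qed
    have YJ: "Y - moll n u z + J = 0" using wf iY im unfolding Qe p0 by (simp add: Y_def moll_def)
    have eY: "(LINT s|lborel. indicator half_plane (s, y) * (f (u (s, y))) * (A (fst (s, y)) * \<kappa>' (snd (s, y) - x)))
       = (LINT s|lborel. indicator {0<..} s * f (u (s, y)) * A s) * \<kappa>' (y - x)" for y
      by (simp add: half_plane_indicator mult.assoc[symmetric])
    have m1: "(\<lambda>y. aW A y * \<kappa>' (y - x)) \<in> borel_measurable lborel" using iA by auto
    have m2: "(\<lambda>y. (LINT s|lborel. indicator {0<..} s * f (u (s, y)) * A s) * \<kappa>' (y - x)) \<in> borel_measurable lborel"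
      using lborel2_fubini(4)[OF iY] unfolding eY by auto
    have "(LINT y|lborel. aW A y * \<kappa>' (y - x)) = (LINT y|lborel. (LINT s|lborel. indicator {0<..} s * f (u (s, y)) * A s) * \<kappa>' (y - x))"
      by (rule integral_cong_AE[OF m1 m2]) (use aW_AE[OF Ai] in eventually_elim, simp)
    also have "\<dots> = Y" unfolding Y_def lborel2_fubini(2)[OF iY] eY ..
    finally have "(LINT y|lborel. aW A y * \<kappa>' (y - x)) = Y" .
    moreover have "(LINT y|lborel. V y * k2 (y - z)) = (LINT y|lborel. V0 y * \<kappa>' (y - x) - aW A y * \<kappa>' (y - x))"
      unfolding lborel2_fubini(2)[OF ik(2)] in2 by (simp add: left_diff_distrib)
    ultimately show ?thesis using J YJ iV0 iA by simp
  qed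
  have "(moll n V has_derivative (\<lambda>h. fst h * (- (LINT y|lborel. V y * k1 (y - z))) + snd h * (- (LINT y|lborel. V y * k2 (y - z))))) (at z)"
    unfolding moll_def[abs_def] by (rule conv_has_derivative[OF kd kc ker_bounded_support Vm V_locally_bounded])
  then show ?thesis unfolding T1 T2 by simp
qed

end

section \<open>Viscosity supersolution property and Hopf-Lax formula\<close>

lemma moll_bounds:
  assumes "g \<in> borel_measurable borel" "locally_bounded g" and "\<And>y. norm (y - z) < 2 / Suc n \<Longrightarrow> lo \<le> g y \<and> g y \<le> hi"
  shows "lo \<le> moll n g z" "moll n g z \<le> hi"
proof -
  have c: "locally_bounded (\<lambda>_. c)" for c by (rule locally_bounded_bounded[of _ "\<bar>c\<bar>"]) simp
  have "moll n (\<lambda>_. lo) z \<le> moll n g z" by (rule moll_mono[OF _ c assms(1,2)]) (use assms(3) in auto)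
  then show "lo \<le> moll n g z" by (simp add: moll_const)
  have "moll n g z \<le> moll n (\<lambda>_. hi) z" by (rule moll_mono[OF assms(1,2) _ c]) (use assms(3) in auto)
  then show "moll n g z \<le> hi" by (simp add: moll_const)
qed

text \<open>This function is the derivative of \<open>flat_exp 1\<close> and will be the weight in
  the tested entropy inequality. The bound 2 is X^2 \<le> 2 exp(X) with X = 1/s.\<close>

lemma flat_exp_square_bounds: "0 \<le> flat_exp [:0,0,1:] s" "flat_exp [:0,0,1:] s \<le> 2" "s > 0 \<Longrightarrow> 0 < flat_exp [:0,0,1:] s" "s \<le> 0 \<Longrightarrow> flat_exp [:0,0,1:] s = 0"
proof -
  show "flat_exp [:0,0,1:] s \<le> 2"
  proof (cases "s > 0")
    case True
    then have "1 + 1/s + (1/s)\<^sup>2 / 2 \<le> exp (1/s)" by (intro exp_lower_Taylor_quadratic) auto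
    moreover have "0 \<le> 1 + 1/s" using True by simp
    ultimately have "(1/s)\<^sup>2 \<le> 2 * exp (1/s)" by linarith
    moreover have "flat_exp [:0,0,1:] s = (1/s)\<^sup>2 * exp (-(1/s))" using True by (simp add: flat_exp_def power2_eq_square)
    moreover have "(1/s)\<^sup>2 * exp (-(1/s)) \<le> (2 * exp (1/s)) * exp (-(1/s))" if "(1/s)\<^sup>2 \<le> 2 * exp (1/s)"
      using that by (intro mult_right_mono) auto
    moreover have "(2 * exp (1/s)) * exp (-(1/s)) = 2" by (simp add: exp_minus)
    ultimately show ?thesis by simp
  qed (simp add: flat_exp_def)
qed (auto simp: flat_exp_def)

context kruzkov_data begin

lemma moll_u_bound: "\<bar>moll n u z\<bar> \<le> B" 
  using moll_bounds[OF um u_locally_bounded, of z n "-B" B] uB by (simp add: abs_le_iff minus_le_iff)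

lemma moll_fu_bound: "\<bar>moll n (\<lambda>y. f (u y)) z\<bar> \<le> Bf"
proof -
  have "(\<lambda>y. f (u y)) \<in> borel_measurable borel" by measurable
  from moll_bounds[OF this fu_locally_bounded, of z n "-Bf" Bf] fuB show ?thesis by (simp add: abs_le_iff minus_le_iff)
qed

lemma moll_V_tendsto: "(\<lambda>n. moll n V z) \<longlonglongrightarrow> V z"
proof (rule LIMSEQ_I)
  fix e :: real assume e: "e > 0"
  obtain d where d: "d > 0" "\<And>y. dist y z < d \<Longrightarrow> dist (V y) (V z) < e / 2"
    using V_cont e unfolding continuous_on_iff by (meson UNIV_I half_gt_zero)
  have "(\<lambda>n. 2 * (1 / real (Suc n))) \<longlonglongrightarrow> 2 * 0" by (intro tendsto_intros LIMSEQ_Suc lim_1_over_n)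
  then have "\<forall>\<^sub>F n in sequentially. 2 * (1 / real (Suc n)) < d" using d(1) by (auto dest: order_tendstoD)
  then obtain N where N: "\<And>n. n \<ge> N \<Longrightarrow> 2 / real (Suc n) < d" by (auto simp: eventually_sequentially)
  show "\<exists>no. \<forall>n\<ge>no. norm (moll n V z - V z) < e"
  proof (intro exI[of _ N] allI impI)
    fix n assume n: "n \<ge> N"
    have "V z - e/2 \<le> V y \<and> V y \<le> V z + e/2" if "norm (y - z) < 2 / Suc n" for y
    proof -
      have "dist (V y) (V z) < e/2" by (rule d(2)) (use that N[OF n] in \<open>auto simp: dist_norm\<close>)
      then show ?thesis unfolding dist_real_def by linarith
    qed
    from moll_bounds[OF Vm V_locally_bounded, of z n, OF this] have "\<bar>moll n V z - V z\<bar> \<le> e/2" by linarith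
    then show "norm (moll n V z - V z) < e" using e by simp
  qed
qed

lemma eventually_inverse_less: "t > 0 \<Longrightarrow> \<forall>\<^sub>F n in sequentially. c / real (Suc n) < t"
proof -
  assume t: "t > 0"
  have "(\<lambda>n. c * (1 / real (Suc n))) \<longlonglongrightarrow> c * 0" by (intro tendsto_intros LIMSEQ_Suc lim_1_over_n)
  then show ?thesis using t by (auto dest: order_tendstoD)
qed

text \<open>Along the segment from (s, y) to (t, x) the mollified potential has as derivative a
  kernel average of (x - y) u - (t - s) f(u), which is at most c. For s > 0 the segment stays where
  \<open>moll_V_derivative\<close> applies once n is large.\<close>

lemma V_sub_interior:
  assumes s: "0 < s" "s < t" and c: "\<And>p. \<bar>p\<bar> \<le> B \<Longrightarrow> p * (x - y) - (t - s) * f p \<le> c"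
  shows "V (t, x) \<le> V (s, y) + c"
proof -
  have "\<forall>\<^sub>F n in sequentially. moll n V (t, x) \<le> moll n V (s, y) + c"
    using eventually_inverse_less[OF s(1), of 1]
  proof eventually_elim
    case (elim n)
    define l where "l \<tau> = (s + \<tau> * (t - s), y + \<tau> * (x - y))" for \<tau>
    define h where "h \<tau> = moll n V (l \<tau>)" for \<tau>
    define h' where "h' \<tau> = (t - s) * (- moll n (\<lambda>y. f (u y)) (l \<tau>)) + (x - y) * moll n u (l \<tau>)" for \<tau>
    have hd: "(h has_real_derivative h' \<tau>) (at \<tau>)" if "0 \<le> \<tau>" for \<tau>
    proof -
      have "1 / Suc n < fst (l \<tau>)" using elim that s by (auto simp: l_def intro: less_le_trans)
      note D = moll_V_derivative[OF this]
      have "(l has_derivative (\<lambda>k. (k * (t - s), k * (x - y)))) (at \<tau>)"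
        unfolding l_def by (auto intro!: derivative_eq_intros)
      from has_derivative_compose[OF this D] show ?thesis
        unfolding h_def h'_def has_field_derivative_def by (rule has_derivative_eq_rhs) (auto simp: algebra_simps)
    qed
    have hc: "h' \<tau> \<le> c" for \<tau>
    proof -
      have i: "integrable lborel (\<lambda>y'. u y' * ker n (y' - l \<tau>))" "integrable lborel (\<lambda>y'. f (u y') * ker n (y' - l \<tau>))"
        using moll_integrable[OF um u_locally_bounded] moll_integrable[OF _ fu_locally_bounded] by auto
      have "h' \<tau> = (LINT y'|lborel. (x - y) * (u y' * ker n (y' - l \<tau>)) - (t - s) * (f (u y') * ker n (y' - l \<tau>)))"
        using i by (simp add: h'_def moll_def)
      also have "\<dots> \<le> (LINT y'|lborel. c * ker n (y' - l \<tau>))"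
      proof (rule integral_mono)
        show "integrable lborel (\<lambda>y'. (x - y) * (u y' * ker n (y' - l \<tau>)) - (t - s) * (f (u y') * ker n (y' - l \<tau>)))" using i by simp
        show "integrable lborel (\<lambda>y'. c * ker n (y' - l \<tau>))" using ker_shift_integral by simp
        fix y'
        have "(u y' * (x - y) - (t - s) * f (u y')) * ker n (y' - l \<tau>) \<le> c * ker n (y' - l \<tau>)"
          by (intro mult_right_mono c uB ker_nonneg)
        then show "(x - y) * (u y' * ker n (y' - l \<tau>)) - (t - s) * (f (u y') * ker n (y' - l \<tau>)) \<le> c * ker n (y' - l \<tau>)"
          by (simp add: algebra_simps)
      qed
      also have "\<dots> = c" using ker_shift_integral by simp
      finally show ?thesis .
    qed
    obtain \<tau> where "h 1 - h 0 = (1 - 0) * h' \<tau>" using MVT2[of 0 1 h h'] hd by auto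
    then have "h 1 \<le> h 0 + c" using hc[of \<tau>] by simp
    then show ?case by (simp add: h_def l_def)
  qed
  then show ?thesis
    by (intro tendsto_le[OF sequentially_bot tendsto_add[OF moll_V_tendsto tendsto_const] moll_V_tendsto])
qed

lemma V_sub:
  assumes s: "0 \<le> s" "s < t" and c: "\<And>p. \<bar>p\<bar> \<le> B \<Longrightarrow> p * (x - y) - (t - s) * f p \<le> c"
  shows "V (t, x) \<le> V (s, y) + c"
proof (rule field_le_epsilon)
  fix e :: real assume e: "e > 0"
  \<comment> \<open>Starting at time s + r makes the interior estimate applicable. The shift costs
    Bf r in the constant and Bf r in V, together at most e, and the factor 1/2 keeps s + r below
    t.\<close>
  define r where "r = min ((t - s) / 2) (e / (2 * (Bf + 1)))"
  have "r \<le> (t - s) / 2" unfolding r_def by (rule min.cobounded1)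
  then have r: "0 < r" "r < t - s" using e s B0 by (auto simp: r_def)
  have re: "2 * Bf * r \<le> e"
  proof -
    have "2 * Bf * r \<le> 2 * (Bf + 1) * (e / (2 * (Bf + 1)))" using B0 r by (intro mult_mono) (auto simp: r_def)
    also have "\<dots> = e" using B0 by (simp add: field_simps)
    finally show ?thesis .
  qed
  have "V (t, x) \<le> V (s + r, y) + (c + r * Bf)"
  proof (rule V_sub_interior)
    fix p assume p: "\<bar>p\<bar> \<le> B"
    have "r * f p \<le> r * Bf" using fB[OF p] r by (intro mult_left_mono) auto
    then show "p * (x - y) - (t - (s + r)) * f p \<le> c + r * Bf" using c[OF p] by (simp add: algebra_simps)
  qed (use s r in auto)
  also have "V (s + r, y) \<le> V (s, y) + Bf * r" using V_Lipschitz_time[of "s + r" y s] r by simp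
  finally show "V (t, x) \<le> V (s, y) + c + e" using re by (simp add: algebra_simps)
qed

lemma V_Lipschitz_space: "\<bar>V (t, x) - V (t, x')\<bar> \<le> B * \<bar>x - x'\<bar>"
proof -
  have pos: "V (t, x) - V (t, x') \<le> B * \<bar>x - x'\<bar>" if t: "t > 0" for t x x'
  proof -
    have "\<forall>\<^sub>F n in sequentially. moll n V (t, x) \<le> moll n V (t, x') + B * \<bar>x - x'\<bar>"
      using eventually_inverse_less[OF t, of 1]
    proof eventually_elim
      case (elim n)
      define h where "h \<tau> = moll n V (t, x' + \<tau> * (x - x'))" for \<tau>
      define h' where "h' \<tau> = (x - x') * moll n u (t, x' + \<tau> * (x - x'))" for \<tau>
      have hd: "(h has_real_derivative h' \<tau>) (at \<tau>)" for \<tau>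
      proof -
        have "1 / Suc n < fst (t, x' + \<tau> * (x - x'))" using elim by simp
        note D = moll_V_derivative[OF this]
        have "((\<lambda>\<tau>. (t, x' + \<tau> * (x - x'))) has_derivative (\<lambda>k. (0, k * (x - x')))) (at \<tau>)"
          by (auto intro!: derivative_eq_intros)
        from has_derivative_compose[OF this D] show ?thesis
          unfolding h_def h'_def has_field_derivative_def by (rule has_derivative_eq_rhs) (auto simp: algebra_simps)
      qed
      have hc: "h' \<tau> \<le> B * \<bar>x - x'\<bar>" for \<tau>
      proof -
        have "h' \<tau> \<le> \<bar>x - x'\<bar> * \<bar>moll n u (t, x' + \<tau> * (x - x'))\<bar>" unfolding h'_def abs_mult[symmetric] by simp
        also have "\<dots> \<le> \<bar>x - x'\<bar> * B" by (intro mult_left_mono moll_u_bound) auto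
        finally show ?thesis by (simp add: mult.commute)
      qed
      obtain \<tau> where "h 1 - h 0 = (1 - 0) * h' \<tau>" using MVT2[of 0 1 h h'] hd by auto
      then have "h 1 \<le> h 0 + B * \<bar>x - x'\<bar>" using hc[of \<tau>] by simp
      then show ?case by (simp add: h_def)
    qed
    then have "V (t, x) \<le> V (t, x') + B * \<bar>x - x'\<bar>"
      by (intro tendsto_le[OF sequentially_bot tendsto_add[OF moll_V_tendsto tendsto_const] moll_V_tendsto])
    then show ?thesis by simp
  qed
  show ?thesis
  proof (cases "t > 0")
    case True then show ?thesis using pos[OF True, of x x'] pos[OF True, of x' x] by (simp add: abs_le_iff abs_minus_commute)
  next
    case False then show ?thesis using V0_Lipschitz[of x x'] by (simp add: V_nonpos)
  qed
qed

lemma V_Lipschitz: "\<bar>V z - V z'\<bar> \<le> (B + Bf) * norm (z - z')"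
proof -
  obtain t x t' x' where z: "z = (t, x)" "z' = (t', x')" by (cases z, cases z')
  have n: "\<bar>t - t'\<bar> \<le> norm (z - z')" "\<bar>x - x'\<bar> \<le> norm (z - z')"
    using norm_fst_le[of "t - t'" "x - x'"] norm_snd_le[of "x - x'" "t - t'"] by (auto simp: z)
  have "\<bar>V z - V z'\<bar> \<le> \<bar>V (t, x) - V (t', x)\<bar> + \<bar>V (t', x) - V (t', x')\<bar>" by (simp add: z)
  also have "\<dots> \<le> Bf * \<bar>t - t'\<bar> + B * \<bar>x - x'\<bar>" by (intro add_mono V_Lipschitz_time V_Lipschitz_space)
  also have "\<dots> \<le> Bf * norm (z - z') + B * norm (z - z')" using n B0 by (intro add_mono mult_left_mono) auto
  finally show ?thesis by (simp add: algebra_simps)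
qed

lemma moll_V_close: "\<bar>moll n V z - V z\<bar> \<le> (B + Bf) * (2 / Suc n)"
proof -
  have "V z - (B + Bf) * (2 / Suc n) \<le> V y \<and> V y \<le> V z + (B + Bf) * (2 / Suc n)" if "norm (y - z) < 2 / Suc n" for y
  proof -
    have "(B + Bf) * norm (y - z) \<le> (B + Bf) * (2 / Suc n)" using that B0 by (intro mult_left_mono) auto
    then show ?thesis using V_Lipschitz[of y z] by linarith
  qed
  from moll_bounds[OF Vm V_locally_bounded, of z n, OF this] show ?thesis by linarith
qed

text \<open>The entropy solution is a viscosity supersolution. The entropy inequality is tested with a smooth version of
  \<open>(\<psi> - V)\<^sup>+\<close>, where \<open>\<psi>\<close> is the touching paraboloid raised by \<open>\<delta>\<close>. Since \<open>V\<^sub>t = - f(u)\<close> and \<open>V\<^sub>x = u\<close>, the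
  entropy for \<open>|u - p|\<close> turns the integrand into \<open>|u - p| (\<psi>\<^sub>t + f(p)) + sgn(u - p) (f(u) - f(p)) (\<psi>\<^sub>x - p)\<close>.\<close>

lemma V_super:
  assumes s0: "s0 > 0" and C: "C \<ge> 0"
    and touch: "\<And>z. V (s0, y0) + b * (fst z - s0) + p * (snd z - y0) - C * (norm (z - (s0, y0)))\<^sup>2 \<le> V z"
    and F: "\<And>q. \<bar>q\<bar> \<le> B \<Longrightarrow> \<bar>f q - f p\<bar> \<le> F * \<bar>q - p\<bar>" "F \<ge> 0"
  shows "0 \<le> b + f p"
proof (rule ccontr)
  assume neg: "\<not> 0 \<le> b + f p"
  \<comment> \<open>Half of the assumed defect; the other half absorbs the errors made inside the
    small ball.\<close>
  define \<sigma> where "\<sigma> = - (b + f p) / 2"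
  have \<sigma>: "\<sigma> > 0" "b + f p = - 2 * \<sigma>" using neg by (auto simp: \<sigma>_def)
  define z0 where "z0 = (s0, y0)"
  \<comment> \<open>The extra 1 makes the contact strict: \<psi> - V is at most \<delta> minus the
    squared distance to z0.\<close>
  define C' where "C' = C + 1"
  have C': "C' \<ge> 1" using C by (simp add: C'_def)
  \<comment> \<open>On the ball of radius \<rho> the gradient of \<psi> differs from (b, p) by at
    most 2 C' \<rho> in each component; weighted by 1 + F this stays below \<sigma>. The bound s0/4
    keeps the ball in positive time.\<close>
  define \<rho> where "\<rho> = min (s0 / 4) (\<sigma> / (2 * C' * (1 + F)))"
  have \<rho>: "\<rho> > 0" "\<rho> \<le> s0 / 4" unfolding \<rho>_def using s0 \<sigma> C' F by (simp, intro min.cobounded1)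
  have \<rho>\<sigma>: "2 * C' * \<rho> * (1 + F) \<le> \<sigma>"
  proof -
    have "\<rho> \<le> \<sigma> / (2 * C' * (1 + F))" by (simp add: \<rho>_def)
    moreover have "0 < 2 * C' * (1 + F)" using C' F by simp
    ultimately have "\<rho> * (2 * C' * (1 + F)) \<le> \<sigma>" by (simp add: pos_le_divide_eq)
    then show ?thesis by (simp add: mult_ac)
  qed
  \<comment> \<open>One \<delta> is the height of the raised paraboloid, the other the allowance for
    replacing V by its mollification; together they are \<rho>^2, so the test function is supported
    in the ball.\<close>
  define \<delta> where "\<delta> = \<rho>\<^sup>2 / 2"
  have \<delta>: "\<delta> > 0" using \<rho> by (simp add: \<delta>_def)
  have nz: "(norm (z - z0))\<^sup>2 = (fst z - s0)\<^sup>2 + (snd z - y0)\<^sup>2" for z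
    by (simp add: z0_def norm_prod_def)
  define \<psi> where "\<psi> z = \<delta> + V z0 + b * (fst z - s0) + p * (snd z - y0) - C' * ((fst z - s0)\<^sup>2 + (snd z - y0)\<^sup>2)" for z
  define \<psi>t where "\<psi>t z = b - 2 * C' * (fst z - s0)" for z :: "real\<times>real"
  define \<psi>x where "\<psi>x z = p - 2 * C' * (snd z - y0)" for z :: "real\<times>real"
  have \<psi>V: "\<psi> z - V z \<le> \<delta> - (norm (z - z0))\<^sup>2" for z
    using touch[of z] unfolding \<psi>_def nz[symmetric] z0_def[symmetric] C'_def by (simp add: algebra_simps)
  have "(\<lambda>n. (B + Bf) * (2 / real (Suc n))) = (\<lambda>n. ((B + Bf) * 2) / real (Suc n))" by auto
  then have "\<forall>\<^sub>F n in sequentially. (B + Bf) * (2 / real (Suc n)) < \<delta> \<and> 1 / real (Suc n) < s0 / 2"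
    using eventually_inverse_less[OF \<delta>, of "(B + Bf) * 2"] eventually_inverse_less[of "s0/2" 1] s0 by (auto elim: eventually_elim2)
  then obtain n0 where n0: "\<And>n. n \<ge> n0 \<Longrightarrow> (B + Bf) * (2 / real (Suc n)) < \<delta> \<and> 1 / real (Suc n) < s0 / 2"
    by (auto simp: eventually_sequentially)
  define \<Psi> where "\<Psi> n z = \<psi> z - moll n V z" for n z
  have loc: "norm (z - z0) < \<rho>" if "n \<ge> n0" "\<Psi> n z > 0" for n z
  proof -
    have "V z - \<delta> < moll n V z" using moll_V_close[of n z] n0[OF that(1)] by linarith
    then have "(norm (z - z0))\<^sup>2 < \<rho>\<^sup>2" using that(2) \<psi>V[of z] by (simp add: \<Psi>_def \<delta>_def)
    then show ?thesis using \<rho> power2_less_imp_less[of "norm (z - z0)" \<rho>] by simp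
  qed
  have loct: "fst z > s0 / 2" if "norm (z - z0) < \<rho>" for z
  proof -
    have "\<bar>fst z - s0\<bar> \<le> norm (z - z0)" using norm_fst_le[of "fst z - s0" "snd z - y0"] by (cases z) (simp add: z0_def)
    then show ?thesis using that \<rho> by linarith
  qed
  define \<chi>' where "\<chi>' = flat_exp [:0,0,1:]"
  have \<chi>D: "(flat_exp 1 has_real_derivative \<chi>' s) (at s)" for s using flat_exp_has_derivative[of 1 s] by (simp add: \<chi>'_def)
  define \<Phi> where "\<Phi> n z = flat_exp 1 (\<Psi> n z)" for n z
  define mw where "mw n = moll n (\<lambda>y. f (u y))" for n
  define mu where "mu n = moll n u" for n
  define g1 where "g1 n z = \<chi>' (\<Psi> n z) * (\<psi>t z + mw n z)" for n z
  define g2 where "g2 n z = \<chi>' (\<Psi> n z) * (\<psi>x z - mu n z)" for n z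
  have \<psi>d: "(\<psi> has_derivative (\<lambda>h. fst h * \<psi>t z + snd h * \<psi>x z)) (at z)" for z
    unfolding \<psi>_def \<psi>t_def \<psi>x_def by (auto intro!: derivative_eq_intros simp: algebra_simps)
  have \<Phi>d: "(\<Phi> n has_derivative (\<lambda>h. fst h * g1 n z + snd h * g2 n z)) (at z)" if n: "n \<ge> n0" for n z
  proof (cases "\<Psi> n z > 0")
    case True
    have "1 / Suc n < fst z" using loct[OF loc[OF n True]] n0[OF n] by linarith
    note D = moll_V_derivative[OF this]
    have "(\<Psi> n has_derivative (\<lambda>h. fst h * (\<psi>t z + mw n z) + snd h * (\<psi>x z - mu n z))) (at z)"
      unfolding \<Psi>_def by (rule has_derivative_eq_rhs[OF has_derivative_diff[OF \<psi>d D]]) (auto simp: mw_def mu_def algebra_simps)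
    from has_derivative_compose[OF this \<chi>D[unfolded has_field_derivative_def]]
    show ?thesis unfolding \<Phi>_def g1_def g2_def by (rule has_derivative_eq_rhs) (auto simp: algebra_simps)
  next
    case False
    obtain a1 a2 where a: "\<And>z. (moll n V has_derivative (\<lambda>h. fst h * a1 z + snd h * a2 z)) (at z)"
      using Cinf_gradient[OF moll_Cinf[OF Vm V_locally_bounded]] by blast
    have "\<chi>' (\<Psi> n z) = 0" using False by (simp add: \<chi>'_def flat_exp_def)
    then show ?thesis
      using has_derivative_compose[OF has_derivative_diff[OF \<psi>d a] \<chi>D[unfolded has_field_derivative_def], of z]
      unfolding \<Phi>_def g1_def g2_def \<Psi>_def by simp
  qed
  have smooth2\<psi>: "smooth2 \<psi>"
  proof -
    have f: "smooth2 (\<lambda>z. fst z)" "smooth2 (\<lambda>z. snd z)"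
      using smooth2_Cinf[OF Cinf_prod[OF smooth1_ident smooth1_const[of 1]]] smooth2_Cinf[OF Cinf_prod[OF smooth1_const[of 1] smooth1_ident]] by simp_all
    have *: "smooth2 (\<lambda>z. (\<delta> + V z0) + (b * (fst z + (- s0)) + (p * (snd z + (- y0)) + (- C') * ((fst z + (- s0)) * (fst z + (- s0)) + (snd z + (- y0)) * (snd z + (- y0))))))"
      by (intro smooth2_add smooth2_mult smooth2_const f)
    have "\<psi> = (\<lambda>z. (\<delta> + V z0) + (b * (fst z + (- s0)) + (p * (snd z + (- y0)) + (- C') * ((fst z + (- s0)) * (fst z + (- s0)) + (snd z + (- y0)) * (snd z + (- y0))))))"
      by (auto simp: \<psi>_def power2_eq_square algebra_simps)
    then show ?thesis using * by simp
  qed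
  have smooth2\<Psi>: "smooth2 (\<Psi> n)" for n
  proof -
    have "smooth2 (\<lambda>z. \<psi> z + (-1) * moll n V z)"
      by (intro smooth2_add smooth2_mult smooth2_const smooth2\<psi> smooth2_Cinf[OF moll_Cinf[OF Vm V_locally_bounded]])
    then show ?thesis by (simp add: \<Psi>_def[abs_def])
  qed
  have \<Phi>C: "Cinf (\<Phi> n)" for n
  proof -
    have "smooth1 (\<lambda>x. flat_exp 1 (1 * x + 0))" by (rule smooth1_exp)
    then have "smooth2 (\<lambda>z. flat_exp 1 (\<Psi> n z))" using smooth2_comp[OF smooth2\<Psi>] by simp
    then show ?thesis unfolding \<Phi>_def[abs_def] by (rule smooth2_imp_Cinf)
  qed
  define R where "R = norm z0 + \<rho>"
  have \<Phi>0: "\<Phi> n z = 0" if "n \<ge> n0" "\<rho> \<le> norm (z - z0)" for n z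
    using loc[OF that(1), of z] that(2) by (auto simp: \<Phi>_def flat_exp_def)
  have \<Phi>s: "bounded_support (\<Phi> n)" if n: "n \<ge> n0" for n unfolding bounded_support_def
  proof (intro exI[of _ R] allI impI)
    fix z :: "real\<times>real" assume "R < norm z"
    then show "\<Phi> n z = 0" using norm_triangle_ineq2[of z z0] by (intro \<Phi>0[OF n]) (auto simp: R_def)
  qed
  have \<Phi>test: "test_fun (\<Phi> n)" if n: "n \<ge> n0" for n
    by (rule test_fun_bounded_support[OF \<Phi>C \<Phi>s[OF n]]) (simp add: \<Phi>_def flat_exp_def)
  have [measurable]: "\<Psi> n \<in> borel_measurable borel" "mw n \<in> borel_measurable borel" "mu n \<in> borel_measurable borel" for n
  proof -
    have "(\<lambda>y. f (u y)) \<in> borel_measurable borel" by measurable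
    then have "Cinf (moll n (\<lambda>y. f (u y)))" by (rule moll_Cinf[OF _ fu_locally_bounded])
    then show "mw n \<in> borel_measurable borel" unfolding mw_def by (intro borel_measurable_continuous_onI Cinf_continuous)
    show "mu n \<in> borel_measurable borel" unfolding mu_def by (intro borel_measurable_continuous_onI Cinf_continuous moll_Cinf um u_locally_bounded)
    show "\<Psi> n \<in> borel_measurable borel" by (intro borel_measurable_continuous_onI Cinf_continuous smooth2_imp_Cinf smooth2\<Psi>)
  qed
  have \<chi>c: "continuous_on UNIV \<chi>'"
    unfolding \<chi>'_def by (meson DERIV_continuous_on flat_exp_has_derivative)
  have [measurable]: "\<chi>' \<in> borel_measurable borel" by (rule borel_measurable_continuous_onI[OF \<chi>c])
  have c\<psi>: "continuous_on UNIV \<psi>" "continuous_on UNIV \<psi>t" "continuous_on UNIV \<psi>x"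
    unfolding \<psi>_def \<psi>t_def \<psi>x_def by (intro continuous_intros)+
  have [measurable]: "\<psi> \<in> borel_measurable borel" "\<psi>t \<in> borel_measurable borel" "\<psi>x \<in> borel_measurable borel"
    using c\<psi> by (auto intro: borel_measurable_continuous_onI)
  have \<psi>b: "\<bar>\<psi>t z - b\<bar> \<le> 2 * C' * \<rho>" "\<bar>\<psi>x z - p\<bar> \<le> 2 * C' * \<rho>" if "norm (z - z0) \<le> \<rho>" for z
  proof -
    have "\<bar>fst z - s0\<bar> \<le> \<rho>" "\<bar>snd z - y0\<bar> \<le> \<rho>"
      using norm_fst_le[of "fst z - s0" "snd z - y0"] norm_snd_le[of "snd z - y0" "fst z - s0"] that by (cases z; auto simp: z0_def)+
    then show "\<bar>\<psi>t z - b\<bar> \<le> 2 * C' * \<rho>" "\<bar>\<psi>x z - p\<bar> \<le> 2 * C' * \<rho>"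
      using C' by (auto simp: \<psi>t_def \<psi>x_def abs_mult intro!: mult_left_mono)
  qed
  \<comment> \<open>The entropy inequality alone gives an integrand of at most -\<sigma> |u - p|
    times the weight, which degenerates where u = p. Adding the time derivative of the test
    function, whose integral is 0, contributes at most -\<sigma> + F |u - p|. The multiple \<theta>
    = F / \<sigma> of the entropy part cancels the F |u - p|, so the sum is at most -\<sigma> times
    the weight.\<close>
  define \<theta> where "\<theta> = F / \<sigma>"
  have \<theta>: "\<theta> \<ge> 0" "\<theta> * \<sigma> = F" using F \<sigma> by (auto simp: \<theta>_def)
  define D where "D n z = indicator half_plane z * (g1 n z * (\<theta> * \<bar>u z - p\<bar> + 1) + \<theta> * (g2 n z * sgn (u z - p) * (f (u z) - f p)))" for n z
  define D\<^sub>0 where "D\<^sub>0 z = indicator half_plane z * (\<chi>' (\<psi> z - V z) * ((\<psi>t z + f (u z)) * (\<theta> * \<bar>u z - p\<bar> + 1) + \<theta> * ((\<psi>x z - u z) * sgn (u z - p) * (f (u z) - f p))))" for z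
  define H where "H = 2 * ((\<bar>b\<bar> + 2 * C' * \<rho> + Bf) * (\<theta> * (B + \<bar>p\<bar>) + 1) + \<theta> * ((\<bar>p\<bar> + 2 * C' * \<rho> + B) * (Bf + \<bar>f p\<bar>)))"
  have Db: "\<bar>D n z\<bar> \<le> indicator (cball 0 R) z * H" if n: "n \<ge> n0" for n z
  proof (cases "\<Psi> n z > 0")
    case True
    note l = loc[OF n True]
    have zR: "z \<in> cball 0 R" using l norm_triangle_ineq2[of z z0] by (simp add: R_def)
    have \<chi>2: "0 \<le> \<chi>' (\<Psi> n z)" "\<chi>' (\<Psi> n z) \<le> 2" using flat_exp_square_bounds by (auto simp: \<chi>'_def)
    have u1: "\<bar>u z - p\<bar> \<le> B + \<bar>p\<bar>" "\<bar>f (u z) - f p\<bar> \<le> Bf + \<bar>f p\<bar>" using uB[of z] fuB[of z] by linarith+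
    have a1: "\<bar>\<psi>t z + mw n z\<bar> \<le> \<bar>b\<bar> + 2 * C' * \<rho> + Bf" "\<bar>\<psi>x z - mu n z\<bar> \<le> \<bar>p\<bar> + 2 * C' * \<rho> + B"
      using \<psi>b[of z] l moll_fu_bound[of n z] moll_u_bound[of n z] unfolding mw_def mu_def by linarith+
    have p1: "\<bar>(\<psi>t z + mw n z) * (\<theta> * \<bar>u z - p\<bar> + 1)\<bar> \<le> (\<bar>b\<bar> + 2 * C' * \<rho> + Bf) * (\<theta> * (B + \<bar>p\<bar>) + 1)"
      unfolding abs_mult using a1 u1 \<theta> C' \<rho> B0 by (intro mult_mono) (auto intro!: mult_left_mono)
    have p2: "\<bar>\<theta> * ((\<psi>x z - mu n z) * sgn (u z - p) * (f (u z) - f p))\<bar> \<le> \<theta> * ((\<bar>p\<bar> + 2 * C' * \<rho> + B) * (Bf + \<bar>f p\<bar>))"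
    proof -
      have "\<bar>(\<psi>x z - mu n z) * sgn (u z - p) * (f (u z) - f p)\<bar> = (\<bar>\<psi>x z - mu n z\<bar> * \<bar>sgn (u z - p)\<bar>) * \<bar>f (u z) - f p\<bar>" by (simp add: abs_mult)
      also have "\<dots> \<le> (\<bar>\<psi>x z - mu n z\<bar> * 1) * \<bar>f (u z) - f p\<bar>" by (intro mult_right_mono mult_left_mono) (auto simp: sgn_if)
      also have "\<dots> \<le> (\<bar>p\<bar> + 2 * C' * \<rho> + B) * (Bf + \<bar>f p\<bar>)" using a1 u1 C' \<rho> B0 by (simp only: mult_1_right) (intro mult_mono; simp)
      finally show ?thesis using \<theta> by (simp add: abs_mult mult_left_mono)
    qed
    have "\<bar>D n z\<bar> = indicator half_plane z * (\<chi>' (\<Psi> n z) * \<bar>(\<psi>t z + mw n z) * (\<theta> * \<bar>u z - p\<bar> + 1) + \<theta> * ((\<psi>x z - mu n z) * sgn (u z - p) * (f (u z) - f p))\<bar>)"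
    proof -
      have "D n z = indicator half_plane z * (\<chi>' (\<Psi> n z) * ((\<psi>t z + mw n z) * (\<theta> * \<bar>u z - p\<bar> + 1) + \<theta> * ((\<psi>x z - mu n z) * sgn (u z - p) * (f (u z) - f p))))"
        by (simp add: D_def g1_def g2_def algebra_simps)
      then show ?thesis using \<chi>2 by (simp only: abs_mult) (simp add: indicator_def)
    qed
    also have "\<dots> \<le> 1 * (2 * ((\<bar>b\<bar> + 2 * C' * \<rho> + Bf) * (\<theta> * (B + \<bar>p\<bar>) + 1) + \<theta> * ((\<bar>p\<bar> + 2 * C' * \<rho> + B) * (Bf + \<bar>f p\<bar>))))"
      using \<chi>2 p1 p2 by (intro mult_mono order_trans[OF abs_triangle_ineq add_mono]) (auto simp: indicator_def)
    finally show ?thesis using zR by (simp add: H_def)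
  next
    case False
    then have "\<chi>' (\<Psi> n z) = 0" by (simp add: \<chi>'_def flat_exp_def)
    moreover have "H \<ge> 0" unfolding H_def using C' \<rho> B0 \<theta> by (intro mult_nonneg_nonneg add_nonneg_nonneg) auto
    ultimately show ?thesis by (simp add: D_def g1_def g2_def)
  qed
  have Dpos: "0 \<le> (LINT z|lborel. D n z)" if n: "n \<ge> n0" for n
  proof -
    \<comment> \<open>The divergence theorem needs continuous partials. Those supplied by
      \<open>Cinf\<close> are continuous, and uniqueness of derivatives identifies them with the
      explicit ones.\<close>
    obtain h1 h2 where h: "\<And>z. (\<Phi> n has_derivative (\<lambda>h. fst h * h1 z + snd h * h2 z)) (at z)" "Cinf h1" "Cinf h2"
      using Cinf_gradient[OF \<Phi>C] by blast
    have hg: "h1 z = g1 n z" "h2 z = g2 n z" for z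
      using dt_dx_eq[OF h(1)[of z]] dt_dx_eq[OF \<Phi>d[OF n, of z]] by auto
    have hc: "continuous_on UNIV h1" "continuous_on UNIV h2" using h Cinf_continuous by auto
    note I = integral_half_plane_derivative[OF h(1) hc \<Phi>s[OF n]]
    have i1: "integrable lborel (\<lambda>z. indicator half_plane z * g1 n z)" "integrable lborel (\<lambda>z. indicator half_plane z * g2 n z)" using I(1,2) by (simp_all add: hg)
    have \<Phi>t0: "\<Phi> n (0, y) = 0" for y
      using loct[of "(0,y)"] loc[OF n, of "(0,y)"] s0 by (force simp: \<Phi>_def flat_exp_def)
    have T: "(LINT z|lborel. indicator half_plane z * g1 n z) = 0" using I(3) by (simp add: hg \<Phi>t0)
    have E: "0 \<le> (LINT z : half_plane | lborel. g1 n z * \<bar>u z - p\<bar> + g2 n z * sgn (u z - p) * (f (u z) - f p))"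
      using entropy[OF \<Phi>test[OF n], of p] by (simp add: dt_dx_eq[OF \<Phi>d[OF n]] \<Phi>t0)
    have ub: "\<bar>\<bar>u z - p\<bar>\<bar> \<le> B + \<bar>p\<bar>" "\<bar>sgn (u z - p) * (f (u z) - f p)\<bar> \<le> Bf + \<bar>f p\<bar>" for z
    proof -
      show "\<bar>\<bar>u z - p\<bar>\<bar> \<le> B + \<bar>p\<bar>" using uB[of z] by linarith
      have "\<bar>sgn (u z - p) * (f (u z) - f p)\<bar> \<le> 1 * \<bar>f (u z) - f p\<bar>" unfolding abs_mult by (intro mult_right_mono) (auto simp: sgn_if)
      also have "1 * \<bar>f (u z) - f p\<bar> \<le> Bf + \<bar>f p\<bar>" using fuB[of z] abs_triangle_ineq4[of "f (u z)" "f p"] by simp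
      finally show "\<bar>sgn (u z - p) * (f (u z) - f p)\<bar> \<le> Bf + \<bar>f p\<bar>" .
    qed
    have i2: "integrable lborel (\<lambda>z. indicator half_plane z * g1 n z * \<bar>u z - p\<bar>)" by (rule integrable_mult_bounded[OF i1(1) _ ub(1)]) measurable
    have i3: "integrable lborel (\<lambda>z. indicator half_plane z * g2 n z * (sgn (u z - p) * (f (u z) - f p)))"
      by (rule integrable_mult_bounded[OF i1(2) _ ub(2)]) measurable
    have "D n = (\<lambda>z. \<theta> * (indicator half_plane z *\<^sub>R (g1 n z * \<bar>u z - p\<bar> + g2 n z * sgn (u z - p) * (f (u z) - f p))) + indicator half_plane z * g1 n z)"
      by (auto simp: D_def algebra_simps)
    moreover have "integrable lborel (\<lambda>z. indicator half_plane z *\<^sub>R (g1 n z * \<bar>u z - p\<bar> + g2 n z * sgn (u z - p) * (f (u z) - f p)))"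
      using Bochner_Integration.integrable_add[OF i2 i3] by (simp add: distrib_left mult.assoc)
    ultimately have "(LINT z|lborel. D n z) = \<theta> * (LINT z : half_plane | lborel. g1 n z * \<bar>u z - p\<bar> + g2 n z * sgn (u z - p) * (f (u z) - f p)) + 0"
      using i1 T by (simp add: set_lebesgue_integral_def)
    then show ?thesis using E \<theta> by simp
  qed
  have fum: "(\<lambda>y. f (u y)) \<in> borel_measurable borel" by measurable
  \<comment> \<open>Along this subsequence the averages of u and of f(u) both converge almost
    everywhere on the ball containing the supports; the shift by n0 keeps the supports
    there.\<close>
  obtain r where r: "strict_mono r" and rAE: "AE z in lborel. norm z \<le> R \<longrightarrow> (\<lambda>n. moll (r n) u z) \<longlonglongrightarrow> u z \<and> (\<lambda>n. moll (r n) (\<lambda>y. f (u y)) z) \<longlonglongrightarrow> f (u z)"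
    using moll_AE_subseq[OF um fum, of "max B Bf" R] uB fuB by (auto simp: le_max_iff_disj)
  have rn: "r (n + n0) \<ge> n0" for n using strict_mono_imp_increasing[OF r, of "n + n0"] by linarith
  have dom: "D\<^sub>0 \<in> borel_measurable lborel" "\<And>n. D (r (n + n0)) \<in> borel_measurable lborel"
    "integrable lborel (\<lambda>z::real\<times>real. indicator (cball 0 R) z * H)" "AE z in lborel. (\<lambda>n. D (r (n + n0)) z) \<longlonglongrightarrow> D\<^sub>0 z"
    "\<And>n. AE z in lborel. norm (D (r (n + n0)) z) \<le> indicator (cball 0 R) z * H"
  proof -
    show "D\<^sub>0 \<in> borel_measurable lborel" unfolding D\<^sub>0_def by measurable
    show "D (r (n + n0)) \<in> borel_measurable lborel" for n unfolding D_def g1_def g2_def by measurable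
    show "integrable lborel (\<lambda>z::real\<times>real. indicator (cball 0 R) z * H)"
      using emeasure_lborel_cball_finite[of "0::real\<times>real" R] by (intro integrable_mult_left integrable_real_indicator) auto
    show "AE z in lborel. norm (D (r (n + n0)) z) \<le> indicator (cball 0 R) z * H" for n
      using Db[OF rn] by (auto intro!: AE_I2)
    show "AE z in lborel. (\<lambda>n. D (r (n + n0)) z) \<longlonglongrightarrow> D\<^sub>0 z" using rAE
    proof eventually_elim
      case (elim z)
      show ?case
      proof (cases "norm (z - z0) < \<rho>")
        case True
        then have "norm z \<le> R" using norm_triangle_ineq2[of z z0] by (simp add: R_def)
        then have l: "(\<lambda>n. mu (r (n + n0)) z) \<longlonglongrightarrow> u z" "(\<lambda>n. mw (r (n + n0)) z) \<longlonglongrightarrow> f (u z)"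
          using elim LIMSEQ_ignore_initial_segment[of "\<lambda>n. moll (r n) u z" "u z" n0] LIMSEQ_ignore_initial_segment[of "\<lambda>n. moll (r n) (\<lambda>y. f (u y)) z" "f (u z)" n0]
          by (auto simp: mu_def mw_def)
        have "(\<lambda>n. moll (r n) V z) \<longlonglongrightarrow> V z" using LIMSEQ_subseq_LIMSEQ[OF moll_V_tendsto[of z] r] by (simp add: comp_def)
        then have "(\<lambda>n. moll (r (n + n0)) V z) \<longlonglongrightarrow> V z" by (rule LIMSEQ_ignore_initial_segment)
        then have "(\<lambda>n. \<Psi> (r (n + n0)) z) \<longlonglongrightarrow> \<psi> z - V z" unfolding \<Psi>_def by (intro tendsto_intros)
        then have c: "(\<lambda>n. \<chi>' (\<Psi> (r (n + n0)) z)) \<longlonglongrightarrow> \<chi>' (\<psi> z - V z)"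
          by (rule continuous_on_tendsto_compose[OF \<chi>c]) auto
        have "(\<lambda>n. D (r (n + n0)) z) \<longlonglongrightarrow> indicator half_plane z * ((\<chi>' (\<psi> z - V z) * (\<psi>t z + f (u z))) * (\<theta> * \<bar>u z - p\<bar> + 1) + \<theta> * ((\<chi>' (\<psi> z - V z) * (\<psi>x z - u z)) * sgn (u z - p) * (f (u z) - f p)))"
          unfolding D_def g1_def g2_def by (intro tendsto_intros c l)
        then show ?thesis by (simp add: D\<^sub>0_def algebra_simps)
      next
        case False
        then have "D (r (n + n0)) z = 0" for n using loc[OF rn[of n], of z] by (auto simp: D_def g1_def g2_def \<chi>'_def flat_exp_def)
        moreover have "D\<^sub>0 z = 0"
        proof -
          have "\<rho>\<^sup>2 \<le> (norm (z - z0))\<^sup>2" using False \<rho> by (intro power_mono) auto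
          then have "\<psi> z - V z \<le> 0" using \<psi>V[of z] \<delta> unfolding \<delta>_def by linarith
          then show ?thesis by (simp add: D\<^sub>0_def \<chi>'_def flat_exp_def)
        qed
        ultimately show ?thesis by simp
      qed
    qed
  qed
  have lim: "(\<lambda>n. LINT z|lborel. D (r (n + n0)) z) \<longlonglongrightarrow> (LINT z|lborel. D\<^sub>0 z)"
    by (rule integral_dominated_convergence[OF dom])
  have "0 \<le> (LINT z|lborel. D\<^sub>0 z)" by (rule LIMSEQ_le_const[OF lim]) (use Dpos[OF rn] in auto)
  moreover have D0le: "D\<^sub>0 z \<le> - \<sigma> * (indicator half_plane z * \<chi>' (\<psi> z - V z))" for z
  proof (cases "\<psi> z - V z > 0")
    case True
    have "(norm (z - z0))\<^sup>2 < \<rho>\<^sup>2" using True \<psi>V[of z] \<delta> unfolding \<delta>_def by linarith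
    then have l: "norm (z - z0) \<le> \<rho>" using \<rho> power2_less_imp_less[of "norm (z - z0)" \<rho>] by simp
    define a where "a = \<bar>u z - p\<bar>"
    have a0: "a \<ge> 0" by (simp add: a_def)
    have fa: "\<bar>f (u z) - f p\<bar> \<le> F * a" using F(1)[OF uB[of z]] by (simp add: a_def)
    define q where "q = sgn (u z - p) * (f (u z) - f p)"
    have qa: "\<bar>q\<bar> \<le> F * a"
    proof -
      have "\<bar>q\<bar> \<le> 1 * \<bar>f (u z) - f p\<bar>" unfolding q_def abs_mult by (intro mult_right_mono) (auto simp: sgn_if)
      then show ?thesis using fa by simp
    qed
    have uq: "(u z - p) * q = a * (f (u z) - f p)"
    proof -
      have "(u z - p) * q = ((u z - p) * sgn (u z - p)) * (f (u z) - f p)" by (simp add: q_def)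
      also have "(u z - p) * sgn (u z - p) = a" by (simp add: a_def abs_sgn)
      finally show ?thesis .
    qed
    have eq: "(\<psi>t z + f (u z)) * a + (\<psi>x z - u z) * q = a * (\<psi>t z + f p) + (\<psi>x z - p) * q"
      using uq by (simp add: algebra_simps)
    have b1: "\<psi>t z + f p \<le> - 2 * \<sigma> + 2 * C' * \<rho>" using \<psi>b(1)[OF l] \<sigma>(2) by linarith
    have b2: "(\<psi>x z - p) * q \<le> 2 * C' * \<rho> * (F * a)"
    proof -
      have "(\<psi>x z - p) * q \<le> \<bar>\<psi>x z - p\<bar> * \<bar>q\<bar>" unfolding abs_mult[symmetric] by simp
      also have "\<dots> \<le> 2 * C' * \<rho> * (F * a)" using \<psi>b(2)[OF l] qa C' \<rho> by (intro mult_mono) auto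
      finally show ?thesis .
    qed
    have "a * (\<psi>t z + f p) \<le> a * (- 2 * \<sigma> + 2 * C' * \<rho>)" using b1 a0 by (intro mult_left_mono)
    moreover have "a * (- 2 * \<sigma> + 2 * C' * \<rho>) + 2 * C' * \<rho> * (F * a) = a * (2 * C' * \<rho> * (1 + F) - 2 * \<sigma>)" by (simp add: algebra_simps)
    moreover have "a * (2 * C' * \<rho> * (1 + F) - 2 * \<sigma>) \<le> a * (- \<sigma>)" using \<rho>\<sigma> a0 by (intro mult_left_mono) auto
    ultimately have key: "(\<psi>t z + f (u z)) * a + (\<psi>x z - u z) * q \<le> - \<sigma> * a" unfolding eq using b2 by (simp add: algebra_simps)
    have "\<theta> * ((\<psi>t z + f (u z)) * a + (\<psi>x z - u z) * q) \<le> \<theta> * (- \<sigma> * a)" using key \<theta> by (intro mult_left_mono)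
    also have "\<dots> = - (F * a)" using \<theta>(2) by (simp add: algebra_simps)
    finally have k1: "\<theta> * ((\<psi>t z + f (u z)) * a + (\<psi>x z - u z) * q) \<le> - (F * a)" .
    have "2 * C' * \<rho> * 1 \<le> 2 * C' * \<rho> * (1 + F)" using C' \<rho> F by (intro mult_left_mono) auto
    then have k2: "\<psi>t z + f (u z) \<le> - \<sigma> + F * a" using b1 \<rho>\<sigma> fa by linarith
    have "(\<psi>t z + f (u z)) * (\<theta> * a + 1) + \<theta> * ((\<psi>x z - u z) * q) = \<theta> * ((\<psi>t z + f (u z)) * a + (\<psi>x z - u z) * q) + (\<psi>t z + f (u z))"
      by (simp add: algebra_simps)
    then have "(\<psi>t z + f (u z)) * (\<theta> * a + 1) + \<theta> * ((\<psi>x z - u z) * q) \<le> - \<sigma>" using k1 k2 by linarith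
    then have "\<chi>' (\<psi> z - V z) * ((\<psi>t z + f (u z)) * (\<theta> * a + 1) + \<theta> * ((\<psi>x z - u z) * q)) \<le> \<chi>' (\<psi> z - V z) * (- \<sigma>)"
      using flat_exp_square_bounds(1) by (intro mult_left_mono) (auto simp: \<chi>'_def)
    then show ?thesis unfolding D\<^sub>0_def a_def[symmetric] q_def by (simp add: indicator_def mult_ac)
  next
    case False
    then show ?thesis by (simp add: D\<^sub>0_def \<chi>'_def flat_exp_def)
  qed
  have iw: "integrable lborel (\<lambda>z. indicator half_plane z * \<chi>' (\<psi> z - V z))"
  proof (rule integrable_bounded_support[where R=R and B=2])
    show "(\<lambda>z. indicator half_plane z * \<chi>' (\<psi> z - V z)) \<in> borel_measurable borel" by measurable
    show "\<bar>indicator half_plane z * \<chi>' (\<psi> z - V z)\<bar> \<le> 2" for z using flat_exp_square_bounds(1,2) by (auto simp: \<chi>'_def indicator_def)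
    fix z :: "real\<times>real" assume "R < norm z"
    then have "\<rho> \<le> norm (z - z0)" using norm_triangle_ineq2[of z z0] by (simp add: R_def)
    then have "\<rho>\<^sup>2 \<le> (norm (z - z0))\<^sup>2" using \<rho> by (intro power_mono) auto
    then have "\<psi> z - V z \<le> 0" using \<psi>V[of z] \<delta> unfolding \<delta>_def by linarith
    then show "indicator half_plane z * \<chi>' (\<psi> z - V z) = 0" by (simp add: \<chi>'_def flat_exp_def)
  qed
  have "(LINT z|lborel. D\<^sub>0 z) \<le> (LINT z|lborel. - \<sigma> * (indicator half_plane z * \<chi>' (\<psi> z - V z)))"
  proof (rule integral_mono_AE)
    show "integrable lborel D\<^sub>0"
      by (rule integrable_dominated_convergence[OF dom])
  qed (use iw D0le in auto)
  ultimately have "0 \<le> - \<sigma> * (LINT z|lborel. indicator half_plane z * \<chi>' (\<psi> z - V z))" by simp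
  then have "(LINT z|lborel. indicator half_plane z * \<chi>' (\<psi> z - V z)) \<le> 0" using \<sigma> by (simp add: mult_le_0_iff zero_le_mult_iff)
  moreover have nn: "0 \<le> indicator half_plane z * \<chi>' (\<psi> z - V z)" for z using flat_exp_square_bounds(1) by (auto simp: \<chi>'_def)
  ultimately have "(LINT z|lborel. indicator half_plane z * \<chi>' (\<psi> z - V z)) = 0"
    by (intro antisym integral_nonneg_AE AE_I2)
  \<comment> \<open>A nonnegative weight with integral 0 vanishes almost everywhere, so V \<ge>
    \<psi> holds a.e. and, by continuity, at every point with t > 0. At z0, however, \<psi> exceeds
    V by \<delta>.\<close>
  then have "AE z in lborel. indicator half_plane z * \<chi>' (\<psi> z - V z) = 0"
    using integral_nonneg_eq_0_iff_AE[OF iw] nn by auto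
  then have "AE z in lborel. z \<notin> half_plane \<inter> {z. V z < \<psi> z}"
  proof eventually_elim
    case (elim z)
    then show ?case using flat_exp_square_bounds(3)[of "\<psi> z - V z"] by (auto simp: \<chi>'_def indicator_def split: if_splits)
  qed
  moreover have "open (half_plane \<inter> {z. V z < \<psi> z})"
    by (intro open_Int open_Times open_Collect_less V_cont c\<psi>) auto
  ultimately have "half_plane \<inter> {z. V z < \<psi> z} = {}" by (rule AE_open_imp_empty)
  moreover have "z0 \<in> half_plane \<inter> {z. V z < \<psi> z}" using s0 \<delta> by (simp add: z0_def \<psi>_def)
  ultimately show False by blast
qed

end

context kruzkov_data begin

text \<open>Lower half of the Hopf-Lax formula. The backward solution \<open>-G(T\<^sub>1 + \<tau> - s, X - y)\<close> is a smooth
  subsolution, so \<open>V\<close> plus its negative, penalised at the final time, cannot attain its minimum at a positive time.\<close>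

lemma V_super_legendre:
  assumes BK: "B < K" and sc: "sc_flux (\<lambda>p. f p + e * p\<^sup>2) K F F0 e"
    and F': "\<And>p q. \<lbrakk>\<bar>p\<bar> \<le> K; \<bar>q\<bar> \<le> K\<rbrakk> \<Longrightarrow> \<bar>f p - f q\<bar> \<le> F' * \<bar>p - q\<bar>" "F' \<ge> 0"
    and T: "T > 0" and c: "\<And>y. c \<le> V0 y + legendre (\<lambda>p. f p + e * p\<^sup>2) K T (X - y)"
  shows "c \<le> V (T, X)"
proof (rule ccontr)
  assume "\<not> c \<le> V (T, X)"
  then have \<gamma>: "c - V (T, X) > 0" by simp
  interpret sc_flux "\<lambda>p. f p + e * p\<^sup>2" K F F0 e by (rule sc)
  have F00: "F0 \<ge> 0" using F0[of 0] K B0 by auto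
  \<comment> \<open>The small time \<tau> shifts G away from its initial time and leaves room for
    the penalty. The total loss 4 \<tau> F0 + \<tau> consists of 2 \<tau> F0 at (T, X), 2 \<tau> F0
    at time 0 and the penalty \<tau>; it stays below the supposed gap.\<close>
  define \<tau> where "\<tau> = (c - V (T, X)) / (2 * (4 * F0 + 1))"
  have \<tau>: "\<tau> > 0" "4 * \<tau> * F0 + \<tau> < c - V (T, X)"
  proof -
    show "\<tau> > 0" using \<gamma> F00 by (simp add: \<tau>_def)
    have "4 * \<tau> * F0 + \<tau> = \<tau> * (4 * F0 + 1)" by (simp add: algebra_simps)
    also have "\<dots> = (c - V (T, X)) / 2" using F00 unfolding \<tau>_def by (simp add: field_simps)
    finally show "4 * \<tau> * F0 + \<tau> < c - V (T, X)" using \<gamma> by simp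
  qed
  define T1 where "T1 = T + \<tau>"
  \<comment> \<open>With this size the penalty at time T is exactly \<tau>, while it still blows up
    at T1.\<close>
  define \<mu> where "\<mu> = \<tau>\<^sup>2"
  have \<mu>: "\<mu> > 0" using \<tau> by (simp add: \<mu>_def)
  define J where "J z = V z + G (T1 + \<tau> - fst z) (X - snd z) + \<mu> / (T1 - fst z)" for z
  define j0 where "j0 = J (T, X)"
  have j0: "j0 \<le> V (T, X) + 2 * \<tau> * F0 + \<tau>"
    using zero_le[of "2 * \<tau>"] \<tau> by (simp add: j0_def J_def T1_def \<mu>_def power2_eq_square abs_le_iff)
  have J0: "j0 < J (0, y)" for y
  proof -
    have "G T (X - y) - 2 * \<tau> * F0 \<le> G (T1 + \<tau>) (X - y)"
      using Lipschitz[of T "X - y" "T1 + \<tau>" "X - y"] \<tau> by (simp add: T1_def abs_le_iff algebra_simps)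
    moreover have "0 \<le> \<mu> / T1" using \<mu> T \<tau> by (simp add: T1_def)
    ultimately have "c - 2 * \<tau> * F0 \<le> J (0, y)" using c[of y] by (simp add: J_def V_nonpos)
    then show ?thesis using j0 \<tau> by linarith
  qed
  define m0 where "m0 = V (0, X) - Bf * T1 - (T1 + \<tau>) * F0"
  have Jlow: "m0 + (K - B) * \<bar>snd z - X\<bar> + \<mu> / (T1 - fst z) \<le> J z" if "0 \<le> fst z" "fst z < T1" for z
  proof -
    obtain s y where z: "z = (s, y)" by (cases z)
    have s: "0 \<le> s" "s < T1" using that by (auto simp: z)
    have "V (0, X) - Bf * s - B * \<bar>y - X\<bar> \<le> V (s, y)"
      using V_Lipschitz_time[of s y 0] V_Lipschitz_space[of 0 y X] s by (simp add: abs_le_iff)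
    moreover have "Bf * s \<le> Bf * T1" using s B0 by (intro mult_left_mono) auto
    moreover have "K * \<bar>X - y\<bar> - (T1 + \<tau> - s) * F0 \<le> G (T1 + \<tau> - s) (X - y)" using s \<tau> by (intro coercive) auto
    moreover have "(T1 + \<tau> - s) * F0 \<le> (T1 + \<tau>) * F0" using s F00 by (intro mult_right_mono) auto
    ultimately show ?thesis unfolding J_def z m0_def by (simp add: algebra_simps abs_minus_commute)
  qed
  have pen0: "0 < \<mu> / (T1 - fst z)" if "fst z < T1" for z :: "real\<times>real" using that \<mu> by simp
  have j0m: "m0 < j0" using Jlow[of "(T, X)"] pen0[of "(T,X)"] T \<tau> by (simp add: j0_def T1_def)
  \<comment> \<open>On the sublevel set of J at j0 the penalty bounds the distance to the final time
    from below by \<theta>, and the growth rate K - B bounds the distance to X by R. The sublevel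
    set thus lies in a compact rectangle.\<close>
  define \<theta> where "\<theta> = \<mu> / (j0 - m0)"
  define R where "R = (j0 - m0) / (K - B)"
  have \<theta>: "\<theta> > 0" using \<mu> j0m by (simp add: \<theta>_def)
  define S where "S = {0..T1 - \<theta>} \<times> {X - R..X + R}"
  have inS: "z \<in> S" if z: "0 \<le> fst z" "fst z < T1" "J z \<le> j0" for z
  proof -
    have a: "(K - B) * \<bar>snd z - X\<bar> \<le> j0 - m0" using Jlow[OF z(1,2)] pen0[OF z(2)] z(3) by linarith
    have "0 \<le> (K - B) * \<bar>snd z - X\<bar>" using BK by simp
    then have b: "\<mu> / (T1 - fst z) \<le> j0 - m0" using Jlow[OF z(1,2)] z(3) by linarith
    have "\<bar>snd z - X\<bar> \<le> R" using a BK by (simp add: R_def pos_le_divide_eq mult.commute)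
    moreover have "\<theta> \<le> T1 - fst z" using b z(2) j0m by (simp add: \<theta>_def field_simps)
    ultimately show ?thesis using z by (auto simp: S_def mem_Times_iff abs_le_iff)
  qed
  have Gc: "continuous_on UNIV (\<lambda>z. G (T1 + \<tau> - fst z) (X - snd z))"
  proof (rule lipschitz_on_continuous_on[of "F0 + K"], rule lipschitz_onI)
    fix z z' :: "real\<times>real"
    have "\<bar>G (T1 + \<tau> - fst z) (X - snd z) - G (T1 + \<tau> - fst z') (X - snd z')\<bar> \<le> F0 * \<bar>fst z - fst z'\<bar> + K * \<bar>snd z - snd z'\<bar>"
      using Lipschitz[of "T1 + \<tau> - fst z" "X - snd z" "T1 + \<tau> - fst z'" "X - snd z'"] by (simp add: abs_minus_commute)
    also have "\<dots> \<le> F0 * dist z z' + K * dist z z'"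
      using dist_fst_le[of z z'] dist_snd_le[of z z'] F00 K B0 by (intro add_mono mult_left_mono) (auto simp: dist_real_def)
    finally show "dist (G (T1 + \<tau> - fst z) (X - snd z)) (G (T1 + \<tau> - fst z') (X - snd z')) \<le> (F0 + K) * dist z z'"
      by (simp add: dist_real_def algebra_simps)
  qed (use F00 K B0 in auto)
  have Jc: "continuous_on S J" unfolding J_def
  proof (intro continuous_intros continuous_on_subset[OF V_cont] continuous_on_subset[OF Gc])
    show "\<forall>z\<in>S. T1 - fst z \<noteq> 0" using \<theta> by (auto simp: S_def)
  qed auto
  have TXS: "(T, X) \<in> S" using T \<tau> by (intro inS) (auto simp: T1_def j0_def)
  have "compact S" unfolding S_def by (intro compact_Times) auto
  then obtain z0 where z0: "z0 \<in> S" "\<And>z. z \<in> S \<Longrightarrow> J z0 \<le> J z"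
    using continuous_attains_inf[OF _ _ Jc] TXS by blast
  have min: "J z0 \<le> J z" if "0 \<le> fst z" "fst z < T1" for z
    using z0(2)[OF TXS] z0(2)[of z] inS[OF that] by (cases "J z \<le> j0") (auto simp: j0_def)
  obtain s0 y0 where z0e: "z0 = (s0, y0)" by (cases z0)
  have s0: "0 < s0" "s0 < T1"
  proof -
    have "s0 \<noteq> 0" using J0[of y0] z0(2)[OF TXS] z0e by (auto simp: j0_def)
    moreover have "0 \<le> s0" using z0(1) by (simp add: S_def z0e)
    ultimately show "0 < s0" by simp
    show "s0 < T1" using z0(1) \<theta> by (simp add: S_def z0e)
  qed
  define a where "a = T1 - s0"
  have a: "a > 0" using s0 by (simp add: a_def)
  define t0 where "t0 = T1 + \<tau> - s0"
  have t0: "t0 > 0" using s0 \<tau> by (simp add: t0_def)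
  obtain p where p: "p \<in> {-K..K}" "\<And>q. q \<in> {-K..K} \<Longrightarrow> q * (X - y0) - t0 * (f q + e * q\<^sup>2) \<le> p * (X - y0) - t0 * (f p + e * p\<^sup>2)"
    using attained[of t0 "X - y0"] by blast
  \<comment> \<open>The time slope of the function touching V from below at the minimum of J. With
    it, b + f(p) equals minus \<open>e * p\<^sup>2\<close> minus the positive slope of the penalty,
    which contradicts the supersolution property.\<close>
  define b where "b = - (f p + e * p\<^sup>2) - \<mu> / a\<^sup>2"
  define r where "r = min s0 (a / 2)"
  have r: "r > 0" using s0 a by (simp add: r_def)
  define C2 where "C2 = (1 + F)\<^sup>2 / (4 * t0 * e) + \<mu> * (2 / a ^ 3)"
  \<comment> \<open>\<open>C2\<close> collects the quadratic errors of G and of the penalty within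
    distance r. The second summand makes the paraboloid fall below the Lipschitz lower bound of V at
    all greater distances, so that it touches globally.\<close>
  define C where "C = C2 + (B + Bf + \<bar>b\<bar> + \<bar>p\<bar>) / r"
  have C20: "C2 \<ge> 0" using t0 e a \<mu> F by (simp add: C2_def)
  have C: "C \<ge> C2" "C \<ge> (B + Bf + \<bar>b\<bar> + \<bar>p\<bar>) / r" using C20 r B0 by (auto simp: C_def)
  have "0 \<le> b + f p"
  proof (rule V_super[where C=C and F=F' and ?s0.0=s0 and ?y0.0=y0])
    show "\<bar>f q - f p\<bar> \<le> F' * \<bar>q - p\<bar>" if "\<bar>q\<bar> \<le> B" for q using F'(1)[of q p] p(1) that BK by (auto simp: abs_le_iff)
    fix z :: "real\<times>real"
    define n where "n = norm (z - (s0, y0))"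
    define h where "h = fst z - s0"
    define k where "k = snd z - y0"
    have hk: "\<bar>h\<bar> \<le> n" "\<bar>k\<bar> \<le> n"
      using norm_fst_le[of h k] norm_snd_le[of k h] by (cases z; simp add: n_def h_def k_def)+
    have n0: "n \<ge> 0" by (simp add: n_def)
    have goal: "V (s0, y0) + b * h + p * k - C * n\<^sup>2 \<le> V z"
    proof (cases "n \<le> r")
      case True
      have fz: "0 \<le> fst z" "fst z < T1" "\<bar>h\<bar> \<le> a / 2" using hk True a by (auto simp: r_def h_def a_def)
      have g: "G (T1 + \<tau> - fst z) (X - snd z) \<le> G t0 (X - y0) - p * k + h * (f p + e * p\<^sup>2) + (1 + F)\<^sup>2 / (4 * t0 * e) * n\<^sup>2"
      proof -
        have "G (T1 + \<tau> - fst z) (X - snd z) \<le> G t0 (X - y0) + p * ((X - snd z) - (X - y0)) - ((T1 + \<tau> - fst z) - t0) * (f p + e * p\<^sup>2)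
           + (\<bar>(X - snd z) - (X - y0)\<bar> + F * \<bar>(T1 + \<tau> - fst z) - t0\<bar>)\<^sup>2 / (4 * t0 * e)"
          by (rule quadratic_bound[OF p t0])
        also have "(X - snd z) - (X - y0) = - k" by (simp add: k_def)
        also have "(T1 + \<tau> - fst z) - t0 = - h" by (simp add: h_def t0_def)
        also have "(\<bar>- k\<bar> + F * \<bar>- h\<bar>)\<^sup>2 / (4 * t0 * e) \<le> ((1 + F) * n)\<^sup>2 / (4 * t0 * e)"
        proof (intro divide_right_mono power_mono)
          have "F * \<bar>h\<bar> \<le> F * n" using hk F by (intro mult_left_mono)
          then show "\<bar>- k\<bar> + F * \<bar>- h\<bar> \<le> (1 + F) * n" using hk by (simp add: algebra_simps)
        qed (use F t0 e in auto)
        also have "((1 + F) * n)\<^sup>2 / (4 * t0 * e) = (1 + F)\<^sup>2 / (4 * t0 * e) * n\<^sup>2" by (simp add: power_mult_distrib)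
        finally show ?thesis by (simp add: algebra_simps)
      qed
      have pe: "\<mu> / (T1 - fst z) \<le> \<mu> / a + \<mu> / a\<^sup>2 * h + \<mu> * (2 / a ^ 3) * n\<^sup>2"
      proof -
        have ah: "a / 2 \<le> a - h" "0 < a - h" using fz(3) a by auto
        \<comment> \<open>Exact second-order expansion; since |h| \<le> a/2 the denominator of the
          remainder is at least half of a^3.\<close>
        have "1 / (a - h) = 1 / a + h / a\<^sup>2 + h\<^sup>2 / (a\<^sup>2 * (a - h))"
          using a ah by (simp add: field_simps power2_eq_square)
        also have "h\<^sup>2 / (a\<^sup>2 * (a - h)) \<le> h\<^sup>2 / (a\<^sup>2 * (a / 2))"
          using a ah by (intro divide_left_mono mult_left_mono mult_pos_pos) auto
        also have "\<dots> = (2 / a ^ 3) * h\<^sup>2" using a by (simp add: power2_eq_square power3_eq_cube)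
        also have "\<dots> \<le> (2 / a ^ 3) * n\<^sup>2" using a hk n0 by (intro mult_left_mono) (auto simp: abs_le_square_iff[symmetric])
        finally have "1 / (a - h) \<le> 1 / a + h / a\<^sup>2 + (2 / a ^ 3) * n\<^sup>2" by simp
        then have "\<mu> * (1 / (a - h)) \<le> \<mu> * (1 / a + h / a\<^sup>2 + (2 / a ^ 3) * n\<^sup>2)" using \<mu> by (intro mult_left_mono) auto
        moreover have "T1 - fst z = a - h" by (simp add: a_def h_def)
        ultimately show ?thesis by (simp only:) (simp add: distrib_left)
      qed
      have "J z0 = V (s0, y0) + G t0 (X - y0) + \<mu> / a" by (simp add: J_def z0e t0_def a_def)
      then have "V (s0, y0) + b * h + p * k - C2 * n\<^sup>2 \<le> V z"
        using min[OF fz(1,2)] g pe unfolding J_def b_def C2_def by (simp add: algebra_simps)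
      moreover have "C2 * n\<^sup>2 \<le> C * n\<^sup>2" using C by (intro mult_right_mono) auto
      ultimately show ?thesis by linarith
    next
      case False
      have "b * h + p * k \<le> \<bar>b\<bar> * n + \<bar>p\<bar> * n"
      proof (rule add_mono)
        have "b * h \<le> \<bar>b\<bar> * \<bar>h\<bar>" unfolding abs_mult[symmetric] by simp
        also have "\<dots> \<le> \<bar>b\<bar> * n" using hk by (intro mult_left_mono) auto
        finally show "b * h \<le> \<bar>b\<bar> * n" .
        have "p * k \<le> \<bar>p\<bar> * \<bar>k\<bar>" unfolding abs_mult[symmetric] by simp
        also have "\<dots> \<le> \<bar>p\<bar> * n" using hk by (intro mult_left_mono) auto
        finally show "p * k \<le> \<bar>p\<bar> * n" .
      qed
      moreover have "(B + Bf + \<bar>b\<bar> + \<bar>p\<bar>) * n \<le> C * n\<^sup>2"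
      proof -
        have "(B + Bf + \<bar>b\<bar> + \<bar>p\<bar>) * n \<le> (B + Bf + \<bar>b\<bar> + \<bar>p\<bar>) * n * (n / r)"
        proof -
          have "1 \<le> n / r" using False r by simp
          then have "(B + Bf + \<bar>b\<bar> + \<bar>p\<bar>) * n * 1 \<le> (B + Bf + \<bar>b\<bar> + \<bar>p\<bar>) * n * (n / r)" using n0 B0 by (intro mult_left_mono) auto
          then show ?thesis by simp
        qed
        also have "\<dots> = ((B + Bf + \<bar>b\<bar> + \<bar>p\<bar>) / r) * n\<^sup>2" by (simp add: power2_eq_square)
        also have "\<dots> \<le> C * n\<^sup>2" using C by (intro mult_right_mono) auto
        finally show ?thesis .
      qed
      moreover have "V (s0, y0) - (B + Bf) * n \<le> V z" using V_Lipschitz[of z "(s0,y0)"] by (simp add: n_def abs_le_iff)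
      ultimately show ?thesis by (simp add: algebra_simps)
    qed
    then show "V (s0, y0) + b * (fst z - s0) + p * (snd z - y0) - C * (norm (z - (s0, y0)))\<^sup>2 \<le> V z"
      by (simp add: h_def k_def n_def)
  qed (use s0 C C20 F' in auto)
  moreover have "\<mu> / a\<^sup>2 > 0" using \<mu> a by simp
  moreover have "e * p\<^sup>2 \<ge> 0" using e by simp
  ultimately show False unfolding b_def by linarith
qed

end

section \<open>Hopf-Lax formula and maximum principle for a convex flux\<close>

lemma continuous_antiderivative:
  fixes g :: "real \<Rightarrow> real"
  assumes c: "continuous_on UNIV g"
  shows "\<exists>P. \<forall>x. (P has_real_derivative g x) (at x)"
proof -
  define P where "P x = (if 0 \<le> x then integral {0..x} g else - integral {x..0} g)" for x
  have i: "g integrable_on {a..b}" for a b by (intro integrable_continuous_real continuous_on_subset[OF c]) auto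
  have "(P has_real_derivative g x) (at x)" for x
  proof -
    define a where "a = \<bar>x\<bar> + 1"
    have eq: "P y = integral {-a..y} g - integral {-a..0} g" if "y \<in> {-a<..<a}" for y
    proof (cases "0 \<le> y")
      case True
      have "integral {-a..0} g + integral {0..y} g = integral {-a..y} g"
        using True by (intro Henstock_Kurzweil_Integration.integral_combine i) (auto simp: a_def)
      then show ?thesis using True by (simp add: P_def)
    next
      case False
      have "integral {-a..y} g + integral {y..0} g = integral {-a..0} g"
        using False that by (intro Henstock_Kurzweil_Integration.integral_combine i) auto
      then show ?thesis using False by (simp add: P_def)
    qed
    have x: "x \<in> {-a<..<a}" by (auto simp: a_def)
    have "((\<lambda>y. integral {-a..y} g) has_real_derivative g x) (at x within {-a..a})"
      by (rule integral_has_real_derivative[OF continuous_on_subset[OF c]]) (use x in auto)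
    then have "((\<lambda>y. integral {-a..y} g) has_real_derivative g x) (at x within {-a<..<a})" by (rule DERIV_subset) auto
    then have "((\<lambda>y. integral {-a..y} g) has_real_derivative g x) (at x)" using x by (subst (asm) at_within_open) auto
    then have "((\<lambda>y. integral {-a..y} g - integral {-a..0} g) has_real_derivative g x) (at x)"
      using DERIV_diff[OF _ DERIV_const] by fastforce
    then show ?thesis
      by (rule has_field_derivative_transform_within_open[where S="{-a<..<a}"]) (use x eq in auto)
  qed
  then show ?thesis by blast
qed

lemma AE_lborel_translate:
  fixes P :: "real \<Rightarrow> bool"
  assumes "AE x in lborel. P x" shows "AE x in lborel. P (x + c)"
proof -
  obtain N where N: "{x \<in> space lborel. \<not> P x} \<subseteq> N" "N \<in> null_sets (lborel :: real measure)"
    using assms unfolding eventually_ae_filter by blast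
  have [measurable]: "N \<in> sets borel" using null_setsD2[OF N(2)] by simp
  have "AE x in lborel. x \<notin> N" by (rule AE_not_in[OF N(2)])
  then have "AE x in lborel. c + 1 * x \<notin> N" by (intro AE_borel_affine) auto
  then show ?thesis by eventually_elim (use N in \<open>auto simp: add.commute\<close>)
qed

lemma legendre_reflect: "legendre f K t (- z) = legendre (\<lambda>p. f (- p)) K t z"
proof -
  have "(\<lambda>p. p * (- z) - t * f p) ` {-K..K} = (\<lambda>p. p * z - t * f (- p)) ` {-K..K}"
  proof (intro equalityI subsetI)
    fix y assume "y \<in> (\<lambda>p. p * (- z) - t * f p) ` {-K..K}"
    then obtain p where p: "p \<in> {-K..K}" "y = p * (- z) - t * f p" by blast
    then show "y \<in> (\<lambda>p. p * z - t * f (- p)) ` {-K..K}" by (intro image_eqI[of _ _ "-p"]) auto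
  next
    fix y assume "y \<in> (\<lambda>p. p * z - t * f (- p)) ` {-K..K}"
    then obtain p where p: "p \<in> {-K..K}" "y = p * z - t * f (- p)" by blast
    then show "y \<in> (\<lambda>p. p * (- z) - t * f p) ` {-K..K}" by (intro image_eqI[of _ _ "-p"]) auto
  qed
  then show ?thesis by (simp add: legendre_def)
qed

text \<open>Two Lipschitz constants are kept apart. \<open>F'\<close> on the large interval supports
  the qualitative arguments and disappears in the end; \<open>L\<close> on the range of the datum
  enters the final bound.\<close>

locale convex_kruzkov_data = kruzkov_data +
  fixes m M L F' :: real
  assumes u0_range: "\<And>y. m \<le> u0 y \<and> u0 y \<le> M" and mM: "- B \<le> m" "m \<le> M" "M \<le> B"
    and f_convex: "convex_on UNIV f"
    and f_Lip: "\<And>p q. \<lbrakk>\<bar>p\<bar> \<le> B + 1; \<bar>q\<bar> \<le> B + 1\<rbrakk> \<Longrightarrow> \<bar>f p - f q\<bar> \<le> F' * \<bar>p - q\<bar>" "F' \<ge> 0"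
    and f_L: "\<And>p q. \<lbrakk>p \<in> {m..M}; q \<in> {m..M}\<rbrakk> \<Longrightarrow> \<bar>f p - f q\<bar> \<le> L * \<bar>p - q\<bar>" "L \<ge> 0"
begin

text \<open>The perturbed flux is strongly convex with modulus e. The slope bound K exceeds B by 1,
  so G grows strictly faster than the potential can decrease.\<close>

abbreviation "fe e \<equiv> (\<lambda>p. f p + e * p\<^sup>2)"
abbreviation "K \<equiv> B + 1"
abbreviation "Fe e \<equiv> F' + 2 * K * e"
abbreviation "F0e e \<equiv> \<bar>f 0\<bar> + F' * K + e * K\<^sup>2"

lemma square_Lip: "\<lbrakk>\<bar>p\<bar> \<le> k; \<bar>q\<bar> \<le> k; 0 \<le> e\<rbrakk> \<Longrightarrow> \<bar>e * p\<^sup>2 - e * q\<^sup>2\<bar> \<le> (2 * k * e) * \<bar>p - q\<bar>" for p q k e :: real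
proof -
  assume a: "\<bar>p\<bar> \<le> k" "\<bar>q\<bar> \<le> k" "0 \<le> e"
  have "e * p\<^sup>2 - e * q\<^sup>2 = e * ((p + q) * (p - q))" by (simp add: power2_eq_square algebra_simps)
  then have "\<bar>e * p\<^sup>2 - e * q\<^sup>2\<bar> = e * (\<bar>p + q\<bar> * \<bar>p - q\<bar>)" using a(3) by (simp add: abs_mult)
  also have "\<dots> \<le> e * ((2 * k) * \<bar>p - q\<bar>)" using a by (intro mult_left_mono mult_right_mono) auto
  finally show ?thesis by (simp add: algebra_simps)
qed

lemma fe_sc:
  assumes e: "e > 0"
  shows "sc_flux (fe e) K (Fe e) (F0e e) e" "sc_flux (\<lambda>p. fe e (- p)) K (Fe e) (F0e e) e"
proof -
  have L: "\<bar>fe e p - fe e q\<bar> \<le> Fe e * \<bar>p - q\<bar>" if "\<bar>p\<bar> \<le> K" "\<bar>q\<bar> \<le> K" for p q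
  proof -
    have "\<bar>fe e p - fe e q\<bar> \<le> \<bar>f p - f q\<bar> + \<bar>e * p\<^sup>2 - e * q\<^sup>2\<bar>" by linarith
    also have "\<dots> \<le> F' * \<bar>p - q\<bar> + (2 * K * e) * \<bar>p - q\<bar>" using that e by (intro add_mono f_Lip square_Lip) auto
    finally show ?thesis by (simp add: algebra_simps)
  qed
  have b: "\<bar>fe e p\<bar> \<le> F0e e" if "\<bar>p\<bar> \<le> K" for p
  proof -
    have "\<bar>f p - f 0\<bar> \<le> F' * \<bar>p\<bar>" using f_Lip(1)[of p 0] that B0 by simp
    also have "\<dots> \<le> F' * K" using that f_Lip(2) by (intro mult_left_mono)
    finally have 1: "\<bar>f p\<bar> \<le> \<bar>f 0\<bar> + F' * K" by linarith
    have "p\<^sup>2 \<le> K\<^sup>2" using that B0 by (simp add: abs_le_square_iff[symmetric])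
    then have "e * p\<^sup>2 \<le> e * K\<^sup>2" using e by (intro mult_left_mono) auto
    moreover have "0 \<le> e * p\<^sup>2" using e by simp
    ultimately show ?thesis using 1 by linarith
  qed
  have s1: "strongly_convex e {-K..K} (fe e)" by (rule strongly_convex_add_square[OF f_convex])
  have s2: "strongly_convex e {-K..K} (\<lambda>p. fe e (- p))" unfolding strongly_convex_def
  proof (intro ballI)
    fix p q l assume pq: "p \<in> {-K..K}" "q \<in> {-K..K}" "l \<in> {0..1::real}"
    have "fe e (l * (-p) + (1 - l) * (-q)) \<le> l * fe e (-p) + (1 - l) * fe e (-q) - e * l * (1 - l) * ((-p) - (-q))\<^sup>2"
      by (rule s1[unfolded strongly_convex_def, rule_format]) (use pq in auto)
    moreover have "l * (-p) + (1 - l) * (-q) = - (l * p + (1 - l) * q)" by (simp add: algebra_simps)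
    moreover have "((-p) - (-q))\<^sup>2 = (p - q)\<^sup>2" by (simp add: power2_commute)
    ultimately show "fe e (- (l * p + (1 - l) * q)) \<le> l * fe e (-p) + (1 - l) * fe e (-q) - e * l * (1 - l) * (p - q)\<^sup>2" by simp
  qed
  show "sc_flux (fe e) K (Fe e) (F0e e) e"
    by unfold_locales (use L b s1 e B0 f_Lip(2) in auto)
  show "sc_flux (\<lambda>p. fe e (- p)) K (Fe e) (F0e e) e"
  proof unfold_locales
    show "\<bar>fe e (- p) - fe e (- q)\<bar> \<le> Fe e * \<bar>p - q\<bar>" if "p \<in> {-K..K}" "q \<in> {-K..K}" for p q
      using L[of "-p" "-q"] that by (auto simp: abs_minus_commute)
    show "\<bar>fe e (- p)\<bar> \<le> F0e e" if "p \<in> {-K..K}" for p using b[of "-p"] that by auto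
  qed (use s2 e B0 f_Lip(2) in auto)
qed

text \<open>The perturbation raises the flux by at most \<open>e * K\<^sup>2\<close> on [-K, K] and
  so lowers G by at most t times that. The lower half carries no such error, because a smaller G
  only weakens it.\<close>

lemma HL_upper:
  assumes e: "e > 0" and t: "t > 0"
  shows "V (t, x) \<le> V0 y + legendre (fe e) K t (x - y) + t * e * K\<^sup>2"
proof -
  interpret sc_flux "fe e" K "Fe e" "F0e e" e by (rule fe_sc(1)[OF e])
  have "V (t, x) \<le> V (0, y) + (legendre (fe e) K t (x - y) + t * e * K\<^sup>2)"
  proof (rule V_sub)
    fix p :: real assume p: "\<bar>p\<bar> \<le> B"
    have "p * (x - y) - t * fe e p \<le> legendre (fe e) K t (x - y)" using p by (intro ge) auto
    moreover have "t * (e * p\<^sup>2) \<le> t * (e * K\<^sup>2)" using p t e B0 by (intro mult_left_mono) (auto simp: abs_le_square_iff[symmetric])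
    ultimately show "p * (x - y) - (t - 0) * f p \<le> legendre (fe e) K t (x - y) + t * e * K\<^sup>2" by (simp add: algebra_simps)
  qed (use t in auto)
  then show ?thesis by (simp add: V_nonpos)
qed

lemma HL_lower:
  assumes e: "e > 0" and t: "t > 0" and c: "\<And>y. c \<le> V0 y + legendre (fe e) K t (x - y)"
  shows "c \<le> V (t, x)"
  by (rule V_super_legendre[OF _ fe_sc(1)[OF e] f_Lip t c]) auto

lemma V0_slope: "0 \<le> a \<Longrightarrow> m * a \<le> V0 (y + a) - V0 y \<and> V0 (y + a) - V0 y \<le> M * a"
proof -
  assume a: "0 \<le> a"
  have d: "V0 (y + a) - V0 y = (LINT s|lborel. indicator {y<..y + a} s * u0 s)" using V0_diff[of y "y + a"] a by simp
  have "(LINT s|lborel. indicator {y<..y + a} s * m) \<le> (LINT s|lborel. indicator {y<..y + a} s * u0 s)"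
    "(LINT s|lborel. indicator {y<..y + a} s * u0 s) \<le> (LINT s|lborel. indicator {y<..y + a} s * M)"
    by (rule integral_mono, simp, rule u0_int, rule mult_left_mono, use u0_range in simp, simp)
       (rule integral_mono, rule u0_int, simp, rule mult_left_mono, use u0_range in simp, simp)
  then show ?thesis using a d by (simp add: mult.commute)
qed

text \<open>The maximum principle by translation: moving the foot together with the observation
  point leaves G unchanged, so a Hopf-Lax candidate changes only by an increment of V0, which lies
  between m a and M a. The error from \<open>fe e\<close> vanishes with e.\<close>

lemma V_space_slope:
  assumes a: "0 \<le> a" shows "m * a \<le> V (t, x + a) - V (t, x)" "V (t, x + a) - V (t, x) \<le> M * a"
proof -
  have "m * a \<le> V (t, x + a) - V (t, x) \<and> V (t, x + a) - V (t, x) \<le> M * a"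
  proof (cases "t > 0")
    case False then show ?thesis using V0_slope[OF a] by (simp add: V_nonpos)
  next
    case True
    have up: "V (t, x + a) - M * a - t * e * K\<^sup>2 \<le> V (t, x)" if e: "e > 0" for e
    proof (rule HL_lower[OF e True])
      fix y show "V (t, x + a) - M * a - t * e * K\<^sup>2 \<le> V0 y + legendre (fe e) K t (x - y)"
        using HL_upper[OF e True, of "x + a" "y + a"] V0_slope[OF a, of y] by simp
    qed
    have lo: "V (t, x) + m * a - t * e * K\<^sup>2 \<le> V (t, x + a)" if e: "e > 0" for e
    proof (rule HL_lower[OF e True])
      fix y show "V (t, x) + m * a - t * e * K\<^sup>2 \<le> V0 y + legendre (fe e) K t (x + a - y)"
        using HL_upper[OF e True, of x "y - a"] V0_slope[OF a, of "y - a"] by (simp add: algebra_simps)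
    qed
    have tk: "t * K\<^sup>2 > 0" using True B0 by simp
    have "V (t, x + a) - M * a \<le> V (t, x) + d" if "d > 0" for d using up[of "d / (t * K\<^sup>2)"] tk that B0 True by simp
    then have 1: "V (t, x + a) - M * a \<le> V (t, x)" by (rule field_le_epsilon)
    have "V (t, x) + m * a \<le> V (t, x + a) + d" if "d > 0" for d using lo[of "d / (t * K\<^sup>2)"] tk that B0 True by simp
    then have 2: "V (t, x) + m * a \<le> V (t, x + a)" by (rule field_le_epsilon)
    show ?thesis using 1 2 by simp
  qed
  then show "m * a \<le> V (t, x + a) - V (t, x)" "V (t, x + a) - V (t, x) \<le> M * a" by auto
qed

text \<open>Mollification preserves the bounds on the spatial increments of V, and its derivative in
  x is the mollified u.\<close>

lemma moll_u_range:
  assumes t: "1 / Suc n < fst z" shows "m \<le> moll n u z \<and> moll n u z \<le> M"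
proof -
  obtain t x where z: "z = (t, x)" by (cases z)
  have tr: "moll n V (t, x + a) = (LINT y|lborel. V (y + (0, a)) * ker n (y - z))" for a
  proof -
    have eq: "y + (0, a) - (t, x + a) = y - z" for y by (cases y) (simp add: z)
    have "(LINT y|lborel. V (y + (0, a)) * ker n (y + (0, a) - (t, x + a))) = (LINT y|lborel. V y * ker n (y - (t, x + a)))"
      by (rule integral_translate) measurable
    then show ?thesis by (simp only: eq moll_def)
  qed
  have iV: "integrable lborel (\<lambda>y. V (y + (0, a)) * ker n (y - z))" for a
  proof (rule moll_integrable)
    have c: "continuous_on UNIV (\<lambda>y. V (y + (0, a)))" by (rule continuous_on_compose2[OF V_cont]) (auto intro!: continuous_intros)
    show "(\<lambda>y. V (y + (0, a))) \<in> borel_measurable borel" "locally_bounded (\<lambda>y. V (y + (0, a)))"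
      using c by (auto intro: borel_measurable_continuous_onI continuous_locally_bounded)
  qed
  have diff: "m * a \<le> moll n V (t, x + a) - moll n V (t, x) \<and> moll n V (t, x + a) - moll n V (t, x) \<le> M * a" if a: "0 \<le> a" for a
  proof -
    have e: "moll n V (t, x + a) - moll n V (t, x) = (LINT y|lborel. (V (y + (0, a)) - V y) * ker n (y - z))"
    proof -
      have "moll n V (t, x) = (LINT y|lborel. V (y + (0, 0)) * ker n (y - z))" using tr[of 0] by simp
      then show ?thesis unfolding tr using iV[of a] iV[of 0] by (simp add: left_diff_distrib zero_prod_def[symmetric])
    qed
    have i: "integrable lborel (\<lambda>y. (V (y + (0, a)) - V y) * ker n (y - z))"
      using Bochner_Integration.integrable_diff[OF iV[of a] iV[of 0]] by (simp add: left_diff_distrib zero_prod_def[symmetric])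
    have s: "m * a \<le> V (y + (0, a)) - V y" "V (y + (0, a)) - V y \<le> M * a" for y
      using V_space_slope[OF a, of "fst y" "snd y"] by (cases y; simp)+
    have "(LINT y|lborel. (m * a) * ker n (y - z)) \<le> (LINT y|lborel. (V (y + (0, a)) - V y) * ker n (y - z))"
      "(LINT y|lborel. (V (y + (0, a)) - V y) * ker n (y - z)) \<le> (LINT y|lborel. (M * a) * ker n (y - z))"
      by (rule integral_mono, use ker_shift_integral in simp, rule i, rule mult_right_mono[OF s(1) ker_nonneg])
         (rule integral_mono, rule i, use ker_shift_integral in simp, rule mult_right_mono[OF s(2) ker_nonneg])
    then show ?thesis unfolding e using ker_shift_integral by simp
  qed
  have D: "((\<lambda>a. moll n V (t, x + a)) has_real_derivative moll n u z) (at 0)"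
  proof -
    have "((\<lambda>a. (t, x + a)) has_derivative (\<lambda>k. (0, k))) (at 0)" by (auto intro!: derivative_eq_intros)
    moreover have "(moll n V has_derivative (\<lambda>h. fst h * (- moll n (\<lambda>y. f (u y)) z) + snd h * moll n u z)) (at (t, x + 0))"
      using moll_V_derivative[OF t] by (simp add: z)
    ultimately have "((\<lambda>a. moll n V (t, x + a)) has_derivative (\<lambda>k. fst (0::real, k) * (- moll n (\<lambda>y. f (u y)) z) + snd (0::real, k) * moll n u z)) (at 0)"
      by (rule has_derivative_compose)
    then show ?thesis by (simp add: has_field_derivative_def mult.commute[of _ "moll n u z"])
  qed
  have up: "moll n u z \<le> M"
  proof (rule ccontr)
    assume "\<not> moll n u z \<le> M"
    then have "0 < moll n u z - M" by simp
    moreover have "((\<lambda>a. moll n V (t, x + a) - M * a) has_real_derivative moll n u z - M) (at 0)"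
      by (rule DERIV_diff[OF D]) (auto intro!: derivative_eq_intros)
    ultimately obtain d where d: "d > 0" "\<And>h. 0 < h \<Longrightarrow> h < d \<Longrightarrow> moll n V (t, x + 0) - M * 0 < moll n V (t, x + (0 + h)) - M * (0 + h)"
      using DERIV_pos_inc_right by blast
    show False using d(2)[of "d/2"] d(1) diff[of "d/2"] by simp
  qed
  have lo: "m \<le> moll n u z"
  proof (rule ccontr)
    assume "\<not> m \<le> moll n u z"
    then have "moll n u z - m < 0" by simp
    moreover have "((\<lambda>a. moll n V (t, x + a) - m * a) has_real_derivative moll n u z - m) (at 0)"
      by (rule DERIV_diff[OF D]) (auto intro!: derivative_eq_intros)
    ultimately obtain d where d: "d > 0" "\<And>h. 0 < h \<Longrightarrow> h < d \<Longrightarrow> moll n V (t, x + (0 + h)) - m * (0 + h) < moll n V (t, x + 0) - m * 0"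
      using DERIV_neg_dec_right by blast
    show False using d(2)[of "d/2"] d(1) diff[of "d/2"] by simp
  qed
  show ?thesis using up lo by simp
qed

text \<open>The constant \<open>L\<close> controls f only on {m..M}, so u has to stay there for the
  oscillation of the trace to be bounded by L (M - m). The bounds pass to a.e. limits of
  mollifications on each ball, and countably many balls suffice.\<close>

lemma u_range: "AE z in lborel. z \<in> half_plane \<longrightarrow> m \<le> u z \<and> u z \<le> M"
proof -
  have "AE z in lborel. norm z \<le> real R \<longrightarrow> (z \<in> half_plane \<longrightarrow> m \<le> u z \<and> u z \<le> M)" for R :: nat
  proof -
    obtain r where r: "strict_mono r" and rAE: "AE z in lborel. norm z \<le> R \<longrightarrow> (\<lambda>n. moll (r n) u z) \<longlonglongrightarrow> u z \<and> (\<lambda>n. moll (r n) u z) \<longlonglongrightarrow> u z"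
      using moll_AE_subseq[OF um um uB uB, of "real R"] by blast
    show ?thesis using rAE
    proof eventually_elim
      case (elim z)
      show ?case
      proof (intro impI)
        assume z: "norm z \<le> real R" "z \<in> half_plane"
        then have l: "(\<lambda>n. moll (r n) u z) \<longlonglongrightarrow> u z" and t: "0 < fst z" using elim by (auto simp: mem_Times_iff)
        have "\<forall>\<^sub>F n in sequentially. 1 / real (Suc n) < fst z" by (rule eventually_inverse_less[OF t])
        then have "\<forall>\<^sub>F n in sequentially. 1 / real (Suc (r n)) < fst z"
          using filterlim_subseq[OF r] by (rule eventually_compose_filterlim)
        then have ev: "\<forall>\<^sub>F n in sequentially. m \<le> moll (r n) u z \<and> moll (r n) u z \<le> M"
          by eventually_elim (rule moll_u_range)
        have "m \<le> u z" by (rule tendsto_lowerbound[OF l]) (use ev in \<open>auto elim: eventually_mono\<close>)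
        moreover have "u z \<le> M" by (rule tendsto_upperbound[OF l]) (use ev in \<open>auto elim: eventually_mono\<close>)
        ultimately show "m \<le> u z \<and> u z \<le> M" by simp
      qed
    qed
  qed
  then have "AE z in lborel. \<forall>R::nat. norm z \<le> real R \<longrightarrow> (z \<in> half_plane \<longrightarrow> m \<le> u z \<and> u z \<le> M)" by (subst AE_all_countable) blast
  then show ?thesis by eventually_elim (meson real_arch_simple)
qed

end

section \<open>Total variation of the trace\<close>

context convex_kruzkov_data begin

text \<open>One parameter e both regularises the flux and averages the datum. The averaged datum has
  no larger variation budget than v, its values stay in {m..M}, and the potential moves by at most B
  e. Only secant slopes are recorded about the approximation, since they are what survives as e
  tends to 0.\<close>

lemma trace_approximation:
  fixes v h :: "real \<Rightarrow> real"
  assumes v: "\<And>a b. a \<le> b \<Longrightarrow> v a \<le> v b" "\<And>y. 0 \<le> v y \<and> v y \<le> c"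
    and h: "AE y in lborel. u0 y = h y" "\<And>a b. a \<le> b \<Longrightarrow> \<bar>h b - h a\<bar> \<le> v b - v a"
    and e: "e > 0"
  shows "\<exists>\<phi>. (\<forall>t>0. \<bar>\<phi> t - V (t, x0)\<bar> \<le> B * e + t * e * K\<^sup>2) \<and>
    (\<forall>n l r. (\<forall>j\<le>n. 0 < l j \<and> l j < r j) \<and> (\<forall>j<n. r j \<le> l (Suc j)) \<longrightarrow>
       (\<Sum>j<n. max 0 (slope \<phi> (l (Suc j)) (r (Suc j)) - slope \<phi> (l j) (r j))) \<le> (L + 2 * B * e) * c)"
proof -
  obtain P where P: "\<And>x. (P has_real_derivative V0 x) (at x)" using continuous_antiderivative[OF V0_cont] by blast
  \<comment> \<open>The average of V0 over a window of length e, written with an antiderivative; it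
    is C^1 with derivative \<open>ud\<close>, a difference quotient of V0 and hence an average of
    u0.\<close>
  define Vd where "Vd y = (P (y + e) - P y) / e" for y
  define ud where "ud y = (V0 (y + e) - V0 y) / e" for y
  have Vd': "(Vd has_real_derivative ud y) (at y)" for y
  proof -
    have "((\<lambda>y. P (y + e)) has_real_derivative V0 (y + e)) (at y)" using P[of "y + e"] by (simp add: DERIV_shift)
    from DERIV_cdivide[OF DERIV_diff[OF this P[of y]], of e] show ?thesis by (simp add: Vd_def[abs_def] ud_def)
  qed
  have Vdc: "continuous_on S Vd" for S by (rule DERIV_continuous_on[OF has_field_derivative_at_within[OF Vd']])
  have close: "\<bar>Vd y - V0 y\<bar> \<le> B * e" for y
  proof -
    obtain \<xi> where \<xi>: "y < \<xi>" "\<xi> < y + e" "P (y + e) - P y = (y + e - y) * V0 \<xi>" using MVT2[of y "y + e" P V0] P e by auto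
    then have "Vd y = V0 \<xi>" using e by (simp add: Vd_def)
    then have "\<bar>Vd y - V0 y\<bar> \<le> B * \<bar>\<xi> - y\<bar>" using V0_Lipschitz[of \<xi> y] by simp
    also have "\<dots> \<le> B * e" using \<xi> B0 by (intro mult_left_mono) auto
    finally show ?thesis .
  qed
  have ud_range: "ud y \<in> {m..M}" for y using V0_slope[of e y] e by (auto simp: ud_def field_simps)
  have ud_B: "\<bar>ud y\<bar> \<le> B" for y using ud_range[of y] mM by auto
  have Vd_Lip: "\<bar>Vd a - Vd b\<bar> \<le> B * \<bar>a - b\<bar>" for a b
  proof -
    have "norm (Vd a - Vd b) \<le> B * norm (a - b)"
      by (rule field_differentiable_bound[of UNIV Vd ud]) (use Vd' ud_B in auto)
    then show ?thesis by simp
  qed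
  have [measurable]: "v \<in> borel_measurable borel" by (rule borel_measurable_mono) (simp add: mono_def v)
  have vi: "integrable lborel (\<lambda>r. indicator {0<..e} r * v (r + y))" for y
    by (rule integrable_mult_bounded[OF integrable_indicator_Ioc, where C=c]) (use v in auto)
  have ui: "integrable lborel (\<lambda>r. indicator {0<..e} r * u0 (r + y))" for y
    by (rule integrable_mult_bounded[OF integrable_indicator_Ioc _ u0B]) auto
  have ud_eq: "ud y = (LINT r|lborel. indicator {0<..e} r * u0 (r + y)) / e" for y
  proof -
    have "(LINT r|lborel. indicator {y<..y + e} (r + y) * u0 (r + y)) = (LINT s|lborel. indicator {y<..y + e} s * u0 s)"
      by (rule integral_translate) measurable
    moreover have "indicator {y<..y + e} (r + y) = (indicator {0<..e} r :: real)" for r by (auto simp: indicator_def)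
    ultimately show ?thesis using V0_diff[of y "y + e"] e by (simp add: ud_def)
  qed
  \<comment> \<open>The same average applied to v. It is again monotone with values in [0, c] and
    dominates the increments of \<open>ud\<close>.\<close>
  define vd where "vd y = (LINT r|lborel. indicator {0<..e} r * v (r + y)) / e" for y
  have vd_range: "0 \<le> vd y" "vd y \<le> c" for y
  proof -
    show "0 \<le> vd y" unfolding vd_def using v e by (intro divide_nonneg_pos integral_nonneg_AE) auto
    have "(LINT r|lborel. indicator {0<..e} r * v (r + y)) \<le> (LINT r|lborel. indicator {0<..e} r * c)"
      by (rule integral_mono[OF vi]) (use v in \<open>auto intro!: mult_left_mono\<close>)
    then show "vd y \<le> c" using e by (simp add: vd_def field_simps)
  qed
  have ud_vd: "\<bar>ud a - ud b\<bar> \<le> vd b - vd a" if ab: "a \<le> b" for a b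
  proof -
    have ae: "AE r in lborel. \<bar>u0 (r + b) - u0 (r + a)\<bar> \<le> v (r + b) - v (r + a)"
      using AE_lborel_translate[OF h(1), of a] AE_lborel_translate[OF h(1), of b]
      by eventually_elim (use h(2) ab in auto)
    have i: "integrable lborel (\<lambda>r. indicator {0<..e} r * (u0 (r + b) - u0 (r + a)))"
      using Bochner_Integration.integrable_diff[OF ui[of b] ui[of a]] by (simp add: right_diff_distrib)
    have j: "integrable lborel (\<lambda>r. indicator {0<..e} r * (v (r + b) - v (r + a)))"
      using Bochner_Integration.integrable_diff[OF vi[of b] vi[of a]] by (simp add: right_diff_distrib)
    have "\<bar>LINT r|lborel. indicator {0<..e} r * (u0 (r + b) - u0 (r + a))\<bar> \<le> (LINT r|lborel. \<bar>indicator {0<..e} r * (u0 (r + b) - u0 (r + a))\<bar>)"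
      by (rule integral_abs_bound)
    also have "\<dots> \<le> (LINT r|lborel. indicator {0<..e} r * (v (r + b) - v (r + a)))"
      by (rule integral_mono_AE[OF integrable_abs[OF i] j]) (use ae in \<open>eventually_elim, auto simp: abs_mult indicator_def\<close>)
    finally have "\<bar>LINT r|lborel. indicator {0<..e} r * (u0 (r + b) - u0 (r + a))\<bar> \<le> (LINT r|lborel. indicator {0<..e} r * (v (r + b) - v (r + a)))" .
    moreover have "ud b - ud a = (LINT r|lborel. indicator {0<..e} r * (u0 (r + b) - u0 (r + a))) / e"
      unfolding ud_eq using ui by (simp add: right_diff_distrib diff_divide_distrib)
    moreover have "vd b - vd a = (LINT r|lborel. indicator {0<..e} r * (v (r + b) - v (r + a))) / e"
      unfolding vd_def using vi by (simp add: right_diff_distrib diff_divide_distrib)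
    ultimately have "\<bar>ud b - ud a\<bar> \<le> vd b - vd a" using e by (simp add: divide_right_mono)
    then show ?thesis by (simp add: abs_minus_commute)
  qed
  have vd_mono: "vd a \<le> vd b" if "a \<le> b" for a b using ud_vd[OF that] by linarith
  \<comment> \<open>L for f plus the Lipschitz constant of the square term on [-B, B], where the
    values of \<open>ud\<close> lie.\<close>
  define Le where "Le = L + 2 * B * e"
  have Le: "Le \<ge> 0" using f_L B0 e by (simp add: Le_def)
  have feL: "\<bar>fe e (ud a) - fe e (ud b)\<bar> \<le> Le * \<bar>ud a - ud b\<bar>" for a b
  proof -
    have "\<bar>fe e (ud a) - fe e (ud b)\<bar> \<le> \<bar>f (ud a) - f (ud b)\<bar> + \<bar>e * (ud a)\<^sup>2 - e * (ud b)\<^sup>2\<bar>" by linarith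
    also have "\<dots> \<le> L * \<bar>ud a - ud b\<bar> + (2 * B * e) * \<bar>ud a - ud b\<bar>"
      using e by (intro add_mono f_L square_Lip ud_range ud_B) auto
    finally show ?thesis by (simp add: Le_def algebra_simps)
  qed
  interpret fl: sc_flux "fe e" K "Fe e" "F0e e" e by (rule fe_sc(1)[OF e])
  interpret fr: sc_flux "\<lambda>p. fe e (- p)" K "Fe e" "F0e e" e by (rule fe_sc(2)[OF e])
  obtain A A1 NA where
    A: "\<And>t. t > 0 \<Longrightarrow> (\<forall>z\<ge>0. A t \<le> Vd (x0 - z) + fl.G t z) \<and> (\<exists>z\<ge>0. A t = Vd (x0 - z) + fl.G t z)"
    and NA: "\<And>t. t > 0 \<Longrightarrow> 0 \<le> NA t \<and> NA t \<le> Le * vd x0"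
    and A1: "\<And>t s. \<lbrakk>t > 0; s > 0\<rbrakk> \<Longrightarrow> A1 t + NA t * (s - t) \<le> A1 s"
    and AA1: "\<And>t. t > 0 \<Longrightarrow> \<exists>k. \<forall>s>0. A s - A1 s \<le> A t - A1 t + k * (s - t)"
  proof -
    have "\<exists>A A1 N. (\<forall>t>0. (\<forall>z\<ge>0. A t \<le> Vd (x0 - z) + fl.G t z) \<and> (\<exists>z\<ge>0. A t = Vd (x0 - z) + fl.G t z)) \<and>
     (\<forall>t>0. 0 \<le> N t \<and> N t \<le> Le * vd x0) \<and> (\<forall>t>0. \<forall>s>0. A1 t + N t * (s - t) \<le> A1 s) \<and>
     (\<forall>t>0. \<exists>k. \<forall>s>0. A s - A1 s \<le> A t - A1 t + k * (s - t))"
    \<comment> \<open>With z = x0 - y the half-line of feet to the left becomes z \<ge> 0;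
      \<open>Nh\<close> is the variation budget between the foot and x0.\<close>
    proof (rule fl.half_line_semiconcave[where ?K0.0=B and r="\<lambda>z. ud (x0 - z)" and Nh="\<lambda>z. vd x0 - vd (x0 - z)"])
      show "continuous_on {0..} (\<lambda>z. Vd (x0 - z))" by (rule continuous_on_compose2[OF Vdc[of UNIV]]) (auto intro!: continuous_intros)
      show "Vd (x0 - 0) - B * z \<le> Vd (x0 - z)" if "z \<ge> 0" for z using Vd_Lip[of "x0" "x0 - z"] that by (simp add: abs_le_iff)
      show "((\<lambda>z. Vd (x0 - z)) has_real_derivative - ud (x0 - z)) (at z)" for z
      proof -
        have "((\<lambda>z. x0 - z) has_real_derivative -1) (at z)" by (auto intro!: derivative_eq_intros)
        from DERIV_chain'[OF this Vd'] show ?thesis by simp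
      qed
      show "\<bar>fe e (ud (x0 - z)) - fe e (ud (x0 - z'))\<bar> \<le> Le * \<bar>ud (x0 - z) - ud (x0 - z')\<bar>" for z z' by (rule feL)
      show "\<bar>ud (x0 - z) - ud (x0 - z')\<bar> \<le> vd x0 - vd (x0 - z') - (vd x0 - vd (x0 - z))" if "z \<le> z'" for z z'
        using ud_vd[of "x0 - z'" "x0 - z"] that by (simp add: abs_minus_commute)
    qed (use Le vd_mono vd_range in auto)
    then obtain A A1 N where *: "\<forall>t>0. (\<forall>z\<ge>0. A t \<le> Vd (x0 - z) + fl.G t z) \<and> (\<exists>z\<ge>0. A t = Vd (x0 - z) + fl.G t z)"
      "\<forall>t>0. 0 \<le> N t \<and> N t \<le> Le * vd x0" "\<forall>t>0. \<forall>s>0. A1 t + N t * (s - t) \<le> A1 s"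
      "\<forall>t>0. \<exists>k. \<forall>s>0. A s - A1 s \<le> A t - A1 t + k * (s - t)" by (elim exE conjE) (rule that)
    show ?thesis by (rule that[of A N A1]) (use * in blast)+
  qed
  obtain Bt B1 NB where
    Bt: "\<And>t. t > 0 \<Longrightarrow> (\<forall>z\<ge>0. Bt t \<le> Vd (x0 + z) + fr.G t z) \<and> (\<exists>z\<ge>0. Bt t = Vd (x0 + z) + fr.G t z)"
    and NB: "\<And>t. t > 0 \<Longrightarrow> 0 \<le> NB t \<and> NB t \<le> Le * (c - vd x0)"
    and B1: "\<And>t s. \<lbrakk>t > 0; s > 0\<rbrakk> \<Longrightarrow> B1 t + NB t * (s - t) \<le> B1 s"
    and BB1: "\<And>t. t > 0 \<Longrightarrow> \<exists>k. \<forall>s>0. Bt s - B1 s \<le> Bt t - B1 t + k * (s - t)"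
  proof -
    have "\<exists>A A1 N. (\<forall>t>0. (\<forall>z\<ge>0. A t \<le> Vd (x0 + z) + fr.G t z) \<and> (\<exists>z\<ge>0. A t = Vd (x0 + z) + fr.G t z)) \<and>
     (\<forall>t>0. 0 \<le> N t \<and> N t \<le> Le * (c - vd x0)) \<and> (\<forall>t>0. \<forall>s>0. A1 t + N t * (s - t) \<le> A1 s) \<and>
     (\<forall>t>0. \<exists>k. \<forall>s>0. A s - A1 s \<le> A t - A1 t + k * (s - t))"
    \<comment> \<open>On the right z = y - x0 reverses orientation, so slopes change sign and the
      flux becomes p |-> fe e (-p). The budgets vd x0 on the left and c - vd x0 on the right add up
      to c.\<close>
    proof (rule fr.half_line_semiconcave[where ?K0.0=B and r="\<lambda>z. - ud (x0 + z)" and Nh="\<lambda>z. vd (x0 + z) - vd x0"])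
      show "continuous_on {0..} (\<lambda>z. Vd (x0 + z))" by (rule continuous_on_compose2[OF Vdc[of UNIV]]) (auto intro!: continuous_intros)
      show "Vd (x0 + 0) - B * z \<le> Vd (x0 + z)" if "z \<ge> 0" for z using Vd_Lip[of "x0" "x0 + z"] that by (simp add: abs_le_iff)
      show "((\<lambda>z. Vd (x0 + z)) has_real_derivative - (- ud (x0 + z))) (at z)" for z
      proof -
        have "((\<lambda>z. x0 + z) has_real_derivative 1) (at z)" by (auto intro!: derivative_eq_intros)
        from DERIV_chain'[OF this Vd'] show ?thesis by simp
      qed
      show "\<bar>fe e (- (- ud (x0 + z))) - fe e (- (- ud (x0 + z')))\<bar> \<le> Le * \<bar>- ud (x0 + z) - - ud (x0 + z')\<bar>" for z z'
        using feL[of "x0 + z" "x0 + z'"] by (simp add: abs_minus_commute)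
      show "\<bar>- ud (x0 + z) - - ud (x0 + z')\<bar> \<le> vd (x0 + z') - vd x0 - (vd (x0 + z) - vd x0)" if "z \<le> z'" for z z'
        using ud_vd[of "x0 + z" "x0 + z'"] that by (simp add: abs_minus_commute)
    qed (use Le vd_mono vd_range in auto)
    then obtain A A1 N where *: "\<forall>t>0. (\<forall>z\<ge>0. A t \<le> Vd (x0 + z) + fr.G t z) \<and> (\<exists>z\<ge>0. A t = Vd (x0 + z) + fr.G t z)"
      "\<forall>t>0. 0 \<le> N t \<and> N t \<le> Le * (c - vd x0)" "\<forall>t>0. \<forall>s>0. A1 t + N t * (s - t) \<le> A1 s"
      "\<forall>t>0. \<exists>k. \<forall>s>0. A s - A1 s \<le> A t - A1 t + k * (s - t)" by (elim exE conjE) (rule that)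
    show ?thesis by (rule that[of A N A1]) (use * in blast)+
  qed
  define \<phi> where "\<phi> t = min (A t) (Bt t)" for t
  have frG: "fr.G t z = fl.G t (- z)" for t z by (rule legendre_reflect[symmetric])
  have "\<bar>\<phi> t - V (t, x0)\<bar> \<le> B * e + t * e * K\<^sup>2" if t: "t > 0" for t
  proof -
    have te: "0 \<le> t * e * K\<^sup>2" using t e by simp
    have ub: "V (t, x0) \<le> Vd y + fl.G t (x0 - y) + (B * e + t * e * K\<^sup>2)" for y
      using HL_upper[OF e t, of x0 y] close[of y] by linarith
    obtain z where "A t = Vd (x0 - z) + fl.G t z" using A[OF t] by blast
    then have 1: "V (t, x0) \<le> A t + (B * e + t * e * K\<^sup>2)" using ub[of "x0 - z"] by simp
    obtain z' where "Bt t = Vd (x0 + z') + fr.G t z'" using Bt[OF t] by blast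
    then have "Bt t = Vd (x0 + z') + fl.G t (- z')" unfolding frG .
    then have 2: "V (t, x0) \<le> Bt t + (B * e + t * e * K\<^sup>2)" using ub[of "x0 + z'"] by simp
    have 3: "\<phi> t - B * e \<le> V (t, x0)"
    proof (rule HL_lower[OF e t])
      fix y
      have "\<phi> t \<le> Vd y + fl.G t (x0 - y)"
      proof (cases "y \<le> x0")
        case True
        then have "A t \<le> Vd (x0 - (x0 - y)) + fl.G t (x0 - y)" by (intro A[OF t, THEN conjunct1, rule_format]) simp
        then show ?thesis by (simp add: \<phi>_def min_le_iff_disj)
      next
        case False
        then have "Bt t \<le> Vd (x0 + (y - x0)) + fr.G t (y - x0)" by (intro Bt[OF t, THEN conjunct1, rule_format]) simp
        then have "Bt t \<le> Vd (x0 + (y - x0)) + fl.G t (- (y - x0))" unfolding frG .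
        then show ?thesis by (simp add: \<phi>_def min_le_iff_disj)
      qed
      then show "\<phi> t - B * e \<le> V0 y + fl.G t (x0 - y)" using close[of y] by linarith
    qed
    have "V (t, x0) \<le> \<phi> t + (B * e + t * e * K\<^sup>2)" using 1 2 by (simp add: \<phi>_def min_def)
    then show ?thesis using 3 te by (simp add: abs_le_iff)
  qed
  moreover have "(\<Sum>j<n. max 0 (slope \<phi> (l (Suc j)) (r (Suc j)) - slope \<phi> (l j) (r j))) \<le> Le * c"
    if lr: "\<forall>j\<le>n. 0 < l j \<and> l j < r j" "\<forall>j<n. r j \<le> l (Suc j)" for n and l r :: "nat \<Rightarrow> real"
  proof (rule slope_positive_variation[where M="\<lambda>t. A1 t + B1 t" and N="\<lambda>t. NA t + NB t"])
    show "0 \<le> NA t + NB t \<and> NA t + NB t \<le> Le * c" if "t > 0" for t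
      using NA[OF that] NB[OF that] by (simp add: algebra_simps)
    show "A1 t + B1 t + (NA t + NB t) * (s - t) \<le> A1 s + B1 s" if "t > 0" "s > 0" for t s
      using A1[OF that] B1[OF that] by (simp add: algebra_simps)
    \<comment> \<open>The minimum keeps the structure with convex part A1 + B1: at t take the
      supergradient of the active branch and subtract the subgradient of the other branch's convex
      part.\<close>
    show "\<forall>t>0. \<exists>k. \<forall>s>0. \<phi> s - (A1 s + B1 s) \<le> \<phi> t - (A1 t + B1 t) + k * (s - t)"
    proof (intro allI impI)
      fix t :: real assume t: "t > 0"
      show "\<exists>k. \<forall>s>0. \<phi> s - (A1 s + B1 s) \<le> \<phi> t - (A1 t + B1 t) + k * (s - t)"
      proof (cases "A t \<le> Bt t")
        case True
        obtain k where k: "\<And>s. s > 0 \<Longrightarrow> A s - A1 s \<le> A t - A1 t + k * (s - t)" using AA1[OF t] by blast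
        show ?thesis
        proof (intro exI[of _ "k - NB t"] allI impI)
          fix s :: real assume s: "s > 0"
          have "\<phi> s \<le> A s" "\<phi> t = A t" using True by (auto simp: \<phi>_def)
          then show "\<phi> s - (A1 s + B1 s) \<le> \<phi> t - (A1 t + B1 t) + (k - NB t) * (s - t)"
            using k[OF s] B1[OF t s] by (simp add: algebra_simps)
        qed
      next
        case False
        obtain k where k: "\<And>s. s > 0 \<Longrightarrow> Bt s - B1 s \<le> Bt t - B1 t + k * (s - t)" using BB1[OF t] by blast
        show ?thesis
        proof (intro exI[of _ "k - NA t"] allI impI)
          fix s :: real assume s: "s > 0"
          have "\<phi> s \<le> Bt s" "\<phi> t = Bt t" using False by (auto simp: \<phi>_def)
          then show "\<phi> s - (A1 s + B1 s) \<le> \<phi> t - (A1 t + B1 t) + (k - NA t) * (s - t)"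
            using k[OF s] A1[OF t s] by (simp add: algebra_simps)
        qed
      qed
    qed
  qed (use lr in auto)
  ultimately show ?thesis unfolding Le_def by (intro exI[of _ \<phi>]) blast
qed

text \<open>The approximations converge pointwise to V(., x0), hence so does each of the finitely
  many secant slopes, and the bound (L + 2 B e) c tends to L c.\<close>

lemma trace_positive_variation:
  fixes v h :: "real \<Rightarrow> real" and l r :: "nat \<Rightarrow> real"
  assumes v: "\<And>a b. a \<le> b \<Longrightarrow> v a \<le> v b" "\<And>y. 0 \<le> v y \<and> v y \<le> c"
    and h: "AE y in lborel. u0 y = h y" "\<And>a b. a \<le> b \<Longrightarrow> \<bar>h b - h a\<bar> \<le> v b - v a"
    and lr: "\<And>j. j \<le> n \<Longrightarrow> 0 < l j \<and> l j < r j" "\<And>j. j < n \<Longrightarrow> r j \<le> l (Suc j)"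
  shows "(\<Sum>j<n. max 0 (slope (\<lambda>t. V (t, x0)) (l (Suc j)) (r (Suc j)) - slope (\<lambda>t. V (t, x0)) (l j) (r j))) \<le> L * c"
proof -
  define e where "e k = 1 / real (Suc k)" for k
  have e: "e k > 0" for k by (simp add: e_def)
  have e0: "e \<longlonglongrightarrow> 0" unfolding e_def by (rule LIMSEQ_Suc[OF lim_1_over_n])
  have ex: "\<forall>k. \<exists>\<phi>. (\<forall>t>0. \<bar>\<phi> t - V (t, x0)\<bar> \<le> B * e k + t * e k * K\<^sup>2) \<and>
       (\<Sum>j<n. max 0 (slope \<phi> (l (Suc j)) (r (Suc j)) - slope \<phi> (l j) (r j))) \<le> (L + 2 * B * e k) * c"
  proof
    fix k
    have "\<exists>\<phi>. (\<forall>t>0. \<bar>\<phi> t - V (t, x0)\<bar> \<le> B * e k + t * e k * K\<^sup>2) \<and> (\<forall>n l r. (\<forall>j\<le>n. 0 < l j \<and> l j < r j) \<and> (\<forall>j<n. r j \<le> l (Suc j)) \<longrightarrow>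
        (\<Sum>j<n. max 0 (slope \<phi> (l (Suc j)) (r (Suc j)) - slope \<phi> (l j) (r j))) \<le> (L + 2 * B * e k) * c)"
      by (rule trace_approximation[where v=v and h=h]) (use v h e in auto)
    then obtain \<phi> where a: "\<forall>t>0. \<bar>\<phi> t - V (t, x0)\<bar> \<le> B * e k + t * e k * K\<^sup>2"
      and b: "\<forall>n l r. (\<forall>j\<le>n. 0 < l j \<and> l j < r j) \<and> (\<forall>j<n. r j \<le> l (Suc j)) \<longrightarrow>
        (\<Sum>j<n. max 0 (slope \<phi> (l (Suc j)) (r (Suc j)) - slope \<phi> (l j) (r j))) \<le> (L + 2 * B * e k) * c"
      by (elim exE conjE) (rule that)
    have "(\<Sum>j<n. max 0 (slope \<phi> (l (Suc j)) (r (Suc j)) - slope \<phi> (l j) (r j))) \<le> (L + 2 * B * e k) * c"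
      by (rule b[rule_format]) (use lr in auto)
    with a show "\<exists>\<phi>. (\<forall>t>0. \<bar>\<phi> t - V (t, x0)\<bar> \<le> B * e k + t * e k * K\<^sup>2) \<and>
       (\<Sum>j<n. max 0 (slope \<phi> (l (Suc j)) (r (Suc j)) - slope \<phi> (l j) (r j))) \<le> (L + 2 * B * e k) * c"
      by (intro exI[of _ \<phi>] conjI)
  qed
  from choice[OF ex] obtain \<phi> where \<phi>0: "\<forall>k. (\<forall>t>0. \<bar>\<phi> k t - V (t, x0)\<bar> \<le> B * e k + t * e k * K\<^sup>2) \<and>
       (\<Sum>j<n. max 0 (slope (\<phi> k) (l (Suc j)) (r (Suc j)) - slope (\<phi> k) (l j) (r j))) \<le> (L + 2 * B * e k) * c" by (rule exE)
  have \<phi>: "\<And>k t. t > 0 \<Longrightarrow> \<bar>\<phi> k t - V (t, x0)\<bar> \<le> B * e k + t * e k * K\<^sup>2"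
    "\<And>k. (\<Sum>j<n. max 0 (slope (\<phi> k) (l (Suc j)) (r (Suc j)) - slope (\<phi> k) (l j) (r j))) \<le> (L + 2 * B * e k) * c"
    using \<phi>0 by auto
  have lim: "(\<lambda>k. \<phi> k t) \<longlonglongrightarrow> V (t, x0)" if t: "t > 0" for t
  proof -
    have "(\<lambda>k. B * e k + t * e k * K\<^sup>2) \<longlonglongrightarrow> B * 0 + t * 0 * K\<^sup>2" by (intro tendsto_intros e0)
    then have "(\<lambda>k. B * e k + t * e k * K\<^sup>2) \<longlonglongrightarrow> 0" by simp
    then have "(\<lambda>k. \<phi> k t - V (t, x0)) \<longlonglongrightarrow> 0"
      by (rule Lim_null_comparison[rotated]) (use \<phi>(1)[OF t] in auto)
    then show ?thesis by (simp add: LIM_zero_iff)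
  qed
  have ls: "(\<lambda>k. slope (\<phi> k) (l j) (r j)) \<longlonglongrightarrow> slope (\<lambda>t. V (t, x0)) (l j) (r j)" if "j \<le> n" for j
    unfolding slope_def using lr(1)[OF that] by (intro tendsto_intros lim) auto
  have "(\<lambda>k. \<Sum>j<n. max 0 (slope (\<phi> k) (l (Suc j)) (r (Suc j)) - slope (\<phi> k) (l j) (r j))) \<longlonglongrightarrow>
    (\<Sum>j<n. max 0 (slope (\<lambda>t. V (t, x0)) (l (Suc j)) (r (Suc j)) - slope (\<lambda>t. V (t, x0)) (l j) (r j)))"
    by (intro tendsto_sum tendsto_max tendsto_const tendsto_diff ls) auto
  moreover have "(\<lambda>k. (L + 2 * B * e k) * c) \<longlonglongrightarrow> (L + 2 * B * 0) * c" by (intro tendsto_intros e0)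
  ultimately show ?thesis using \<phi>(2) by (intro LIMSEQ_le) auto
qed

end

section \<open>Partition sums, the variation function and the choice of a representative\<close>

definition lvar :: "(real \<Rightarrow> real) \<Rightarrow> real list \<Rightarrow> real" where
  "lvar g xs = (\<Sum>i<length xs - 1. \<bar>g (xs ! Suc i) - g (xs ! i)\<bar>)"

lemma pvar_lvar: "pvar g S = (SUP xs \<in> {xs. sorted_wrt (<) xs \<and> set xs \<subseteq> S}. ereal (lvar g xs))"
  by (simp add: pvar_def lvar_def)

lemma lvar_snoc:
  assumes "xs \<noteq> []" shows "lvar g (xs @ [y]) = lvar g xs + \<bar>g y - g (last xs)\<bar>"
proof -
  obtain n where n: "length xs = Suc n" using assms by (cases xs) auto
  have "lvar g (xs @ [y]) = (\<Sum>i<Suc n. \<bar>g ((xs @ [y]) ! Suc i) - g ((xs @ [y]) ! i)\<bar>)" by (simp add: lvar_def n)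
  also have "\<dots> = (\<Sum>i<n. \<bar>g ((xs @ [y]) ! Suc i) - g ((xs @ [y]) ! i)\<bar>) + \<bar>g y - g (last xs)\<bar>"
    using assms n by (simp add: nth_append last_conv_nth)
  also have "(\<Sum>i<n. \<bar>g ((xs @ [y]) ! Suc i) - g ((xs @ [y]) ! i)\<bar>) = (\<Sum>i<n. \<bar>g (xs ! Suc i) - g (xs ! i)\<bar>)"
    by (rule sum.cong) (auto simp: nth_append n)
  also have "\<dots> = lvar g xs" by (simp add: lvar_def n)
  finally show ?thesis .
qed

lemma pvar_upper: "sorted_wrt (<) xs \<Longrightarrow> set xs \<subseteq> S \<Longrightarrow> ereal (lvar g xs) \<le> pvar g S"
  unfolding pvar_lvar by (rule SUP_upper) auto

lemma pvar_nonneg: "0 \<le> pvar g S"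
  using pvar_upper[of "[]" S g] by (simp add: lvar_def zero_ereal_def)

lemma pvar_mono: "S \<subseteq> S' \<Longrightarrow> pvar g S \<le> pvar g S'"
  unfolding pvar_def by (rule SUP_subset_mono) auto

text \<open>v(y) is the variation of h on {..y}. A partition of {..a} becomes one of {..b} by
  appending b, after inserting a where it is missing; the insertion does not decrease the sum, and
  the last step adds |h b - h a|.\<close>

lemma variation_function:
  assumes c: "pvar h UNIV \<le> ereal c"
  shows "\<exists>v. (\<forall>a b. a \<le> b \<longrightarrow> v a \<le> v b) \<and> (\<forall>y. 0 \<le> v y \<and> v y \<le> c) \<and> (\<forall>a b. a \<le> b \<longrightarrow> \<bar>h b - h a\<bar> \<le> v b - v a)"
proof -
  define v where "v y = real_of_ereal (pvar h {..y})" for y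
  have le: "pvar h {..y} \<le> ereal c" for y using pvar_mono[of "{..y}" UNIV h] c by (rule order_trans[OF _]) simp
  have fin: "pvar h {..y} = ereal (v y)" for y
    using le[of y] pvar_nonneg[of h "{..y}"] unfolding v_def by (cases "pvar h {..y}") auto
  have rng: "0 \<le> v y \<and> v y \<le> c" for y using le[of y] pvar_nonneg[of h "{..y}"] by (simp add: fin)
  have key: "\<bar>h b - h a\<bar> \<le> v b - v a" if ab: "a \<le> b" for a b
  proof (cases "a = b")
    case False
    then have ab: "a < b" using ab by simp
    have "lvar h xs \<le> v b - \<bar>h b - h a\<bar>" if xs: "sorted_wrt (<) xs" "set xs \<subseteq> {..a}" for xs
    proof -
      have up: "lvar h ys \<le> v b" if "sorted_wrt (<) ys" "set ys \<subseteq> {..b}" for ys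
        using pvar_upper[OF that, of h] by (simp add: fin)
      show ?thesis
      proof (cases "a \<in> set xs")
        case True
        then have ne: "xs \<noteq> []" by auto
        have "last xs = a"
        proof -
          obtain i where i: "i < length xs" "xs ! i = a" using True by (metis in_set_conv_nth)
          have "last xs = xs ! (length xs - 1)" using ne by (rule last_conv_nth)
          moreover have "i = length xs - 1"
          proof (rule ccontr)
            assume "i \<noteq> length xs - 1"
            then have "i < length xs - 1" using i by simp
            then have "a < xs ! (length xs - 1)" using xs(1) i by (auto simp: sorted_wrt_iff_nth_less)
            moreover have "xs ! (length xs - 1) \<in> {..a}" using xs(2) ne by (meson last_conv_nth last_in_set nth_mem subsetD diff_less length_greater_0_conv zero_less_one)
            ultimately show False by simp
          qed
          ultimately show ?thesis using i by simp
        qed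
        moreover have "lvar h (xs @ [b]) \<le> v b" by (rule up) (use xs ab in \<open>auto simp: sorted_wrt_append\<close>)
        ultimately show ?thesis using lvar_snoc[OF ne, of h b] by simp
      next
        case False
        have s: "sorted_wrt (<) ((xs @ [a]) @ [b])"
        proof -
          have "x < a" if "x \<in> set xs" for x
          proof -
            have "x \<le> a" "x \<noteq> a" using xs(2) that False by auto
            then show ?thesis by simp
          qed
          then show ?thesis using xs(1) ab by (auto simp: sorted_wrt_append intro: less_trans)
        qed
        have "lvar h ((xs @ [a]) @ [b]) \<le> v b" by (rule up[OF s]) (use xs ab in auto)
        moreover have "lvar h ((xs @ [a]) @ [b]) = lvar h (xs @ [a]) + \<bar>h b - h a\<bar>" using lvar_snoc[of "xs @ [a]" h b] by simp
        moreover have "lvar h xs \<le> lvar h (xs @ [a])" using lvar_snoc[of xs h a] by (cases "xs = []") (auto simp: lvar_def)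
        ultimately show ?thesis by simp
      qed
    qed
    then have "pvar h {..a} \<le> ereal (v b - \<bar>h b - h a\<bar>)" unfolding pvar_lvar by (intro SUP_least) auto
    then show ?thesis by (simp add: fin)
  qed simp
  have "v a \<le> v b" if "a \<le> b" for a b using key[OF that] by linarith
  then show ?thesis using rng key by blast
qed

lemma pvar_neg: "pvar (\<lambda>y. - g y) S = pvar g S"
proof -
  have "\<bar>- a - - b\<bar> = \<bar>a - b\<bar>" for a b :: real by simp
  then show ?thesis unfolding pvar_def by simp
qed

lemma TotVar_neg: "TotVar (\<lambda>y. - g y) S = TotVar g S"
proof -
  have le: "TotVar (\<lambda>y. - g y) S \<le> TotVar g S" for g
    unfolding TotVar_def
  proof (rule INF_greatest)
    fix h assume "h \<in> {h. AE y in lborel. y \<in> S \<longrightarrow> g y = h y}"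
    then have "(\<lambda>y. - h y) \<in> {h. AE y in lborel. y \<in> S \<longrightarrow> - g y = h y}" by auto
    then have "(INF h \<in> {h. AE y in lborel. y \<in> S \<longrightarrow> - g y = h y}. pvar h S) \<le> pvar (\<lambda>y. - h y) S" by (rule INF_lower)
    then show "(INF h \<in> {h. AE y in lborel. y \<in> S \<longrightarrow> - g y = h y}. pvar h S) \<le> pvar h S" by (simp add: pvar_neg)
  qed
  show ?thesis using le[of g] le[of "\<lambda>y. - g y"] by simp
qed

text \<open>From |x| = 2 max(0, x) - x. A one-sided variation bound together with an oscillation
  bound thus controls the full variation.\<close>

lemma sum_abs_eq_positive_part:
  fixes a :: "nat \<Rightarrow> real"
  shows "(\<Sum>j<n. \<bar>a (Suc j) - a j\<bar>) = 2 * (\<Sum>j<n. max 0 (a (Suc j) - a j)) - (a n - a 0)"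
proof -
  have "(\<Sum>j<n. \<bar>a (Suc j) - a j\<bar>) = (\<Sum>j<n. 2 * max 0 (a (Suc j) - a j) - (a (Suc j) - a j))"
    by (rule sum.cong) (auto simp: max_def)
  also have "\<dots> = 2 * (\<Sum>j<n. max 0 (a (Suc j) - a j)) - (\<Sum>j<n. a (Suc j) - a j)"
    by (simp add: sum_subtractf sum_distrib_left)
  also have "(\<Sum>j<n. a (Suc j) - a j) = a n - a 0" by (rule sum_lessThan_telescope)
  finally show ?thesis .
qed

context convex_kruzkov_data begin

text \<open>\<open>W t x0\<close> is meaningful only up to null sets of times, and a bad
  representative may have infinite pointwise variation. The representative used here takes at every
  t minus a cluster value of the right difference quotients of the potential; each partition sum is
  then approximated by secant slopes over disjoint intervals.\<close>

lemma trace_TotVar: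
  assumes v: "\<And>a b. a \<le> b \<Longrightarrow> v a \<le> v b" "\<And>y. 0 \<le> v y \<and> v y \<le> c"
    and h: "AE y in lborel. u0 y = h y" "\<And>a b. a \<le> b \<Longrightarrow> \<bar>h b - h a\<bar> \<le> v b - v a"
  shows "TotVar (\<lambda>t. W t x0) {0<..<T} \<le> ereal (2 * (L * c) + L * (M - m))"
proof -
  define \<phi> where "\<phi> t = V (t, x0)" for t
  obtain p1 where p1: "p1 \<in> {m..M}" "\<And>p. p \<in> {m..M} \<Longrightarrow> f p1 \<le> f p"
    using continuous_attains_inf[of "{m..M}" f] mM continuous_on_subset[OF f_cont] by auto
  obtain p2 where p2: "p2 \<in> {m..M}" "\<And>p. p \<in> {m..M} \<Longrightarrow> f p \<le> f p2"
    using continuous_attains_sup[of "{m..M}" f] mM continuous_on_subset[OF f_cont] by auto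
  have osc: "f p2 - f p1 \<le> L * (M - m)"
  proof -
    have "f p2 - f p1 \<le> L * \<bar>p2 - p1\<bar>" using f_L(1)[OF p2(1) p1(1)] by simp
    also have "\<dots> \<le> L * (M - m)" using p1(1) p2(1) f_L(2) by (intro mult_left_mono) auto
    finally show ?thesis .
  qed
  have fr: "AE z in lborel. z \<in> half_plane \<longrightarrow> f p1 \<le> f (u z) \<and> f (u z) \<le> f p2"
    using u_range by eventually_elim (use p1 p2 in auto)
  have sr: "slope \<phi> s t \<in> {- f p2..- f p1}" if "0 \<le> s" "s < t" for s t
    using W_range[OF fr, of s t x0] V_time[of s t x0] that unfolding slope_def \<phi>_def by (auto simp: field_simps)
  define w where "w t = indicator {0<..} t * W t x0" for t
  have wi: "w integrable_on cbox a b" for a b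
  proof -
    have "integrable lborel (\<lambda>t. indicator {0<..} t * W t x0 * indicator {a..b} t)"
      by (rule W_int) (auto intro: borel_integrable_atLeastAtMost[of a b "\<lambda>_. 1", simplified])
    then have "set_integrable lborel {a..b} w" by (simp add: set_integrable_def w_def mult.commute)
    then show ?thesis using set_borel_integral_eq_integral(1)[of "{a..b}" w] by simp
  qed
  obtain N where N: "negligible N" and Nd: "\<And>x e. \<lbrakk>x \<notin> N; 0 < e\<rbrakk> \<Longrightarrow> \<exists>d>0. \<forall>h. 0 < h \<and> h < d \<longrightarrow>
        norm (integral (cbox x (x + h *\<^sub>R One)) w /\<^sub>R h ^ DIM(real) - w x) < e"
    using integrable_ccontinuous_explicit[of w] wi by blast
  \<comment> \<open>Says that -y is a cluster value of the slopes over [t, t + s] as s decreases to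
    0; the sign is that of V_t = -W.\<close>
  define cl where "cl t y \<longleftrightarrow> (\<forall>e>0. \<forall>d>0. \<exists>s. 0 < s \<and> s < d \<and> \<bar>slope \<phi> t (t + s) + y\<bar> < e)" for t y
  \<comment> \<open>Outside the null set N, Lebesgue differentiation makes W(t, x0) itself such a
    value.\<close>
  have wcl: "cl t (W t x0)" if t: "t > 0" "t \<notin> N" for t unfolding cl_def
  proof (intro allI impI)
    fix e d :: real assume e: "e > 0" and d: "d > 0"
    obtain d' where d': "d' > 0" "\<And>s. 0 < s \<Longrightarrow> s < d' \<Longrightarrow> \<bar>integral {t..t + s} w / s - w t\<bar> < e"
      using Nd[OF t(2) e] by (auto simp: divide_inverse_commute)
    define s where "s = min d d' / 2"
    have s: "0 < s" "s < d" "s < d'" using d d'(1) by (auto simp: s_def)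
    have "integral {t..t + s} w = (LINT r|lborel. indicator {t<..t + s} r * W r x0)"
    proof -
      have si: "set_integrable lborel {t..t + s} w"
      proof -
        have "integrable lborel (\<lambda>r. indicator {0<..} r * W r x0 * indicator {t..t + s} r)"
          by (rule W_int) (auto intro: borel_integrable_atLeastAtMost[of t "t + s" "\<lambda>_. 1", simplified])
        then show ?thesis by (simp add: set_integrable_def w_def mult.commute)
      qed
      have "integral {t..t + s} w = (LINT r:{t..t + s}|lborel. w r)" using set_borel_integral_eq_integral(2)[OF si] by simp
      also have "\<dots> = (LINT r|lborel. indicator {t<..t + s} r * W r x0)" unfolding set_lebesgue_integral_def
      proof (rule integral_cong_AE)
        show "(\<lambda>r. indicator {t..t + s} r *\<^sub>R w r) \<in> borel_measurable lborel" using si by (simp add: set_integrable_def)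
        show "(\<lambda>r. indicator {t<..t + s} r * W r x0) \<in> borel_measurable lborel" using W_int_interval[of t "t + s" x0] t by simp
        show "AE r in lborel. indicator {t..t + s} r *\<^sub>R w r = indicator {t<..t + s} r * W r x0"
          using AE_lborel_singleton[of t] by eventually_elim (use t in \<open>auto simp: w_def indicator_def\<close>)
      qed
      finally show ?thesis .
    qed
    then have "slope \<phi> t (t + s) = - (integral {t..t + s} w / s)"
      using V_time[of t "t + s" x0] t s by (simp add: slope_def \<phi>_def)
    moreover have "w t = W t x0" using t by (simp add: w_def)
    ultimately have "\<bar>slope \<phi> t (t + s) + W t x0\<bar> < e" using d'(2)[OF s(1,3)] by (simp add: abs_minus_commute)
    then show "\<exists>s. 0 < s \<and> s < d \<and> \<bar>slope \<phi> t (t + s) + W t x0\<bar> < e" using s by blast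
  qed
  \<comment> \<open>At the exceptional times a cluster value exists by compactness, since all slopes
    lie in a fixed interval.\<close>
  have excl: "\<exists>y. cl t y" if t: "t > 0" for t
  proof -
    define a where "a n = slope \<phi> t (t + 1 / real (Suc n))" for n
    have "a n \<in> {- f p2..- f p1}" for n unfolding a_def using t by (intro sr) auto
    then obtain y r where y: "strict_mono r" "(a \<circ> r) \<longlonglongrightarrow> y"
      using compact_Icc[of "- f p2" "- f p1"] unfolding compact_def by meson
    have "cl t (- y)" unfolding cl_def
    proof (intro allI impI)
      fix e d :: real assume e: "e > 0" and d: "d > 0"
      have "\<forall>\<^sub>F n in sequentially. \<bar>a (r n) - y\<bar> < e" using tendstoD[OF y(2) e] by (simp add: dist_real_def)
      moreover have "\<forall>\<^sub>F n in sequentially. 1 / real (Suc (r n)) < d"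
        using filterlim_subseq[OF y(1)] by (rule eventually_compose_filterlim[OF eventually_inverse_less[OF d]])
      ultimately have "\<forall>\<^sub>F n in sequentially. \<bar>a (r n) - y\<bar> < e \<and> 1 / real (Suc (r n)) < d" by (rule eventually_conj)
      then obtain n where "\<bar>a (r n) - y\<bar> < e" "1 / real (Suc (r n)) < d" by (auto simp: eventually_sequentially)
      then show "\<exists>s. 0 < s \<and> s < d \<and> \<bar>slope \<phi> t (t + s) + - y\<bar> < e"
        by (intro exI[of _ "1 / real (Suc (r n))"]) (auto simp: a_def)
    qed
    then show ?thesis by blast
  qed
  define g where "g t = (if t \<in> N then (SOME y. cl t y) else W t x0)" for t
  have gcl: "cl t (g t)" if "t > 0" for t
    using wcl[OF that] someI_ex[OF excl[OF that]] by (simp add: g_def)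
  have "AE x in lebesgue. x \<notin> N" using N by (intro AE_not_in) (simp add: negligible_iff_null_sets)
  then have "AE x in lborel. x \<notin> N" by (simp add: AE_completion_iff)
  then have "AE t in lborel. t \<in> {0<..<T} \<longrightarrow> W t x0 = g t" by eventually_elim (simp add: g_def)
  then have "TotVar (\<lambda>t. W t x0) {0<..<T} \<le> pvar g {0<..<T}" unfolding TotVar_def by (intro INF_lower) simp
  also have "\<dots> \<le> ereal (2 * (L * c) + L * (M - m))" unfolding pvar_lvar
  proof (rule SUP_least)
    fix xs assume "xs \<in> {xs. sorted_wrt (<) xs \<and> set xs \<subseteq> {0<..<T}}"
    then have xs: "sorted_wrt (<) xs" "set xs \<subseteq> {0<..<T}" by auto
    have "lvar g xs \<le> 2 * (L * c) + L * (M - m)"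
    proof (cases "xs = []")
      case True
      have "0 \<le> 2 * (L * c) + L * (M - m)" using f_L(2) mM v(2)[of 0] by simp
      then show ?thesis using True by (simp add: lvar_def)
    next
      case False
      define n where "n = length xs - 1"
      have len: "length xs = Suc n" using False by (cases xs) (auto simp: n_def)
      define l where "l j = xs ! j" for j
      have lpos: "l j > 0" if "j \<le> n" for j
      proof -
        have "xs ! j \<in> set xs" using that len by (intro nth_mem) simp
        then show ?thesis using xs(2) by (auto simp: l_def)
      qed
      have lmono: "l j < l (Suc j)" if "j < n" for j
        using xs(1) that len by (auto simp: l_def sorted_wrt_iff_nth_less)
      show ?thesis
      proof (rule field_le_epsilon)
        fix e :: real assume e: "e > 0"
        \<comment> \<open>Each of the n increments involves two approximated values, so the total
          error 2 n e' is at most e.\<close>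
        define e' where "e' = e / (2 * (real n + 1))"
        have e': "e' > 0" using e by (simp add: e'_def)
        \<comment> \<open>Restricting the secant at each partition point to this length keeps the
          intervals disjoint; the last point has no successor, and any positive value
          serves.\<close>
        define gap where "gap j = (if j < n then l (Suc j) - l j else 1)" for j
        have "\<exists>s. 0 < s \<and> s < gap j \<and> \<bar>slope \<phi> (l j) (l j + s) + g (l j)\<bar> < e'" if "j \<le> n" for j
          using gcl[OF lpos[OF that]] e' lmono[of j] unfolding cl_def by (auto simp: gap_def)
        then obtain s where s: "\<And>j. j \<le> n \<Longrightarrow> 0 < s j" "\<And>j. j \<le> n \<Longrightarrow> s j < gap j"
          "\<And>j. j \<le> n \<Longrightarrow> \<bar>slope \<phi> (l j) (l j + s j) + g (l j)\<bar> < e'" by metis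
        define a where "a j = slope \<phi> (l j) (l j + s j)" for j
        have "(\<Sum>j<n. max 0 (a (Suc j) - a j)) \<le> L * c" unfolding a_def \<phi>_def[abs_def]
        proof (rule trace_positive_variation[where v=v and h=h])
          show "0 < l j \<and> l j < l j + s j" if "j \<le> n" for j using lpos[OF that] s(1)[OF that] by simp
          show "l j + s j \<le> l (Suc j)" if "j < n" for j using s(2)[of j] that by (simp add: gap_def)
        qed (use v h in auto)
        moreover have "a 0 \<in> {- f p2..- f p1}" "a n \<in> {- f p2..- f p1}" unfolding a_def
          using sr[of "l 0" "l 0 + s 0"] sr[of "l n" "l n + s n"] lpos[of 0] lpos[of n] s(1)[of 0] s(1)[of n] by auto
        ultimately have va: "(\<Sum>j<n. \<bar>a (Suc j) - a j\<bar>) \<le> 2 * (L * c) + L * (M - m)"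
          unfolding sum_abs_eq_positive_part using osc by auto
        have "lvar g xs = (\<Sum>j<n. \<bar>g (l (Suc j)) - g (l j)\<bar>)" by (simp add: lvar_def n_def l_def)
        also have "\<dots> \<le> (\<Sum>j<n. \<bar>a (Suc j) - a j\<bar> + 2 * e')"
        proof (rule sum_mono)
          fix j assume "j \<in> {..<n}"
          then show "\<bar>g (l (Suc j)) - g (l j)\<bar> \<le> \<bar>a (Suc j) - a j\<bar> + 2 * e'"
            using s(3)[of j] s(3)[of "Suc j"] unfolding a_def[symmetric] by auto
        qed
        also have "\<dots> = (\<Sum>j<n. \<bar>a (Suc j) - a j\<bar>) + real n * (2 * e')" by (simp add: sum.distrib)
        also have "real n * (2 * e') \<le> e" using e by (simp add: e'_def field_simps)
        finally show "lvar g xs \<le> 2 * (L * c) + L * (M - m) + e" using va by simp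
      qed
    qed
    then show "ereal (lvar g xs) \<le> ereal (2 * (L * c) + L * (M - m))" by simp
  qed
  finally show ?thesis .
qed

end

section \<open>Reduction of the original data to the normalised setting\<close>

lemma AE_lborel_const: "(AE x in (lborel :: real measure). P) \<longleftrightarrow> P"
proof
  assume "AE x in (lborel :: real measure). P"
  then have "P \<or> UNIV = ({} :: real set)" using AE_open_imp_empty[of "UNIV :: real set"] by (cases P) auto
  then show P by auto
qed simp

lemma BV_representative:
  assumes "BV u0" "e > 0"
  shows "\<exists>h. (AE y in lborel. u0 y = h y) \<and> pvar h UNIV \<le> ereal (real_of_ereal (TotVar u0 UNIV) + e)"
    and "0 \<le> real_of_ereal (TotVar u0 UNIV)"
proof -
  have nn: "0 \<le> TotVar u0 UNIV" unfolding TotVar_def by (rule INF_greatest) (rule pvar_nonneg)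
  then have eq: "TotVar u0 UNIV = ereal (real_of_ereal (TotVar u0 UNIV))"
    using assms(1) unfolding BV_def by (cases "TotVar u0 UNIV") auto
  have "TotVar u0 UNIV < ereal (real_of_ereal (TotVar u0 UNIV) + e)" using assms(2) by (subst eq) simp
  then obtain h where "h \<in> {h. AE y in lborel. y \<in> UNIV \<longrightarrow> u0 y = h y}" "pvar h UNIV < ereal (real_of_ereal (TotVar u0 UNIV) + e)"
    unfolding TotVar_def INF_less_iff by blast
  then show "\<exists>h. (AE y in lborel. u0 y = h y) \<and> pvar h UNIV \<le> ereal (real_of_ereal (TotVar u0 UNIV) + e)"
    by (intro exI[of _ h]) auto
  show "0 \<le> real_of_ereal (TotVar u0 UNIV)" using nn by (simp add: real_of_ereal_pos)
qed

text \<open>The two-sided bound makes the essential supremum finite as an extended real, so that its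
  conversion by \<open>real_of_ereal\<close> does not return a default value.\<close>

lemma ess_sup_bounds:
  assumes [measurable]: "g \<in> borel_measurable borel" and b: "AE y in lborel. - b \<le> g y" and a: "AE y in lborel. g y \<le> a"
  shows "AE y in lborel. g y \<le> ess_sup g" "- b \<le> ess_sup g" "ess_sup g \<le> a"
proof -
  define E where "E = esssup lborel (\<lambda>x. ereal (g x))"
  have ae: "AE y in lborel. ereal (g y) \<le> E" unfolding E_def by (rule esssup_AE)
  have up: "E \<le> ereal a" unfolding E_def by (rule esssup_I) (use a in auto)
  have "AE y in (lborel :: real measure). ereal (- b) \<le> E" using ae b
  proof eventually_elim
    case (elim y)
    then show ?case by (meson ereal_less_eq(3) order_trans)
  qed
  then have lo: "ereal (- b) \<le> E" by (simp only: AE_lborel_const)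
  have E: "E = ereal (ess_sup g)" unfolding ess_sup_def E_def[symmetric] using up lo by (cases E) auto
  show "AE y in lborel. g y \<le> ess_sup g" using ae by (simp add: E)
  show "- b \<le> ess_sup g" "ess_sup g \<le> a" using up lo by (auto simp: E)
qed

lemma ess_inf_neg: "ess_inf g = - ess_sup (\<lambda>y. - g y)" "ess_sup g = - ess_inf (\<lambda>y. - g y)"
  by (auto simp: ess_inf_def ess_sup_def)

lemma Cinf_partials_measurable:
  assumes "Cinf \<phi>"
  shows "dt \<phi> \<in> borel_measurable borel" "dx \<phi> \<in> borel_measurable borel" "(\<lambda>y. \<phi> (0, y)) \<in> borel_measurable borel"
proof -
  obtain g1 g2 where g: "\<And>z. (\<phi> has_derivative (\<lambda>h. fst h * g1 z + snd h * g2 z)) (at z)" "Cinf g1" "Cinf g2"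
    using Cinf_gradient[OF assms] by blast
  have "dt \<phi> = g1" "dx \<phi> = g2" using dt_dx_eq[OF g(1)] by auto
  then show "dt \<phi> \<in> borel_measurable borel" "dx \<phi> \<in> borel_measurable borel"
    using g Cinf_continuous by (auto intro: borel_measurable_continuous_onI)
  show "(\<lambda>y. \<phi> (0, y)) \<in> borel_measurable borel"
    by (rule borel_measurable_continuous_onI, rule continuous_on_compose2[OF Cinf_continuous[OF assms, of UNIV]]) (auto intro!: continuous_intros)
qed

text \<open>The positive variation contributes 2 L c and the oscillation L (M - m) \<le> L c, where
  c is the variation of a nearly optimal representative of the datum. Since \<open>TotVar\<close> is
  an infimum, c exceeds it by an arbitrary e > 0, removed at the end.\<close>

lemma TotVar_trace_convex:
  assumes C2: "C2 f" and cv: "\<And>v. 0 \<le> (deriv ^^ 2) f v" and bv: "BV u0"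
    and ks: "kruzkov_solution f u0 u" and ws: "weak_star_rep (\<lambda>t x. f (u t x)) W"
  shows "TotVar (\<lambda>t. W t x) {0<..<T} \<le> ereal (3 * real_of_ereal (TotVar u0 UNIV) * flux_lip f u0)"
proof -
  define TV where "TV = real_of_ereal (TotVar u0 UNIV)"
  define L where "L = flux_lip f u0"
  have D1: "(f has_real_derivative deriv f v) (at v)" for v
    using C2 unfolding C2_def by (simp add: DERIV_deriv_iff_field_differentiable)
  have D2: "(deriv f has_real_derivative deriv (deriv f) v) (at v)" for v
    using C2 unfolding C2_def by (simp add: DERIV_deriv_iff_field_differentiable)
  have cf: "continuous_on UNIV f" using D1 by (auto intro!: continuous_at_imp_continuous_on intro: DERIV_isCont)
  have cf': "continuous_on UNIV (deriv f)" using D2 by (auto intro!: continuous_at_imp_continuous_on intro: DERIV_isCont)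
  have conv: "convex_on UNIV f"
    by (rule f''_ge0_imp_convex[OF _ D1 D2]) (use cv in \<open>auto simp: numeral_2_eq_2\<close>)
  have [measurable]: "u0 \<in> borel_measurable borel" using bv by (auto simp: BV_def)
  define m where "m = ess_inf u0"
  define M where "M = ess_sup u0"
  have bound: "TotVar (\<lambda>t. W t x) {0<..<T} \<le> ereal (3 * (TV + e) * L)" if e: "e > 0" for e
  proof -
    define c where "c = TV + e"
    obtain h where h: "AE y in lborel. u0 y = h y" "pvar h UNIV \<le> ereal c"
      using BV_representative(1)[OF bv e] by (auto simp: c_def TV_def)
    obtain v where v: "\<And>a b. a \<le> b \<Longrightarrow> v a \<le> v b" "\<And>y. 0 \<le> v y \<and> v y \<le> c" "\<And>a b. a \<le> b \<Longrightarrow> \<bar>h b - h a\<bar> \<le> v b - v a"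
      using variation_function[OF h(2)] by blast
    have hc: "\<bar>h a - h b\<bar> \<le> c" for a b
      using v(3)[of a b] v(3)[of b a] v(2)[of a] v(2)[of b] by (cases "a \<le> b") (auto simp: abs_minus_commute)
    have up: "AE y in lborel. u0 y \<le> h b + c" for b using h(1) by eventually_elim (use hc[of _ b] in \<open>simp add: abs_le_iff algebra_simps\<close>)
    have lo: "AE y in lborel. - (c - h b) \<le> u0 y" for b using h(1) by eventually_elim (use hc[of _ b] in \<open>simp add: abs_le_iff algebra_simps\<close>)
    have Mle: "M \<le> h b + c" for b unfolding M_def by (rule ess_sup_bounds(3)[OF _ lo up]) simp
    have aeM: "AE y in lborel. u0 y \<le> M" unfolding M_def by (rule ess_sup_bounds(1)[OF _ lo[of 0] up[of 0]]) simp
    \<comment> \<open>Every value of h is at least M - c, hence so is u0 almost everywhere. This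
      yields M - m \<le> c, the step that turns the oscillation of the trace into a multiple of the
      variation.\<close>
    have lo': "AE y in lborel. - u0 y \<le> c - M" using h(1) by eventually_elim (use Mle in \<open>auto simp: algebra_simps\<close>)
    have up': "AE y in lborel. - (h 0 + c) \<le> - u0 y" using up[of 0] by eventually_elim simp
    have "AE y in lborel. - u0 y \<le> - m" and mM1: "- m \<le> c - M" and mlo: "- (h 0 + c) \<le> - m"
      unfolding m_def using ess_sup_bounds[OF _ up' lo'] by (simp_all add: ess_inf_neg(1))
    then have aem: "AE y in lborel. m \<le> u0 y" by simp
    have "AE y in (lborel :: real measure). m \<le> M" using aem aeM by eventually_elim simp
    then have mM: "m \<le> M" by (simp only: AE_lborel_const)
    obtain B1 where B1: "AE z in lborel. z \<in> half_plane \<longrightarrow> \<bar>u (fst z) (snd z)\<bar> \<le> B1" using ks unfolding kruzkov_solution_def by blast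
    define B where "B = max \<bar>B1\<bar> (max \<bar>m\<bar> \<bar>M\<bar>)"
    have B: "B1 \<le> B" "- B \<le> m" "M \<le> B" "B \<ge> 0" by (auto simp: B_def)
    define Fu where "Fu z = indicator half_plane z * u (fst z) (snd z)" for z
    have [measurable]: "Fu \<in> borel_measurable borel"
      using ks unfolding kruzkov_solution_def set_borel_measurable_def Fu_def by simp
    \<comment> \<open>Set to 0 outside the half-plane and wherever the bound B fails, so that the
      bound holds everywhere; on t > 0 this changes u only on a null set.\<close>
    define u' where "u' z = (if \<bar>Fu z\<bar> \<le> B then Fu z else 0)" for z
    have [measurable]: "u' \<in> borel_measurable borel" unfolding u'_def by measurable
    have u'u: "AE z in lborel. z \<in> half_plane \<longrightarrow> u' z = u (fst z) (snd z)" using B1 by eventually_elim (use B in \<open>auto simp: u'_def Fu_def\<close>)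
    \<comment> \<open>Clamping to the essential range changes u0 only on a null set and gives
      pointwise bounds by m and M.\<close>
    define u0' where "u0' y = max m (min M (u0 y))" for y
    have [measurable]: "u0' \<in> borel_measurable borel" unfolding u0'_def by measurable
    have u0'u0: "AE y in lborel. u0' y = u0 y" using aem aeM by eventually_elim (simp add: u0'_def)
    have u0'r: "m \<le> u0' y \<and> u0' y \<le> M" for y using mM by (auto simp: u0'_def)
    have "compact (f ` {-B..B})" by (intro compact_continuous_image continuous_on_subset[OF cf]) auto
    then obtain Bf where Bf0: "\<forall>y\<in>f ` {-B..B}. norm y \<le> Bf" using compact_imp_bounded bounded_iff by metis
    have Bf: "\<bar>f p\<bar> \<le> Bf" if "\<bar>p\<bar> \<le> B" for p
    proof -
      have "p \<in> {-B..B}" using that by auto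
      then show ?thesis using Bf0 by simp
    qed
    have "compact (deriv f ` {-(B+1)..B+1})" by (intro compact_continuous_image continuous_on_subset[OF cf']) auto
    then obtain F' where F'1: "\<forall>y\<in>deriv f ` {-(B+1)..B+1}. norm y \<le> F'" using compact_imp_bounded bounded_iff by metis
    have F': "\<bar>deriv f p\<bar> \<le> F'" if "\<bar>p\<bar> \<le> B + 1" for p
    proof -
      have "p \<in> {-(B+1)..B+1}" using that by auto
      then show ?thesis using F'1 by simp
    qed
    have F'0: "F' \<ge> 0" using F'[of 0] B by simp
    have bdd: "bdd_above ((\<lambda>v. \<bar>deriv f v\<bar>) ` {m..M})"
      by (intro bounded_imp_bdd_above compact_imp_bounded compact_continuous_image continuous_intros continuous_on_subset[OF cf']) auto
    have Lv: "\<bar>deriv f v\<bar> \<le> L" if "v \<in> {m..M}" for v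
      unfolding L_def flux_lip_def m_def[symmetric] M_def[symmetric] using that bdd by (intro cSup_upper) auto
    have L0: "L \<ge> 0" using Lv[of m] mM by simp
    interpret convex_kruzkov_data f u0' u' W B Bf m M L F'
    proof unfold_locales
      show "continuous_on UNIV f" by (rule cf)
      show "\<bar>f p\<bar> \<le> Bf" if "\<bar>p\<bar> \<le> B" for p by (rule Bf[OF that])
      show "u0' \<in> borel_measurable borel" "u' \<in> borel_measurable borel" by measurable
      show "\<bar>u0' y\<bar> \<le> B" for y using u0'r[of y] B by auto
      show "\<bar>u' z\<bar> \<le> B" for z using B by (auto simp: u'_def)
      show "AE z in lborel. z \<in> half_plane \<longrightarrow> W (fst z) (snd z) = f (u' z)"
      proof -
        have "AE z in lborel. z \<in> half_plane \<longrightarrow> W (fst z) (snd z) = f (u (fst z) (snd z))"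
          using ws unfolding weak_star_rep_def by blast
        then show ?thesis using u'u by eventually_elim auto
      qed
      show "set_borel_measurable lborel {0<..} (\<lambda>t. W t x)" "\<exists>M. AE t in lborel. 0 < t \<longrightarrow> \<bar>W t x\<bar> \<le> M" for x
        using ws unfolding weak_star_rep_def by blast+
      show "continuous_on UNIV (\<lambda>x. LINT t:{0<..}|lborel. W t x * g t)" if "set_integrable lborel {0<..} g" for g
        using ws that unfolding weak_star_rep_def by blast
      show "m \<le> u0' y \<and> u0' y \<le> M" for y by (rule u0'r)
      show "- B \<le> m" "m \<le> M" "M \<le> B" using B mM by auto
      show "convex_on UNIV f" by (rule conv)
      show "\<bar>f p - f q\<bar> \<le> F' * \<bar>p - q\<bar>" if "\<bar>p\<bar> \<le> B + 1" "\<bar>q\<bar> \<le> B + 1" for p q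
      proof -
        have "norm (f p - f q) \<le> F' * norm (p - q)"
          by (rule field_differentiable_bound[of "{-(B+1)..B+1}" f "deriv f"]) (use D1 F' that in \<open>auto intro: has_field_derivative_at_within simp: abs_le_iff\<close>)
        then show ?thesis by simp
      qed
      show "\<bar>f p - f q\<bar> \<le> L * \<bar>p - q\<bar>" if "p \<in> {m..M}" "q \<in> {m..M}" for p q
      proof -
        have "norm (f p - f q) \<le> L * norm (p - q)"
          by (rule field_differentiable_bound[of "{m..M}" f "deriv f"]) (use D1 Lv that in \<open>auto intro: has_field_derivative_at_within\<close>)
        then show ?thesis by simp
      qed
      show "F' \<ge> 0" "L \<ge> 0" by (rule F'0, rule L0)
      fix c :: real and \<phi> assume t: "test_fun \<phi>"
      have [measurable]: "f \<in> borel_measurable borel" by (rule borel_measurable_continuous_onI[OF cf])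
      have [measurable]: "dt \<phi> \<in> borel_measurable borel" "dx \<phi> \<in> borel_measurable borel" "(\<lambda>y. \<phi> (0, y)) \<in> borel_measurable borel"
        using Cinf_partials_measurable t by (auto simp: test_fun_def)
      have "(LINT z : half_plane | lborel. dt \<phi> z * \<bar>u (fst z) (snd z) - c\<bar> + dx \<phi> z * sgn (u (fst z) (snd z) - c) * (f (u (fst z) (snd z)) - f c))
        = (LINT z|lborel. indicator half_plane z * (dt \<phi> z * \<bar>Fu z - c\<bar> + dx \<phi> z * sgn (Fu z - c) * (f (Fu z) - f c)))"
        unfolding set_lebesgue_integral_def by (rule Bochner_Integration.integral_cong) (auto simp: Fu_def indicator_def)
      also have "\<dots> = (LINT z|lborel. indicator half_plane z * (dt \<phi> z * \<bar>u' z - c\<bar> + dx \<phi> z * sgn (u' z - c) * (f (u' z) - f c)))"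
      proof (rule integral_cong_AE)
        show "AE z in lborel. indicator half_plane z * (dt \<phi> z * \<bar>Fu z - c\<bar> + dx \<phi> z * sgn (Fu z - c) * (f (Fu z) - f c))
          = indicator half_plane z * (dt \<phi> z * \<bar>u' z - c\<bar> + dx \<phi> z * sgn (u' z - c) * (f (u' z) - f c))"
          using u'u by eventually_elim (auto simp: indicator_def Fu_def)
      qed measurable
      finally have 1: "(LINT z : half_plane | lborel. dt \<phi> z * \<bar>u (fst z) (snd z) - c\<bar> + dx \<phi> z * sgn (u (fst z) (snd z) - c) * (f (u (fst z) (snd z)) - f c))
        = (LINT z : half_plane | lborel. dt \<phi> z * \<bar>u' z - c\<bar> + dx \<phi> z * sgn (u' z - c) * (f (u' z) - f c))"
        by (simp add: set_lebesgue_integral_def)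
      have 2: "(LINT y | lborel. \<phi> (0, y) * \<bar>u0 y - c\<bar>) = (LINT y | lborel. \<phi> (0, y) * \<bar>u0' y - c\<bar>)"
      proof (rule integral_cong_AE)
        show "AE y in lborel. \<phi> (0, y) * \<bar>u0 y - c\<bar> = \<phi> (0, y) * \<bar>u0' y - c\<bar>" using u0'u0 by eventually_elim simp
      qed measurable
      show "0 \<le> (LINT z : half_plane | lborel. dt \<phi> z * \<bar>u' z - c\<bar> + dx \<phi> z * sgn (u' z - c) * (f (u' z) - f c))
        + (LINT y | lborel. \<phi> (0, y) * \<bar>u0' y - c\<bar>)"
        using ks t unfolding kruzkov_solution_def 1[symmetric] 2[symmetric] by blast
    qed
    have "AE y in lborel. u0' y = h y" using u0'u0 h(1) by eventually_elim simp
    then have "TotVar (\<lambda>t. W t x) {0<..<T} \<le> ereal (2 * (L * c) + L * (M - m))"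
      by (intro trace_TotVar[where v=v and h=h]) (use v in auto)
    also have "2 * (L * c) + L * (M - m) \<le> 3 * c * L"
    proof -
      have "L * (M - m) \<le> L * c" using mM1 L0 by (intro mult_left_mono) auto
      then show ?thesis by (simp add: algebra_simps)
    qed
    finally show ?thesis by (simp add: c_def)
  qed
  have "TotVar (\<lambda>t. W t x) {0<..<T} \<le> ereal (3 * TV * L) + ereal d" if d: "d > 0" for d
  proof -
    \<comment> \<open>Chosen so that 3 e L \<le> d; the added 1 covers L = 0.\<close>
    define e where "e = d / (3 * (\<bar>L\<bar> + 1))"
    have "e > 0" using d by (simp add: e_def)
    then have "TotVar (\<lambda>t. W t x) {0<..<T} \<le> ereal (3 * (TV + e) * L)" by (rule bound)
    also have "3 * (TV + e) * L \<le> 3 * TV * L + d"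
    proof -
      have "3 * e * L \<le> 3 * e * (\<bar>L\<bar> + 1)" using \<open>e > 0\<close> by (intro mult_left_mono) auto
      also have "\<dots> = d" by (simp add: e_def field_simps)
      finally show ?thesis by (simp add: algebra_simps)
    qed
    finally show ?thesis by simp
  qed
  then have "TotVar (\<lambda>t. W t x) {0<..<T} \<le> ereal (3 * TV * L)" by (rule ereal_le_epsilon2)
  then show ?thesis by (simp add: TV_def L_def)
qed

text \<open>The flux belonging to -u is -f(-v); its second derivative at v is minus that of f at -v,
  so a concave flux becomes convex.\<close>

lemma deriv_reflect:
  assumes "C2 f"
  shows "deriv (\<lambda>v. - f (- v)) = (\<lambda>v. deriv f (- v))" "deriv (\<lambda>v. deriv f (- v)) = (\<lambda>v. - deriv (deriv f) (- v))" "C2 (\<lambda>v. - f (- v))"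
proof -
  have D1: "((\<lambda>v. - f (- v)) has_real_derivative deriv f (- v)) (at v)" for v
  proof -
    have "(f has_real_derivative deriv f (- v)) (at (- v))" using assms unfolding C2_def by (simp add: DERIV_deriv_iff_field_differentiable)
    from DERIV_minus[OF DERIV_chain'[OF DERIV_minus[OF DERIV_ident] this]] show ?thesis by simp
  qed
  have D2: "((\<lambda>v. deriv f (- v)) has_real_derivative - deriv (deriv f) (- v)) (at v)" for v
  proof -
    have "(deriv f has_real_derivative deriv (deriv f) (- v)) (at (- v))" using assms unfolding C2_def by (simp add: DERIV_deriv_iff_field_differentiable)
    from DERIV_chain'[OF DERIV_minus[OF DERIV_ident] this] show ?thesis by simp
  qed
  show 1: "deriv (\<lambda>v. - f (- v)) = (\<lambda>v. deriv f (- v))" using D1 by (auto intro: DERIV_imp_deriv)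
  show 2: "deriv (\<lambda>v. deriv f (- v)) = (\<lambda>v. - deriv (deriv f) (- v))" using D2 by (auto intro: DERIV_imp_deriv)
  have "continuous_on UNIV (\<lambda>v. - deriv (deriv f) (- v))"
    using assms unfolding C2_def by (auto intro!: continuous_intros continuous_on_compose2[of UNIV "deriv (deriv f)"])
  then show "C2 (\<lambda>v. - f (- v))" unfolding C2_def 1 2 using D1 D2 by (auto simp: field_differentiable_def)
qed

text \<open>The entropy inequality for -u at level c is the one for u at level -c: the sign factor
  and the flux difference both change sign.\<close>

lemma kruzkov_solution_reflect:
  assumes "kruzkov_solution f u0 u"
  shows "kruzkov_solution (\<lambda>v. - f (- v)) (\<lambda>y. - u0 y) (\<lambda>t x. - u t x)"
  unfolding kruzkov_solution_def
proof (intro conjI allI impI)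
  have m: "(\<lambda>z. indicator half_plane z *\<^sub>R u (fst z) (snd z)) \<in> borel_measurable lborel"
    using assms unfolding kruzkov_solution_def set_borel_measurable_def by blast
  show "set_borel_measurable lborel half_plane (\<lambda>z. - u (fst z) (snd z))" unfolding set_borel_measurable_def
    using borel_measurable_uminus[OF m] by simp
  show "\<exists>M. AE z in lborel. z \<in> half_plane \<longrightarrow> \<bar>- u (fst z) (snd z)\<bar> \<le> M" using assms unfolding kruzkov_solution_def by simp
  fix c :: real and \<phi> assume "test_fun \<phi>"
  then have "0 \<le> (LINT z : half_plane | lborel. dt \<phi> z * \<bar>u (fst z) (snd z) - (- c)\<bar> + dx \<phi> z * sgn (u (fst z) (snd z) - (- c)) * (f (u (fst z) (snd z)) - f (- c)))
        + (LINT y | lborel. \<phi> (0, y) * \<bar>u0 y - (- c)\<bar>)"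
    using assms unfolding kruzkov_solution_def by blast
  moreover have "\<bar>- a - c\<bar> = \<bar>a - - c\<bar>" "sgn (- a - c) * (- f (- (- a)) - - f (- c)) = sgn (a - - c) * (f a - f (- c))" for a
    by (auto simp: sgn_if)
  ultimately show "0 \<le> (LINT z : half_plane | lborel. dt \<phi> z * \<bar>- u (fst z) (snd z) - c\<bar> + dx \<phi> z * sgn (- u (fst z) (snd z) - c) * (- f (- (- u (fst z) (snd z))) - - f (- c)))
        + (LINT y | lborel. \<phi> (0, y) * \<bar>- u0 y - c\<bar>)"
    by (simp only: mult.assoc)
qed

lemma weak_star_rep_reflect:
  assumes "weak_star_rep w W"
  shows "weak_star_rep (\<lambda>t x. - w t x) (\<lambda>t x. - W t x)"
  unfolding weak_star_rep_def
proof (intro conjI allI impI)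
  show "AE z in lborel. z \<in> half_plane \<longrightarrow> - W (fst z) (snd z) = - w (fst z) (snd z)" using assms unfolding weak_star_rep_def by simp
  fix x
  have m: "(\<lambda>t. indicator {0<..} t *\<^sub>R W t x) \<in> borel_measurable lborel"
    using assms unfolding weak_star_rep_def set_borel_measurable_def by blast
  show "set_borel_measurable lborel {0<..} (\<lambda>t. - W t x)" unfolding set_borel_measurable_def
    using borel_measurable_uminus[OF m] by simp
  show "\<exists>M. AE t in lborel. 0 < t \<longrightarrow> \<bar>- W t x\<bar> \<le> M" using assms unfolding weak_star_rep_def by simp
next
  fix g :: "real \<Rightarrow> real" assume "set_integrable lborel {0<..} g"
  then have "continuous_on UNIV (\<lambda>x. - (LINT t : {0<..} | lborel. W t x * g t))"
    using assms unfolding weak_star_rep_def by (intro continuous_on_minus) blast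
  then show "continuous_on UNIV (\<lambda>x. LINT t : {0<..} | lborel. - W t x * g t)" by (simp add: set_lebesgue_integral_def)
qed

theorem theorem1p1:
  "\<exists>C :: real \<Rightarrow> real \<Rightarrow> real.
     \<forall>f u0 u W. C2 f \<and> ((\<forall>v. (deriv ^^ 2) f v \<le> 0) \<or> (\<forall>v. (deriv ^^ 2) f v \<ge> 0)) \<and>
        BV u0 \<and> kruzkov_solution f u0 u \<and>
        weak_star_rep (\<lambda>t x. f (u t x)) W \<longrightarrow>
        (\<forall>x T. T > 0 \<longrightarrow>
           TotVar (\<lambda>t. W t x) {0<..<T} \<le> ereal (C (real_of_ereal (TotVar u0 UNIV)) (flux_lip f u0)))"
proof (intro exI[of _ "\<lambda>V L. 3 * V * L"] allI impI, elim conjE)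
  fix f u0 :: "real \<Rightarrow> real" and u W :: "real \<Rightarrow> real \<Rightarrow> real" and x T :: real
  assume C2: "C2 f" and cv: "(\<forall>v. (deriv ^^ 2) f v \<le> 0) \<or> (\<forall>v. (deriv ^^ 2) f v \<ge> 0)"
    and bv: "BV u0" and ks: "kruzkov_solution f u0 u" and ws: "weak_star_rep (\<lambda>t x. f (u t x)) W"
  show "TotVar (\<lambda>t. W t x) {0<..<T} \<le> ereal (3 * real_of_ereal (TotVar u0 UNIV) * flux_lip f u0)"
    using cv
  proof
    assume "\<forall>v. (deriv ^^ 2) f v \<ge> 0"
    then show ?thesis by (intro TotVar_trace_convex[OF C2 _ bv ks ws]) auto
  next
    assume neg: "\<forall>v. (deriv ^^ 2) f v \<le> 0"
    note r = deriv_reflect[OF C2]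
    have "TotVar (\<lambda>t. - W t x) {0<..<T} \<le> ereal (3 * real_of_ereal (TotVar (\<lambda>y. - u0 y) UNIV) * flux_lip (\<lambda>v. - f (- v)) (\<lambda>y. - u0 y))"
    proof (rule TotVar_trace_convex[OF r(3) _ _ kruzkov_solution_reflect[OF ks]])
      show "0 \<le> (deriv ^^ 2) (\<lambda>v. - f (- v)) v" for v using neg by (simp add: numeral_2_eq_2 r(1,2))
      show "BV (\<lambda>y. - u0 y)" using bv by (simp add: BV_def TotVar_neg)
      show "weak_star_rep (\<lambda>t x. - f (- (- u t x))) (\<lambda>t x. - W t x)" using weak_star_rep_reflect[OF ws] by simp
    qed
    moreover have "flux_lip (\<lambda>v. - f (- v)) (\<lambda>y. - u0 y) = flux_lip f u0"
    proof -
      \<comment> \<open>The essential range of -u0 is the reflected interval, and the derivative of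
        the reflected flux at v is that of f at -v, so the same values compete in the
        supremum.\<close>
      have "(\<lambda>v. \<bar>deriv f (- v)\<bar>) ` {- b..- a} = (\<lambda>v. \<bar>deriv f v\<bar>) ` {a..b}" for a b
      proof -
        have "{- b..- a} = uminus ` {a..b}" by simp
        then show ?thesis by (simp only: image_image minus_minus)
      qed
      then show ?thesis unfolding flux_lip_def r(1) using ess_inf_neg[of u0] ess_inf_neg[of "\<lambda>y. - u0 y"] by simp
    qed
    ultimately show ?thesis by (simp add: TotVar_neg)
  qed
qed

end
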